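(* Let $G$ be a pro-oligomorphic group, let $k$ be a commutative ring, let $\mu$ be a $k$-valued measure for $G$, and let $X$ be a finitary $\hat G$-set. Suppose that $k$ is reduced, that $\mu$ satisfies (P), and that $A\in\mathrm{Mat}_X(k)$ is nilpotent. Then $\mathrm{tr}(A)=0$.
   Context: A pro-oligomorphic group is a topological group $G$ that is Hausdorff, non-archimedean (its open subgroups form a neighborhood basis of the identity), and Roelcke precompact (in the presence of the previous condition: $U\backslash G/V$ is finite for all open subgroups $U,V$). A $G$-set is a set with a smooth action of $G$, i.e. every stabilizer is open (same convention for open subgroups). A set with a group action is finitary if it has finitely many orbits. A $\hat G$-set is a set $X$ with a smooth action of some open subgroup $U$ of $G$ (a group of definition), where shrinking $U$ does not change the $\hat G$-set; it is finitary if $U$ has finitely many orbits on $X$ (independent of $U$). Maps of $\hat G$-sets are functions equivariant for some common open group of definition. For $g\in G$, $X^g$ is the same set with action $h\bullet x=(g^{-1}hg)\cdot x$. A measure for $G$ with values in a commutative ring $k$ is a rule $\mu$ assigning to each finitary $\hat G$-set $X$ an element $\mu(X)\in k$ such that: (a) $\mu(X)=\mu(Y)$ if $X\cong Y$; (b) $\mu$ of a one-point set is $1$; (c) $\mu(X\amalg Y)=\mu(X)+\mu(Y)$; (d) $\mu(X^g)=\mu(X)$; (e) if $U$ is an open subgroup and $X\to Y$ is a map of transitive $U$-sets with fiber $F$ over some point, then $\mu(X)=\mu(F)\mu(Y)$. Property (P): a commutative ring $R$ satisfies (P) if for every finitely generated reduced $R$-algebra $R'$ one has $\bigcap\ker(\phi)=0$,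 the intersection over all homomorphisms $\phi$ from $R'$ to fields of positive characteristic. A measure $\mu$ satisfies (P) if the subring of $k$ generated by all values $\mu(X)$ is contained in a subring of $k$ that satisfies (P). A Schwartz function on a $\hat G$-set $X$ is a function $\phi\colon X\to k$ that is invariant under some group of definition of $X$ and whose support is a finitary $\hat G$-set; such $\phi$ takes finitely many non-zero values $c_1,\dots,c_n$, and $\int_X\phi(x)\,dx=\sum_i c_i\,\mu(\phi^{-1}(c_i))$. For a finitary $\hat G$-set $X$, $\mathrm{Mat}_X(k)$ is the set of Schwartz functions $A\colon X\times X\to k$; it is an associative unital $k$-algebra under $(AB)(x,z)=\int_X A(x,y)B(y,z)\,dy$, and $\mathrm{tr}(A)=\int_X A(x,x)\,dx$. *)

theory Defs
  imports "HOL-Analysis.T1_Spaces" "HOL-Algebra.Group_Action" "HOL-Algebra.Generated_Fields"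
    "HOL-Algebra.Weak_Morphisms"
begin

section \<open>Pro-oligomorphic groups\<close>

definition topological_group :: "('g, 'm) monoid_scheme \<Rightarrow> 'g topology \<Rightarrow> bool" where
  "topological_group G T \<longleftrightarrow>
     group G \<and> topspace T = carrier G \<and>
     continuous_map (prod_topology T T) T (\<lambda>(x, y). x \<otimes>\<^bsub>G\<^esub> y) \<and>
     continuous_map T T (\<lambda>x. inv\<^bsub>G\<^esub> x)"

definition open_subgroup :: "('g, 'm) monoid_scheme \<Rightarrow> 'g topology \<Rightarrow> 'g set \<Rightarrow> bool" where
  "open_subgroup G T U \<longleftrightarrow> subgroup U G \<and> openin T U"

definition pro_oligomorphic :: "('g, 'm) monoid_scheme \<Rightarrow> 'g topology \<Rightarrow> bool" where
  "pro_oligomorphic G T \<longleftrightarrow>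
     topological_group G T \<and> Hausdorff_space T \<and>
     (\<forall>N. openin T N \<and> \<one>\<^bsub>G\<^esub> \<in> N \<longrightarrow> (\<exists>U. open_subgroup G T U \<and> U \<subseteq> N)) \<and>
     (\<forall>U V. open_subgroup G T U \<and> open_subgroup G T V \<longrightarrow>
        finite {(U #>\<^bsub>G\<^esub> g) <#>\<^bsub>G\<^esub> V | g. g \<in> carrier G})"


section \<open>Sets with a germ of a smooth action\<close>

text \<open>A \<open>hat-G\<close>-set is represented by its underlying set together with one group of definition and
  its action.  Two representatives that differ by shrinking the group of definition are
  isomorphic in the sense of \<open>hat_isomorphic\<close> below, via the identity map.\<close>

record ('g, 'x) hat_set =
  hpoints :: "'x set"
  hgroup :: "'g set"
  hact :: "'g \<Rightarrow> 'x \<Rightarrow> 'x"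

definition is_hat_set :: "('g, 'm) monoid_scheme \<Rightarrow> 'g topology \<Rightarrow> ('g, 'x) hat_set \<Rightarrow> bool" where
  "is_hat_set G T X \<longleftrightarrow>
     open_subgroup G T (hgroup X) \<and>
     group_action (G\<lparr>carrier := hgroup X\<rparr>) (hpoints X) (hact X) \<and>
     (\<forall>x \<in> hpoints X. openin T (stabilizer (G\<lparr>carrier := hgroup X\<rparr>) (hact X) x))"

definition finitary_hat_set :: "('g, 'm) monoid_scheme \<Rightarrow> 'g topology \<Rightarrow> ('g, 'x) hat_set \<Rightarrow> bool" where
  "finitary_hat_set G T X \<longleftrightarrow>
     is_hat_set G T X \<and> finite (orbits (G\<lparr>carrier := hgroup X\<rparr>) (hpoints X) (hact X))"

definition hat_map ::
  "('g, 'm) monoid_scheme \<Rightarrow> 'g topology \<Rightarrow> ('g, 'x) hat_set \<Rightarrow> ('g, 'y) hat_set \<Rightarrow> ('x \<Rightarrow> 'y) \<Rightarrow> bool" where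
  "hat_map G T X Y f \<longleftrightarrow>
     f \<in> hpoints X \<rightarrow> hpoints Y \<and>
     (\<exists>V. open_subgroup G T V \<and> V \<subseteq> hgroup X \<inter> hgroup Y \<and>
        (\<forall>v \<in> V. \<forall>x \<in> hpoints X. f (hact X v x) = hact Y v (f x)))"

definition hat_isomorphic ::
  "('g, 'm) monoid_scheme \<Rightarrow> 'g topology \<Rightarrow> ('g, 'x) hat_set \<Rightarrow> ('g, 'y) hat_set \<Rightarrow> bool" where
  "hat_isomorphic G T X Y \<longleftrightarrow> (\<exists>f. hat_map G T X Y f \<and> bij_betw f (hpoints X) (hpoints Y))"

definition hat_conj ::
  "('g, 'm) monoid_scheme \<Rightarrow> 'g \<Rightarrow> ('g, 'x) hat_set \<Rightarrow> ('g, 'x) hat_set" where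
  "hat_conj G g X =
     \<lparr>hpoints = hpoints X,
      hgroup = {g \<otimes>\<^bsub>G\<^esub> u \<otimes>\<^bsub>G\<^esub> inv\<^bsub>G\<^esub> g | u. u \<in> hgroup X},
      hact = (\<lambda>h. hact X (inv\<^bsub>G\<^esub> g \<otimes>\<^bsub>G\<^esub> h \<otimes>\<^bsub>G\<^esub> g))\<rparr>"

definition hat_sum :: "('g, 'x) hat_set \<Rightarrow> ('g, 'y) hat_set \<Rightarrow> ('g, 'x + 'y) hat_set" where
  "hat_sum X Y =
     \<lparr>hpoints = Sum_Type.Plus (hpoints X) (hpoints Y),
      hgroup = hgroup X \<inter> hgroup Y,
      hact = (\<lambda>g. \<lambda>z \<in> Sum_Type.Plus (hpoints X) (hpoints Y). map_sum (hact X g) (hact Y g) z)\<rparr>"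

definition hat_prod :: "('g, 'x) hat_set \<Rightarrow> ('g, 'y) hat_set \<Rightarrow> ('g, 'x \<times> 'y) hat_set" where
  "hat_prod X Y =
     \<lparr>hpoints = hpoints X \<times> hpoints Y,
      hgroup = hgroup X \<inter> hgroup Y,
      hact = (\<lambda>g. \<lambda>z \<in> hpoints X \<times> hpoints Y. map_prod (hact X g) (hact Y g) z)\<rparr>"

text \<open>A subset \<open>S\<close> of \<open>X\<close> is a \<open>hat-G\<close>-subset iff it is stable under some open subgroup of the group
  of definition.  Its setwise stabilizer is then the largest such subgroup, and is
  used as group of definition; for a fiber of an equivariant map it contains the stabilizer of
  the base point.\<close>

definition hat_sub :: "('g, 'x) hat_set \<Rightarrow> 'x set \<Rightarrow> ('g, 'x) hat_set" where
  "hat_sub X S =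
     \<lparr>hpoints = S,
      hgroup = {g \<in> hgroup X. hact X g ` S = S},
      hact = (\<lambda>g. restrict (hact X g) S)\<rparr>"


section \<open>Measures\<close>

text \<open>A measure is a function on all finitary \<open>hat-G\<close>-sets.  Every finitary \<open>hat-G\<close>-set is isomorphic to a
  finite disjoint union of coset spaces \<open>U/V\<close>, hence to one whose points are of type
  \<open>nat \<times> 'g set\<close> (see \<open>hat_universe\<close> below).  We therefore take measures to be functions on
  these, and extend them to an arbitrary finitary \<open>hat-G\<close>-set along an isomorphism.\<close>

type_synonym ('g, 'k) hat_fun = "('g, nat \<times> 'g set) hat_set \<Rightarrow> 'k"

definition mval ::
  "('g, 'm) monoid_scheme \<Rightarrow> 'g topology \<Rightarrow> ('g, 'k) hat_fun \<Rightarrow> ('g, 'x) hat_set \<Rightarrow> 'k" where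
  "mval G T \<mu> X = \<mu> (SOME Y. finitary_hat_set G T Y \<and> hat_isomorphic G T X Y)"

definition transitive_hat_set ::
  "('g, 'm) monoid_scheme \<Rightarrow> 'g topology \<Rightarrow> 'g set \<Rightarrow> ('g, 'x) hat_set \<Rightarrow> bool" where
  "transitive_hat_set G T U X \<longleftrightarrow>
     is_hat_set G T X \<and> hgroup X = U \<and> hpoints X \<noteq> {} \<and>
     transitive_action (G\<lparr>carrier := U\<rparr>) (hpoints X) (hact X)"

definition hat_measure ::
  "('g, 'm) monoid_scheme \<Rightarrow> 'g topology \<Rightarrow> ('k, 'n) ring_scheme \<Rightarrow> ('g, 'k) hat_fun \<Rightarrow> bool" where
  "hat_measure G T k \<mu> \<longleftrightarrow>
     (\<forall>X. finitary_hat_set G T X \<longrightarrow> \<mu> X \<in> carrier k) \<and>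
     (\<forall>X Y. finitary_hat_set G T X \<and> finitary_hat_set G T Y \<and> hat_isomorphic G T X Y \<longrightarrow>
        \<mu> X = \<mu> Y) \<and>
     (\<forall>X x. finitary_hat_set G T X \<and> hpoints X = {x} \<longrightarrow> \<mu> X = \<one>\<^bsub>k\<^esub>) \<and>
     (\<forall>X Y. finitary_hat_set G T X \<and> finitary_hat_set G T Y \<longrightarrow>
        mval G T \<mu> (hat_sum X Y) = \<mu> X \<oplus>\<^bsub>k\<^esub> \<mu> Y) \<and>
     (\<forall>X g. finitary_hat_set G T X \<and> g \<in> carrier G \<longrightarrow> \<mu> (hat_conj G g X) = \<mu> X) \<and>
     (\<forall>U X Y f y.
        open_subgroup G T U \<and> transitive_hat_set G T U X \<and> transitive_hat_set G T U Y \<and>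
        f \<in> hpoints X \<rightarrow> hpoints Y \<and>
        (\<forall>u \<in> U. \<forall>x \<in> hpoints X. f (hact X u x) = hact Y u (f x)) \<and>
        y \<in> hpoints Y \<longrightarrow>
        \<mu> X = \<mu> (hat_sub X {x \<in> hpoints X. f x = y}) \<otimes>\<^bsub>k\<^esub> \<mu> Y)"


section \<open>Schwartz functions, integration, and matrices\<close>

definition schwartz ::
  "('g, 'm) monoid_scheme \<Rightarrow> 'g topology \<Rightarrow> ('k, 'n) ring_scheme \<Rightarrow> ('g, 'x) hat_set \<Rightarrow> ('x \<Rightarrow> 'k) set" where
  "schwartz G T k X =
     {\<phi> \<in> hpoints X \<rightarrow>\<^sub>E carrier k.
        (\<exists>V. open_subgroup G T V \<and> V \<subseteq> hgroup X \<and>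
           (\<forall>v \<in> V. \<forall>x \<in> hpoints X. \<phi> (hact X v x) = \<phi> x)) \<and>
        finitary_hat_set G T (hat_sub X {x \<in> hpoints X. \<phi> x \<noteq> \<zero>\<^bsub>k\<^esub>})}"

definition hat_integral ::
  "('g, 'm) monoid_scheme \<Rightarrow> 'g topology \<Rightarrow> ('k, 'n) ring_scheme \<Rightarrow> ('g, 'k) hat_fun \<Rightarrow>
   ('g, 'x) hat_set \<Rightarrow> ('x \<Rightarrow> 'k) \<Rightarrow> 'k" where
  "hat_integral G T k \<mu> X \<phi> =
     (\<Oplus>\<^bsub>k\<^esub>c \<in> \<phi> ` hpoints X - {\<zero>\<^bsub>k\<^esub>}.
        c \<otimes>\<^bsub>k\<^esub> mval G T \<mu> (hat_sub X {x \<in> hpoints X. \<phi> x = c}))"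

definition hat_mat ::
  "('g, 'm) monoid_scheme \<Rightarrow> 'g topology \<Rightarrow> ('k, 'n) ring_scheme \<Rightarrow> ('g, 'k) hat_fun \<Rightarrow>
   ('g, 'x) hat_set \<Rightarrow> ('x \<times> 'x \<Rightarrow> 'k) ring" where
  "hat_mat G T k \<mu> X =
     \<lparr>carrier = schwartz G T k (hat_prod X X),
      mult = (\<lambda>A B. \<lambda>(x, z) \<in> hpoints X \<times> hpoints X.
                hat_integral G T k \<mu> X (\<lambda>y \<in> hpoints X. A (x, y) \<otimes>\<^bsub>k\<^esub> B (y, z))),
      one = (\<lambda>(x, z) \<in> hpoints X \<times> hpoints X. if x = z then \<one>\<^bsub>k\<^esub> else \<zero>\<^bsub>k\<^esub>),
      zero = (\<lambda>_ \<in> hpoints X \<times> hpoints X. \<zero>\<^bsub>k\<^esub>),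
      add = (\<lambda>A B. \<lambda>p \<in> hpoints X \<times> hpoints X. A p \<oplus>\<^bsub>k\<^esub> B p)\<rparr>"

definition hat_trace ::
  "('g, 'm) monoid_scheme \<Rightarrow> 'g topology \<Rightarrow> ('k, 'n) ring_scheme \<Rightarrow> ('g, 'k) hat_fun \<Rightarrow>
   ('g, 'x) hat_set \<Rightarrow> ('x \<times> 'x \<Rightarrow> 'k) \<Rightarrow> 'k" where
  "hat_trace G T k \<mu> X A = hat_integral G T k \<mu> X (\<lambda>x \<in> hpoints X. A (x, x))"


section \<open>Nilpotence and property (P)\<close>

definition nilpotent_elem :: "('a, 'm) ring_scheme \<Rightarrow> 'a \<Rightarrow> bool" where
  "nilpotent_elem R a \<longleftrightarrow> a \<in> carrier R \<and> (\<exists>n::nat. a [^]\<^bsub>R\<^esub> n = \<zero>\<^bsub>R\<^esub>)"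

definition reduced_ring :: "('a, 'm) ring_scheme \<Rightarrow> bool" where
  "reduced_ring R \<longleftrightarrow> (\<forall>a. nilpotent_elem R a \<longrightarrow> a = \<zero>\<^bsub>R\<^esub>)"

definition positive_char :: "('a, 'm) ring_scheme \<Rightarrow> bool" where
  "positive_char K \<longleftrightarrow> (\<exists>n::nat. n > 0 \<and> [n] \<cdot>\<^bsub>K\<^esub> \<one>\<^bsub>K\<^esub> = \<zero>\<^bsub>K\<^esub>)"

definition fg_algebra_via ::
  "('r, 'm) ring_scheme \<Rightarrow> ('s, 'n) ring_scheme \<Rightarrow> ('r \<Rightarrow> 's) \<Rightarrow> bool" where
  "fg_algebra_via R R' h \<longleftrightarrow>
     cring R' \<and> h \<in> ring_hom R R' \<and>
     (\<exists>S. finite S \<and> S \<subseteq> carrier R' \<and> carrier R' = generate_ring R' (h ` carrier R \<union> S))"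

text \<open>A finitely generated algebra \<open>R'\<close> over \<open>R\<close> has at most as many elements as there are lists over
  the (nonempty) carrier of \<open>R\<close>, so up to isomorphism its elements have type \<open>'r list\<close>.  The
  same holds for the subfield generated by the image of a homomorphism from \<open>R'\<close> to a field,
  and replacing the target by this subfield does not change the kernel.  Hence the restriction to
  the type \<open>'r list\<close> is immaterial; this is made precise in \<open>property_P_any_algebra\<close> and
  \<open>field_hom_universe\<close> below.\<close>

definition property_P :: "('r, 'm) ring_scheme \<Rightarrow> bool" where
  "property_P R \<longleftrightarrow>
     cring R \<and>
     (\<forall>(R' :: 'r list ring) h. fg_algebra_via R R' h \<and> reduced_ring R' \<longrightarrow>
        {r \<in> carrier R'. \<forall>(K :: 'r list ring) \<phi>.
           field K \<and> positive_char K \<and> \<phi> \<in> ring_hom R' K \<longrightarrow> r \<in> a_kernel R' K \<phi>}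
        = {\<zero>\<^bsub>R'\<^esub>})"

definition measure_property_P ::
  "('g, 'm) monoid_scheme \<Rightarrow> 'g topology \<Rightarrow> ('k, 'n) ring_scheme \<Rightarrow> ('g, 'k) hat_fun \<Rightarrow> bool" where
  "measure_property_P G T k \<mu> \<longleftrightarrow>
     (\<exists>S. subring S k \<and>
        generate_ring k {\<mu> X | X. finitary_hat_set G T X} \<subseteq> S \<and>
        property_P (k\<lparr>carrier := S\<rparr>))"

lemma hat_set_transport:
  fixes X :: "('g, 'x) hat_set" and f :: "'x \<Rightarrow> 'y"
  assumes G: "group G" and X: "finitary_hat_set G T X" and inj: "inj_on f (hpoints X)"
  shows "\<exists>Y :: ('g, 'y) hat_set. finitary_hat_set G T Y \<and> hat_isomorphic G T X Y"
proof -
  define P where "P = hpoints X"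
  define U where "U = hgroup X"
  define r where "r = inv_into P f"
  define b where "b = (\<lambda>g. \<lambda>y \<in> f ` P. f (hact X g (r y)))"
  define Y where "Y = \<lparr>hpoints = f ` P, hgroup = U, hact = b\<rparr>"
  interpret A: group_action "G\<lparr>carrier := U\<rparr>" P "hact X"
    using X by (simp add: finitary_hat_set_def is_hat_set_def P_def U_def)
  interpret GU: group_hom "G\<lparr>carrier := U\<rparr>" "BijGroup P" "hact X"
    by (rule A.group_hom)
  have r: "r (f x) = x" if "x \<in> P" for x
    using inj that by (simp add: r_def P_def)
  have b: "b g (f x) = f (hact X g x)" if "x \<in> P" for g x
    using that by (simp add: b_def r)
  have cl: "hact X g x \<in> P" if "g \<in> U" "x \<in> P" for g x
    using A.element_image[of g x] that by simp
  have bij: "b g \<in> Bij (f ` P)" if g: "g \<in> U" for g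
  proof -
    have "b g ` f ` P = f ` (hact X g ` P)"
      unfolding image_image by (rule image_cong) (simp_all add: b)
    also have "\<dots> = f ` P"
      using A.surj_prop[of g] g by simp
    finally have "b g ` f ` P = f ` P" .
    moreover have "inj_on (b g) (f ` P)"
    proof (rule inj_onI)
      fix y z assume "y \<in> f ` P" "z \<in> f ` P" and eq: "b g y = b g z"
      then obtain u v where uv: "u \<in> P" "v \<in> P" "y = f u" "z = f v" by blast
      with eq have "f (hact X g u) = f (hact X g v)" by (simp add: b)
      hence "hact X g u = hact X g v"
        using inj cl[OF g] uv by (auto simp: P_def dest: inj_onD)
      hence "u = v"
        using A.inj_prop[of g] g uv by (auto dest: inj_onD)
      thus "y = z" by (simp add: uv)
    qed
    ultimately show ?thesis
      by (simp add: Bij_def bij_betw_def b_def)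
  qed
  have hom: "b \<in> hom (G\<lparr>carrier := U\<rparr>) (BijGroup (f ` P))"
  proof (rule homI)
    fix g assume "g \<in> carrier (G\<lparr>carrier := U\<rparr>)"
    thus "b g \<in> carrier (BijGroup (f ` P))" using bij by (simp add: BijGroup_def)
  next
    fix g h assume gh: "g \<in> carrier (G\<lparr>carrier := U\<rparr>)" "h \<in> carrier (G\<lparr>carrier := U\<rparr>)"
    have "b (g \<otimes>\<^bsub>G\<^esub> h) = compose (f ` P) (b g) (b h)"
    proof (rule extensionalityI[where A = "f ` P"])
      fix y assume "y \<in> f ` P"
      then obtain x where x: "x \<in> P" "y = f x" by blast
      have "hact X (g \<otimes>\<^bsub>G\<^esub> h) x = hact X g (hact X h x)"
        using A.composition_rule[of x g h] gh x by simp
      thus "b (g \<otimes>\<^bsub>G\<^esub> h) y = compose (f ` P) (b g) (b h) y"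
        using x cl[of h x] gh by (simp add: compose_def b)
    qed (simp_all add: b_def compose_def)
    thus "b (g \<otimes>\<^bsub>G\<lparr>carrier := U\<rparr>\<^esub> h) = b g \<otimes>\<^bsub>BijGroup (f ` P)\<^esub> b h"
      using bij gh by (simp add: BijGroup_def)
  qed
  have act: "group_action (G\<lparr>carrier := U\<rparr>) (f ` P) b"
    by (simp add: group_action_def group_hom_def group_hom_axioms_def hom group_BijGroup
        GU.G.is_group)
  have stab: "stabilizer (G\<lparr>carrier := U\<rparr>) b (f x) = stabilizer (G\<lparr>carrier := U\<rparr>) (hact X) x"
    if x: "x \<in> P" for x
  proof -
    have "f (hact X g x) = f x \<longleftrightarrow> hact X g x = x" if "g \<in> U" for g
      using inj_on_eq_iff[OF inj] cl[OF that x] x by (simp add: P_def)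
    thus ?thesis by (auto simp: stabilizer_def b x)
  qed
  have "is_hat_set G T Y"
    using X act stab by (auto simp: finitary_hat_set_def is_hat_set_def Y_def P_def U_def)
  moreover have "orbits (G\<lparr>carrier := U\<rparr>) (f ` P) b
                   = (\<lambda>S. f ` S) ` orbits (G\<lparr>carrier := U\<rparr>) P (hact X)"
  proof -
    have "orbit (G\<lparr>carrier := U\<rparr>) b (f x) = f ` orbit (G\<lparr>carrier := U\<rparr>) (hact X) x" if "x \<in> P" for x
      using that by (auto simp: orbit_def b)
    thus ?thesis by (auto simp: orbits_def image_iff)
  qed
  hence "finite (orbits (G\<lparr>carrier := U\<rparr>) (f ` P) b)"
    using X by (simp add: finitary_hat_set_def P_def U_def)
  ultimately have "finitary_hat_set G T Y"
    by (simp add: finitary_hat_set_def Y_def)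
  moreover have "hat_map G T X Y f"
    unfolding hat_map_def using X b
    by (auto simp: Y_def P_def U_def finitary_hat_set_def is_hat_set_def intro!: exI[of _ "hgroup X"])
  moreover have "bij_betw f (hpoints X) (hpoints Y)"
    using inj by (simp add: Y_def P_def bij_betw_def)
  ultimately show ?thesis
    by (auto simp: hat_isomorphic_def)
qed

lemma hat_universe:
  fixes X :: "('g, 'x) hat_set"
  assumes G: "group G" and X: "finitary_hat_set G T X"
  shows "\<exists>Y :: ('g, nat \<times> 'g set) hat_set. finitary_hat_set G T Y \<and> hat_isomorphic G T X Y"
proof -
  define P where "P = hpoints X"
  define U where "U = hgroup X"
  define O' where "O' = orbits (G\<lparr>carrier := U\<rparr>) P (hact X)"
  interpret A: group_action "G\<lparr>carrier := U\<rparr>" P "hact X"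
    using X by (simp add: finitary_hat_set_def is_hat_set_def P_def U_def)
  interpret GU: group_hom "G\<lparr>carrier := U\<rparr>" "BijGroup P" "hact X"
    by (rule A.group_hom)
  have "finite O'" using X by (simp add: finitary_hat_set_def O'_def P_def U_def)
  from finite_imp_inj_to_nat_seg[OF this]
  obtain n :: "'x set \<Rightarrow> nat" where n: "inj_on n O'"
    by blast
  define orb where "orb x = orbit (G\<lparr>carrier := U\<rparr>) (hact X) x" for x
  define rep where "rep S = (SOME x. x \<in> S)" for S :: "'x set"
  define f where "f x = (n (orb x), {u \<in> U. hact X u (rep (orb x)) = x})" for x
  have orb: "orb x \<in> O'" "x \<in> orb x" if "x \<in> P" for x
    using that A.orbit_refl by (auto simp: O'_def orbits_def orb_def)
  have ex: "\<exists>u \<in> U. hact X u (rep (orb x)) = x" if x: "x \<in> P" for x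
  proof -
    have rep: "rep (orb x) \<in> orb x"
      unfolding rep_def using orb(2)[OF x] by (rule someI)
    hence repP: "rep (orb x) \<in> P"
      using A.element_image x by (auto simp: orb_def orbit_def)
    have "x \<in> orbit (G\<lparr>carrier := U\<rparr>) (hact X) (rep (orb x))"
      using A.orbit_sym[OF x repP] rep by (simp add: orb_def)
    thus ?thesis by (simp add: orbit_def) metis
  qed
  have "inj_on f P"
  proof (rule inj_onI)
    fix x y assume xy: "x \<in> P" "y \<in> P" "f x = f y"
    hence "orb x = orb y" using n orb by (auto simp: f_def dest: inj_onD)
    moreover obtain u where "u \<in> U" "hact X u (rep (orb x)) = x" using ex[OF xy(1)] by blast
    ultimately show "x = y" using xy(3) by (auto simp: f_def)
  qed
  thus ?thesis using hat_set_transport[OF G X] by (simp add: P_def)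
qed

lemma finite_ordLeq_infinite:
  includes cardinal_syntax
  assumes "finite A" "infinite W"
  shows "|A| \<le>o |W|"
proof -
  have "|A| \<le>o |W| \<or> |W| \<le>o |A|" by (intro ordLeq_total card_of_Well_order)
  moreover have "\<not> |W| \<le>o |A|" using card_of_ordLeq_finite[of W A] assms by blast
  ultimately show ?thesis by blast
qed

lemma Un_ordLeq_infinite:
  includes cardinal_syntax
  assumes "infinite W" "|A| \<le>o |W|" "|B| \<le>o |W|"
  shows "|A \<union> B| \<le>o |W|"
  using card_of_Un_ordLeq_infinite_Field[OF _ assms(2,3) card_of_Card_order] assms(1)
  by (simp add: Field_card_of)

lemma closure_ordLeq:
  includes cardinal_syntax
  fixes D :: "'a \<Rightarrow> 'a \<Rightarrow> 'a set"
  assumes W: "infinite W" and B: "|B| \<le>o |W|" and D: "\<And>x y. finite (D x y)"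
  shows "\<exists>C. B \<subseteq> C \<and> (\<forall>x \<in> C. \<forall>y \<in> C. D x y \<subseteq> C) \<and> |C| \<le>o |W|"
proof -
  define stage where "stage n = ((\<lambda>S. S \<union> (\<Union>p \<in> S \<times> S. D (fst p) (snd p))) ^^ n) B" for n
  have stage_Suc: "stage (Suc n) = stage n \<union> (\<Union>p \<in> stage n \<times> stage n. D (fst p) (snd p))" for n
    by (simp add: stage_def)
  have small: "|stage n| \<le>o |W|" for n
  proof (induction n)
    case 0
    show ?case using B by (simp add: stage_def)
  next
    case (Suc n)
    have "|stage n \<times> stage n| \<le>o |W|"
      using card_of_Times_ordLeq_infinite_Field[OF _ Suc.IH Suc.IH card_of_Card_order] W
      by (simp add: Field_card_of)
    hence "|\<Union>p \<in> stage n \<times> stage n. D (fst p) (snd p)| \<le>o |W|"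
      using W D by (intro card_of_UNION_ordLeq_infinite) (auto intro: finite_ordLeq_infinite)
    thus ?case unfolding stage_Suc by (intro Un_ordLeq_infinite W Suc.IH)
  qed
  have mono: "stage m \<subseteq> stage n" if "m \<le> n" for m n
    using that by (induction rule: dec_induct) (auto simp: stage_Suc)
  have "|\<Union>n. stage n| \<le>o |W|"
    using W small by (intro card_of_UNION_ordLeq_infinite) (auto simp: infinite_iff_card_of_nat)
  moreover have "B \<subseteq> (\<Union>n. stage n)"
    by (rule order_trans[OF _ UN_upper[of 0]]) (simp_all add: stage_def)
  moreover have "D x y \<subseteq> (\<Union>n. stage n)" if xy: "x \<in> (\<Union>n. stage n)" "y \<in> (\<Union>n. stage n)" for x y
  proof -
    from xy obtain m n where mn: "x \<in> stage m" "y \<in> stage n" by blast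
    hence "x \<in> stage (max m n)" "y \<in> stage (max m n)"
      using mono[of m "max m n"] mono[of n "max m n"] by auto
    hence "D x y \<subseteq> stage (Suc (max m n))" unfolding stage_Suc by fastforce
    thus ?thesis by blast
  qed
  ultimately show ?thesis by (intro exI[of _ "\<Union>n. stage n"] conjI ballI)
qed

lemma fg_algebra_ordLeq:
  includes cardinal_syntax
  fixes R :: "('r, 'm) ring_scheme" and R' :: "('s, 'n) ring_scheme"
  assumes "fg_algebra_via R R' h"
  shows "|carrier R'| \<le>o |UNIV :: 'r list set|"
proof -
  note W = infinite_UNIV_listI[where ?'a = 'r]
  obtain S where S: "finite S" "carrier R' = generate_ring R' (h ` carrier R \<union> S)"
    using assms by (auto simp: fg_algebra_via_def)
  define H where "H = h ` carrier R \<union> S"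
  define B where "B = H \<union> {\<one>\<^bsub>R'\<^esub>}"
  define D where "D x y = {\<ominus>\<^bsub>R'\<^esub> x, x \<oplus>\<^bsub>R'\<^esub> y, x \<otimes>\<^bsub>R'\<^esub> y}" for x y
  have "|h ` carrier R| \<le>o |carrier R|" by (rule card_of_image)
  also have "|carrier R| \<le>o |UNIV :: 'r list set|"
    using card_of_ordLeq[of "carrier R" "UNIV :: 'r list set"] by (auto intro!: exI[of _ "\<lambda>x. [x]"] inj_onI)
  finally have "|B| \<le>o |UNIV :: 'r list set|"
    unfolding B_def H_def
    by (rule Un_ordLeq_infinite[OF W Un_ordLeq_infinite[OF W _ finite_ordLeq_infinite[OF S(1) W]]
          finite_ordLeq_infinite[OF _ W]]) simp_all
  from closure_ordLeq[OF W this, of D] obtain C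
    where C: "B \<subseteq> C" "\<And>x y. x \<in> C \<Longrightarrow> y \<in> C \<Longrightarrow> D x y \<subseteq> C" "|C| \<le>o |UNIV :: 'r list set|"
    by (auto simp: D_def)
  have "x \<in> C" if "x \<in> generate_ring R' H" for x
    using that by induction (use C(1,2) in \<open>auto simp: B_def D_def\<close>)
  hence "carrier R' \<subseteq> C" using S(2) by (auto simp: H_def)
  from ordLeq_transitive[OF card_of_mono1[OF this] C(3)] show ?thesis .
qed

lemma generate_field_ordLeq:
  includes cardinal_syntax
  assumes W: "infinite W" and H: "|H| \<le>o |W|"
  shows "|generate_field L H| \<le>o |W|"
proof -
  define D where "D x y = {\<ominus>\<^bsub>L\<^esub> x, inv\<^bsub>L\<^esub> x, x \<oplus>\<^bsub>L\<^esub> y, x \<otimes>\<^bsub>L\<^esub> y}" for x y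
  have "|H \<union> {\<one>\<^bsub>L\<^esub>}| \<le>o |W|"
    by (rule Un_ordLeq_infinite[OF W H finite_ordLeq_infinite[OF _ W]]) simp
  from closure_ordLeq[OF W this, of D] obtain C
    where C: "H \<union> {\<one>\<^bsub>L\<^esub>} \<subseteq> C" "\<And>x y. x \<in> C \<Longrightarrow> y \<in> C \<Longrightarrow> D x y \<subseteq> C" "|C| \<le>o |W|"
    by (auto simp: D_def)
  have "x \<in> C" if "x \<in> generate_field L H" for x
    using that by induction (use C(1,2) in \<open>auto simp: D_def\<close>)
  hence "generate_field L H \<subseteq> C" by blast
  from ordLeq_transitive[OF card_of_mono1[OF this] C(3)] show ?thesis .
qed

lemma ring_hom_generate_ring:
  assumes "ring R" "ring S" "i \<in> ring_hom R S" "H \<subseteq> carrier R"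
  shows "i ` generate_ring R H \<subseteq> generate_ring S (i ` H)"
proof -
  interpret ring_hom_ring R S i
    using assms(1-3) by (simp add: ring_hom_ring_def ring_hom_ring_axioms_def)
  have "i x \<in> generate_ring S (i ` H)" if "x \<in> generate_ring R H" for x
    using that
  proof induction
    case (a_inv x)
    thus ?case using R.generate_ring_in_carrier[OF assms(4)] by (simp add: generate_ring.a_inv)
  next
    case (eng_add x y)
    thus ?case using R.generate_ring_in_carrier[OF assms(4)] by (simp add: generate_ring.eng_add)
  next
    case (eng_mult x y)
    thus ?case using R.generate_ring_in_carrier[OF assms(4)] by (simp add: generate_ring.eng_mult)
  qed (auto intro: generate_ring.one generate_ring.incl)
  thus ?thesis by blast
qed

lemma property_P_any_algebra:
  fixes R :: "('r, 'm) ring_scheme" and R' :: "('s, 'n) ring_scheme"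
  assumes P: "property_P R" and fg: "fg_algebra_via R R' h" and red: "reduced_ring R'"
  shows "{r \<in> carrier R'. \<forall>(K :: 'r list ring) \<phi>.
            field K \<and> positive_char K \<and> \<phi> \<in> ring_hom R' K \<longrightarrow> r \<in> a_kernel R' K \<phi>}
         = {\<zero>\<^bsub>R'\<^esub>}"
proof -
  obtain i :: "'s \<Rightarrow> 'r list" where i: "inj_on i (carrier R')"
    using fg_algebra_ordLeq[OF fg] by (auto simp: card_of_ordLeq[symmetric])
  interpret R': cring R' using fg by (simp add: fg_algebra_via_def)
  define Q where "Q = image_ring i R'"
  have iso: "i \<in> ring_iso R' Q" unfolding Q_def by (rule inj_imp_image_ring_iso[OF i])
  have cQ: "carrier Q = i ` carrier R'" by (simp add: Q_def image_ring_carrier)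
  have zQ: "\<zero>\<^bsub>Q\<^esub> = i \<zero>\<^bsub>R'\<^esub>" by (simp add: Q_def image_ring_zero)
  have "ring Q" unfolding Q_def by (rule R'.inj_imp_image_ring_is_ring[OF i])
  have ihom: "i \<in> ring_hom R' Q" using iso by (simp add: ring_iso_def)
  interpret i: ring_hom_ring R' Q i
    using \<open>ring Q\<close> ihom R'.ring_axioms by (simp add: ring_hom_ring_def ring_hom_ring_axioms_def)
  have crQ: "cring Q"
    using R'.ring_iso_imp_img_cring[OF iso] by (simp add: zQ[symmetric])
  obtain S where S: "finite S" "S \<subseteq> carrier R'" "carrier R' = generate_ring R' (h ` carrier R \<union> S)"
    and h: "h \<in> ring_hom R R'"
    using fg by (auto simp: fg_algebra_via_def)
  have hR: "h ` carrier R \<union> S \<subseteq> carrier R'" using S(2) h by (auto simp: ring_hom_def)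
  have "carrier Q \<subseteq> generate_ring Q (i ` (h ` carrier R \<union> S))"
    using ring_hom_generate_ring[OF R'.ring_axioms \<open>ring Q\<close> ihom hR] S(3) cQ by simp
  moreover have "generate_ring Q (i ` (h ` carrier R \<union> S)) \<subseteq> carrier Q"
    by (rule i.S.generate_ring_incl) (use hR cQ in blast)
  ultimately have "carrier Q = generate_ring Q ((i \<circ> h) ` carrier R \<union> i ` S)"
    by (simp add: image_Un image_comp)
  moreover have "i ` S \<subseteq> carrier Q" using S(2) cQ by blast
  ultimately have fgQ: "fg_algebra_via R Q (i \<circ> h)"
    using crQ ring_hom_trans[OF h ihom] S(1) by (auto simp: fg_algebra_via_def)
  have inj0: "x = \<zero>\<^bsub>R'\<^esub>" if "x \<in> carrier R'" "i x = \<zero>\<^bsub>Q\<^esub>" for x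
    using that inj_onD[OF i] R'.zero_closed i.hom_zero by metis
  have redQ: "reduced_ring Q"
    unfolding reduced_ring_def
  proof (intro allI impI)
    fix q assume "nilpotent_elem Q q"
    then obtain x n where x: "x \<in> carrier R'" "q = i x" "q [^]\<^bsub>Q\<^esub> (n::nat) = \<zero>\<^bsub>Q\<^esub>"
      by (auto simp: nilpotent_elem_def cQ)
    hence "i (x [^]\<^bsub>R'\<^esub> n) = \<zero>\<^bsub>Q\<^esub>" by (simp add: i.hom_nat_pow)
    hence "x [^]\<^bsub>R'\<^esub> n = \<zero>\<^bsub>R'\<^esub>" using x(1) by (intro inj0) simp_all
    hence "x = \<zero>\<^bsub>R'\<^esub>" using red x(1) by (auto simp: reduced_ring_def nilpotent_elem_def)
    thus "q = \<zero>\<^bsub>Q\<^esub>" using x(2) by simp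
  qed
  have PQ: "{r \<in> carrier Q. \<forall>(K :: 'r list ring) \<phi>.
            field K \<and> positive_char K \<and> \<phi> \<in> ring_hom Q K \<longrightarrow> r \<in> a_kernel Q K \<phi>} = {\<zero>\<^bsub>Q\<^esub>}"
    using P fgQ redQ unfolding property_P_def by blast
  show ?thesis
  proof (intro equalityI subsetI)
    fix r
    assume r: "r \<in> {r \<in> carrier R'. \<forall>(K :: 'r list ring) \<phi>.
            field K \<and> positive_char K \<and> \<phi> \<in> ring_hom R' K \<longrightarrow> r \<in> a_kernel R' K \<phi>}"
    have "i r \<in> a_kernel Q K \<phi>"
      if K: "field K" "positive_char K" "\<phi> \<in> ring_hom Q K" for K :: "'r list ring" and \<phi>
    proof -
      have "r \<in> a_kernel R' K (\<phi> \<circ> i)" using r K ring_hom_trans[OF ihom K(3)] by blast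
      thus ?thesis using cQ unfolding a_kernel_def' comp_def by blast
    qed
    hence "i r \<in> {\<zero>\<^bsub>Q\<^esub>}" using r unfolding PQ[symmetric] by auto
    thus "r \<in> {\<zero>\<^bsub>R'\<^esub>}" using inj0 r by simp
  next
    fix r assume "r \<in> {\<zero>\<^bsub>R'\<^esub>}"
    moreover have "\<phi> \<zero>\<^bsub>R'\<^esub> = \<zero>\<^bsub>K\<^esub>" if "field K" "\<phi> \<in> ring_hom R' K" for K :: "'r list ring" and \<phi>
      using ring_hom_zero[OF that(2) R'.ring_axioms] that(1)
      by (simp add: field_def domain_def cring_def)
    ultimately show "r \<in> {r \<in> carrier R'. \<forall>(K :: 'r list ring) \<phi>.
            field K \<and> positive_char K \<and> \<phi> \<in> ring_hom R' K \<longrightarrow> r \<in> a_kernel R' K \<phi>}"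
      unfolding a_kernel_def' by blast
  qed
qed

lemma field_hom_universe:
  fixes R :: "('r, 'm) ring_scheme" and R' :: "('s, 'n) ring_scheme" and L :: "('l, 'p) ring_scheme"
  assumes fg: "fg_algebra_via R R' h" and L: "field L" "positive_char L"
    and \<phi>: "\<phi> \<in> ring_hom R' L"
  shows "\<exists>(K :: 'r list ring) \<psi>. field K \<and> positive_char K \<and> \<psi> \<in> ring_hom R' K \<and>
           a_kernel R' K \<psi> = a_kernel R' L \<phi>"
proof -
  include cardinal_syntax
  interpret L: field L by (rule L)
  define H where "H = \<phi> ` carrier R'"
  define F where "F = L\<lparr>carrier := generate_field L H\<rparr>"
  have H: "H \<subseteq> carrier L" using \<phi> by (auto simp: H_def ring_hom_def)
  interpret F: field F unfolding F_def by (rule L.generate_field_is_field[OF H])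
  have "|H| \<le>o |UNIV :: 'r list set|"
    unfolding H_def by (rule ordLeq_transitive[OF card_of_image fg_algebra_ordLeq[OF fg]])
  from generate_field_ordLeq[OF infinite_UNIV_listI this]
  obtain i :: "'l \<Rightarrow> 'r list" where i: "inj_on i (carrier F)"
    by (auto simp: card_of_ordLeq[symmetric] F_def)
  define K where "K = image_ring i F"
  have K: "field K" unfolding K_def by (rule F.inj_imp_image_ring_is_field[OF i])
  interpret K: field K by (rule K)
  have ihom: "i \<in> ring_hom F K"
    using inj_imp_image_ring_iso[OF i] by (simp add: K_def ring_iso_def)
  interpret i: ring_hom_ring F K i
    using ihom F.ring_axioms K.ring_axioms by (simp add: ring_hom_ring_def ring_hom_ring_axioms_def)
  have FL: "\<zero>\<^bsub>F\<^esub> = \<zero>\<^bsub>L\<^esub>" "\<one>\<^bsub>F\<^esub> = \<one>\<^bsub>L\<^esub>" "[n] \<cdot>\<^bsub>F\<^esub> \<one>\<^bsub>F\<^esub> = [n] \<cdot>\<^bsub>L\<^esub> \<one>\<^bsub>L\<^esub>" for n :: nat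
    by (simp_all add: F_def add_pow_def nat_pow_def)
  have "\<phi> \<in> ring_hom R' F"
    using \<phi> by (auto simp: ring_hom_def F_def H_def intro: generate_field.incl)
  hence "i \<circ> \<phi> \<in> ring_hom R' K" by (rule ring_hom_trans[OF _ ihom])
  moreover have "positive_char K"
  proof -
    have "i ([n] \<cdot>\<^bsub>F\<^esub> \<one>\<^bsub>F\<^esub>) = [n] \<cdot>\<^bsub>K\<^esub> \<one>\<^bsub>K\<^esub>" for n :: nat
      by (induction n) simp_all
    thus ?thesis using L(2) FL i.hom_zero by (metis positive_char_def)
  qed
  moreover have "i (\<phi> x) = \<zero>\<^bsub>K\<^esub> \<longleftrightarrow> \<phi> x = \<zero>\<^bsub>L\<^esub>" if "x \<in> carrier R'" for x
  proof -
    have "\<phi> x \<in> carrier F" using that by (auto simp: F_def H_def intro: generate_field.incl)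
    thus ?thesis using inj_on_eq_iff[OF i _ F.zero_closed] FL(1) i.hom_zero by metis
  qed
  hence "a_kernel R' K (i \<circ> \<phi>) = a_kernel R' L \<phi>"
    unfolding a_kernel_def' comp_def by blast
  ultimately show ?thesis using K by blast
qed

end

theory Submission
  imports Defs "HOL-Number_Theory.Cong"
begin

text \<open>Property (P) reduces the claim to characteristic \<open>p\<close>.  Let \<open>R\<close> be the subring of \<open>k\<close> generated by a
  subring with (P) that contains the values of \<open>\<mu>\<close>, and by the finitely many entries of \<open>A\<close>.  It is
  reduced, so an element of \<open>R\<close> that dies under all homomorphisms \<open>\<phi>\<close> to fields of positive
  characteristic is zero.  Since \<open>\<phi> \<circ> \<mu>\<close> is again a measure, with values in the field, and
  \<open>\<phi>\<close> is compatible with integrals, it is enough to treat \<open>\<phi> \<circ> A\<close> over the field.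

  Over a ring in which the prime \<open>p\<close> vanishes one has \<open>tr (A\<^sup>p) = (tr A)\<^sup>p\<close>
  (\<open>ktrace_prime_power\<close>).  Indeed both sides are integrals over \<open>X\<^sup>p\<close>: the left side
  of \<open>A(x\<^sub>1, x\<^sub>2) A(x\<^sub>2, x\<^sub>3) \<dots> A(x\<^sub>p, x\<^sub>1)\<close>, the right side of
  \<open>A(x\<^sub>1, x\<^sub>1) A(x\<^sub>2, x\<^sub>2) \<dots> A(x\<^sub>p, x\<^sub>p)\<close>.  Both integrands are invariant under cyclic rotation of
  the variables, and they agree on the diagonal, which is the fixed set of the rotation.  Off
  the diagonal the rotation generates a free action of a group of order \<open>p\<close>, and there the integral
  of an invariant function is \<open>p\<close> times an integral over the quotient, hence zero
  (\<open>integ_fixed_points\<close>).  Iterating, \<open>(tr A)\<^sup>q = tr (A\<^sup>q)\<close> for every power \<open>q\<close> of \<open>p\<close>; for a large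
  one \<open>A\<^sup>q = 0\<close>, and therefore \<open>tr A = 0\<close>.

  The manipulations of integrals rest on one theorem, \<open>fubini\<close>, for an arbitrary equivariant map of
  finitary sets.  It is applied to the projection from lists of length \<open>n + 1\<close> to their first entry
  (iterated integrals, associativity of the matrix product, the two formulas for traces) and to the
  quotient by a rotation.  It follows by summing over orbits from the product axiom of a measure,
  which speaks of maps of transitive sets, and from invariance under conjugation, which makes the
  integral over a fiber an invariant function of the base point.\<close>


section \<open>Finite sums in a ring\<close>

lemma (in abelian_monoid) finsum_swap:
  assumes "finite I" "finite J" and h: "\<And>i j. i \<in> I \<Longrightarrow> j \<in> J \<Longrightarrow> h i j \<in> carrier G"
  shows "(\<Oplus>i \<in> I. \<Oplus>j \<in> J. h i j) = (\<Oplus>j \<in> J. \<Oplus>i \<in> I. h i j)"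
  using assms(1) h
proof (induction I rule: finite_induct)
  case (insert a I)
  have "(\<Oplus>i \<in> insert a I. \<Oplus>j \<in> J. h i j) = (\<Oplus>j \<in> J. h a j) \<oplus> (\<Oplus>j \<in> J. \<Oplus>i \<in> I. h i j)"
    using insert by (subst finsum_insert) (auto intro!: finsum_closed)
  also have "\<dots> = (\<Oplus>j \<in> J. h a j \<oplus> (\<Oplus>i \<in> I. h i j))"
    using insert by (intro finsum_addf[symmetric]) (auto intro!: finsum_closed)
  also have "\<dots> = (\<Oplus>j \<in> J. \<Oplus>i \<in> insert a I. h i j)"
    using insert by (intro finsum_cong') (auto intro!: finsum_closed simp: finsum_insert)
  finally show ?case .
qed (simp add: finsum_zero)

lemma (in abelian_monoid) finsum_group:
  assumes "finite I" and h: "h \<in> I \<rightarrow> carrier G"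
  shows "(\<Oplus>b \<in> c ` I. \<Oplus>i \<in> {i \<in> I. c i = b}. h i) = (\<Oplus>i \<in> I. h i)"
proof -
  have "(\<Oplus>i \<in> (\<Union>b \<in> c ` I. {i \<in> I. c i = b}). h i) = (\<Oplus>b \<in> c ` I. \<Oplus>i \<in> {i \<in> I. c i = b}. h i)"
    using assms by (intro add.finprod_UN_disjoint) (auto simp: Pi_def pairwise_def disjnt_def)
  moreover have "(\<Union>b \<in> c ` I. {i \<in> I. c i = b}) = I" by blast
  ultimately show ?thesis by simp
qed


section \<open>Orbits of maps of prime order\<close>

text \<open>A repetition among the first \<open>p\<close> iterates gives a period prime to \<open>p\<close>, and a point with that period
  and the period \<open>p\<close> is fixed.\<close>

lemma funpow_orbit:
  fixes p :: nat
  assumes p: "prime p" and \<sigma>: "(\<sigma> ^^ p) z = z" and nf: "\<sigma> z \<noteq> z"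
  defines "q \<equiv> \<lambda>z. (\<lambda>i. (\<sigma> ^^ i) z) ` {..<p}"
  shows "card (q z) = p" "\<And>i. q ((\<sigma> ^^ i) z) = q z"
proof -
  have p0: "p > 0" using p by (simp add: prime_gt_0_nat)
  have md: "(\<sigma> ^^ (i mod p)) z = (\<sigma> ^^ i) z" for i by (rule funpow_mod_eq[OF \<sigma>])
  have less: False if ij: "i < j" "j < p" and e: "(\<sigma> ^^ i) z = (\<sigma> ^^ j) z" for i j
  proof -
    define d where "d = j - i"
    have d: "0 < d" "d < p" using ij by (auto simp: d_def)
    have "(\<sigma> ^^ (p - i)) ((\<sigma> ^^ i) z) = (\<sigma> ^^ (p - i)) ((\<sigma> ^^ j) z)" using e by simp
    hence "(\<sigma> ^^ (p - i + i)) z = (\<sigma> ^^ (p - i + j)) z" by (simp only: funpow_add comp_apply)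
    moreover have "p - i + i = p" "p - i + j = d + p" using ij by (auto simp: d_def)
    ultimately have "(\<sigma> ^^ d) z = z" using \<sigma> by (simp add: funpow_add)
    hence fix_d: "(\<sigma> ^^ (d * n)) z = z" for n
      by (induction n) (simp_all add: funpow_add)
    have "coprime d p"
      using p d by (metis coprime_commute nat_dvd_not_less prime_imp_coprime)
    then obtain x where "[d * x = Suc 0] (mod p)" using cong_solve_coprime_nat by blast
    hence "(d * x) mod p = 1" using p prime_gt_1_nat by (auto simp: cong_def)
    hence "\<sigma> z = z" using md[of "d * x"] fix_d[of x] by simp
    thus False using nf by simp
  qed
  have "inj_on (\<lambda>i. (\<sigma> ^^ i) z) {..<p}"
    by (rule linorder_inj_onI) (use less in auto)
  thus "card (q z) = p" by (simp add: q_def card_image)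
  have all: "q z = range (\<lambda>i. (\<sigma> ^^ i) z)"
  proof -
    have "(\<sigma> ^^ i) z \<in> q z" for i unfolding q_def using md[of i, symmetric] p0 by (intro image_eqI[of _ _ "i mod p"]) auto
    thus ?thesis by (auto simp: q_def)
  qed
  have "q ((\<sigma> ^^ i) z) = (\<lambda>j. (\<sigma> ^^ (j + i)) z) ` {..<p}" for i
    by (simp add: q_def funpow_add)
  moreover have "(\<lambda>j. (\<sigma> ^^ (j + i)) z) ` {..<p} = q z" for i
  proof
    show "(\<lambda>j. (\<sigma> ^^ (j + i)) z) ` {..<p} \<subseteq> q z" unfolding all by blast
    show "q z \<subseteq> (\<lambda>j. (\<sigma> ^^ (j + i)) z) ` {..<p}"
    proof
      fix w assume "w \<in> q z"
      then obtain n where n: "w = (\<sigma> ^^ n) z" by (auto simp: q_def)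
      \<comment> \<open>The index is \<open>n - i\<close> modulo \<open>p\<close>, with \<open>p\<close> added to stay within the natural numbers.\<close>
      define j where "j = (n + (p - i mod p)) mod p"
      have "(j + i) mod p = (n + (p - i mod p) + i mod p) mod p"
        unfolding j_def by (simp add: mod_simps)
      also have "n + (p - i mod p) + i mod p = n + p" using mod_less_divisor[OF p0, of i] by simp
      also have "(n + p) mod p = n mod p" by simp
      finally have "(\<sigma> ^^ (j + i)) z = w" using md[of "j + i"] md[of n] n by simp
      moreover have "j < p" using p0 by (simp add: j_def)
      ultimately show "w \<in> (\<lambda>j. (\<sigma> ^^ (j + i)) z) ` {..<p}" by blast
    qed
  qed
  ultimately show "q ((\<sigma> ^^ i) z) = q z" for i by simp
qed


section \<open>Pro-oligomorphic groups\<close>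

locale pro_oligomorphic_group = group G for G :: "('g, 'm) monoid_scheme" (structure) +
  fixes T :: "'g topology"
  assumes pro_oligomorphic: "pro_oligomorphic G T"
begin

lemma topspace_eq: "topspace T = carrier G"
  using pro_oligomorphic by (simp add: pro_oligomorphic_def topological_group_def)

lemma open_subgroupD:
  assumes "open_subgroup G T U"
  shows "subgroup U G" "openin T U" "U \<subseteq> carrier G" "\<one> \<in> U"
    "\<And>g h. g \<in> U \<Longrightarrow> h \<in> U \<Longrightarrow> g \<otimes> h \<in> U" "\<And>g. g \<in> U \<Longrightarrow> inv g \<in> U"
  using assms
  by (auto simp: open_subgroup_def subgroup.one_closed subgroup.m_closed subgroup.m_inv_closed
      dest: subgroup.subset)

lemma open_subgroup_Int:
  assumes "open_subgroup G T U" "open_subgroup G T V"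
  shows "open_subgroup G T (U \<inter> V)"
  using assms by (auto simp: open_subgroup_def subgroups_Inter_pair)

lemma continuous_translate_left:
  assumes a: "a \<in> carrier G"
  shows "continuous_map T T (\<lambda>x. a \<otimes> x)"
proof -
  have "continuous_map (prod_topology T T) T (\<lambda>(x, y). x \<otimes> y)"
    using pro_oligomorphic by (simp add: pro_oligomorphic_def topological_group_def)
  moreover have "continuous_map T (prod_topology T T) (\<lambda>x. (a, x))"
    by (intro continuous_map_pairedI) (auto simp: a topspace_eq)
  ultimately have "continuous_map T T ((\<lambda>(x, y). x \<otimes> y) \<circ> (\<lambda>x. (a, x)))"
    by (rule continuous_map_compose[rotated])
  thus ?thesis by (simp add: comp_def)
qed

lemma continuous_translate_right:
  assumes a: "a \<in> carrier G"
  shows "continuous_map T T (\<lambda>x. x \<otimes> a)"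
proof -
  have "continuous_map (prod_topology T T) T (\<lambda>(x, y). x \<otimes> y)"
    using pro_oligomorphic by (simp add: pro_oligomorphic_def topological_group_def)
  moreover have "continuous_map T (prod_topology T T) (\<lambda>x. (x, a))"
    by (intro continuous_map_pairedI) (auto simp: a topspace_eq)
  ultimately have "continuous_map T T ((\<lambda>(x, y). x \<otimes> y) \<circ> (\<lambda>x. (x, a)))"
    by (rule continuous_map_compose[rotated])
  thus ?thesis by (simp add: comp_def)
qed

text \<open>The group \<open>W\<close> is a union of translates of \<open>V\<close>.\<close>

lemma open_subgroup_supergroup:
  assumes V: "open_subgroup G T V" and W: "subgroup W G" and VW: "V \<subseteq> W"
  shows "open_subgroup G T W"
proof -
  have "\<exists>N. openin T N \<and> w \<in> N \<and> N \<subseteq> W" if w: "w \<in> W" for w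
  proof -
    have wc: "w \<in> carrier G" using w subgroup.subset[OF W] by blast
    define N where "N = {x \<in> topspace T. inv w \<otimes> x \<in> V}"
    have "openin T N" unfolding N_def
      using continuous_translate_left[of "inv w"] wc open_subgroupD(2)[OF V]
      by (intro openin_continuous_map_preimage) auto
    moreover have "w \<in> N" using wc open_subgroupD[OF V] by (simp add: N_def topspace_eq)
    moreover have "x \<in> W" if x: "x \<in> N" for x
    proof -
      have "w \<otimes> (inv w \<otimes> x) \<in> W"
        using x w VW subgroup.m_closed[OF W] by (auto simp: N_def)
      thus ?thesis using x wc by (simp add: N_def topspace_eq m_assoc[symmetric])
    qed
    ultimately show ?thesis by blast
  qed
  hence "openin T W" by (subst openin_subopen) blast
  thus ?thesis using W by (simp add: open_subgroup_def)
qed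

lemma inv_cancel_left:
  assumes "g \<in> carrier G" "x \<in> carrier G"
  shows "g \<otimes> (inv g \<otimes> x) = x" "inv g \<otimes> (g \<otimes> x) = x"
  using assms by (simp_all add: m_assoc[symmetric])

lemma conj_cancel:
  assumes "g \<in> carrier G" "u \<in> carrier G"
  shows "inv g \<otimes> (g \<otimes> u \<otimes> inv g) \<otimes> g = u"
  using assms by (simp add: m_assoc inv_cancel_left)

lemma conj_mem:
  assumes U: "U \<subseteq> carrier G" and g: "g \<in> carrier G"
  shows "h \<in> {g \<otimes> u \<otimes> inv g | u. u \<in> U} \<longleftrightarrow> h \<in> carrier G \<and> inv g \<otimes> h \<otimes> g \<in> U"
proof
  assume "h \<in> {g \<otimes> u \<otimes> inv g | u. u \<in> U}"
  then obtain u where u: "u \<in> U" "h = g \<otimes> u \<otimes> inv g" by blast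
  thus "h \<in> carrier G \<and> inv g \<otimes> h \<otimes> g \<in> U" using U g conj_cancel by auto
next
  assume h: "h \<in> carrier G \<and> inv g \<otimes> h \<otimes> g \<in> U"
  hence "h = g \<otimes> (inv g \<otimes> h \<otimes> g) \<otimes> inv g" using g by (simp add: m_assoc inv_cancel_left)
  thus "h \<in> {g \<otimes> u \<otimes> inv g | u. u \<in> U}" using h by blast
qed

lemma open_subgroup_conj:
  assumes U: "open_subgroup G T U" and g: "g \<in> carrier G"
  shows "open_subgroup G T {g \<otimes> u \<otimes> inv g | u. u \<in> U}"
proof -
  let ?C = "{g \<otimes> u \<otimes> inv g | u. u \<in> U}"
  note UD = open_subgroupD[OF U]
  have Uc: "u \<in> carrier G" if "u \<in> U" for u using that UD(3) by blast
  note mem = conj_mem[OF UD(3) g]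
  have "continuous_map T T ((\<lambda>x. x \<otimes> g) \<circ> (\<lambda>x. inv g \<otimes> x))"
    using g by (intro continuous_map_compose[OF continuous_translate_left continuous_translate_right]) auto
  hence "openin T {h \<in> topspace T. ((\<lambda>x. x \<otimes> g) \<circ> (\<lambda>x. inv g \<otimes> x)) h \<in> U}"
    using UD(2) by (rule openin_continuous_map_preimage)
  also have "{h \<in> topspace T. ((\<lambda>x. x \<otimes> g) \<circ> (\<lambda>x. inv g \<otimes> x)) h \<in> U} = ?C"
    using mem by (auto simp: topspace_eq)
  finally have "openin T ?C" .
  moreover have "subgroup ?C G"
  proof (rule subgroupI)
    show "?C \<subseteq> carrier G" using g Uc by auto
    show "?C \<noteq> {}" using UD(4) by blast
    fix a assume "a \<in> ?C"
    then obtain u where u: "u \<in> U" "a = g \<otimes> u \<otimes> inv g" by blast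
    hence "inv a = g \<otimes> inv u \<otimes> inv g" using g Uc by (simp add: inv_mult_group m_assoc)
    thus "inv a \<in> ?C" using UD(6)[OF u(1)] by blast
    fix b assume "b \<in> ?C"
    then obtain v where v: "v \<in> U" "b = g \<otimes> v \<otimes> inv g" by blast
    have "a \<otimes> b = g \<otimes> (u \<otimes> v) \<otimes> inv g"
      using u v g Uc by (simp add: m_assoc inv_cancel_left)
    thus "a \<otimes> b \<in> ?C" using UD(5)[OF u(1) v(1)] by blast
  qed
  ultimately show ?thesis by (simp add: open_subgroup_def)
qed

lemma finite_double_cosets:
  assumes "open_subgroup G T U" "open_subgroup G T V"
  shows "finite {(U #> g) <#> V | g. g \<in> carrier G}"
  using assms pro_oligomorphic by (simp add: pro_oligomorphic_def)


section \<open>Smooth actions\<close>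

lemma hat_set_open: "is_hat_set G T X \<Longrightarrow> open_subgroup G T (hgroup X)"
  by (simp add: is_hat_set_def)

lemma hat_set_action:
  assumes X: "is_hat_set G T X"
  shows hact_closed: "\<And>g x. g \<in> hgroup X \<Longrightarrow> x \<in> hpoints X \<Longrightarrow> hact X g x \<in> hpoints X"
    and hact_one: "\<And>x. x \<in> hpoints X \<Longrightarrow> hact X \<one> x = x"
    and hact_mult: "\<And>g h x. g \<in> hgroup X \<Longrightarrow> h \<in> hgroup X \<Longrightarrow> x \<in> hpoints X \<Longrightarrow>
           hact X (g \<otimes> h) x = hact X g (hact X h x)"
    and hact_extensional: "\<And>g. g \<in> hgroup X \<Longrightarrow> hact X g \<in> extensional (hpoints X)"
proof -
  interpret A: group_action "G\<lparr>carrier := hgroup X\<rparr>" "hpoints X" "hact X"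
    using X by (simp add: is_hat_set_def)
  show "hact X g x \<in> hpoints X" if "g \<in> hgroup X" "x \<in> hpoints X" for g x
    using A.element_image[of g x] that by simp
  show "hact X \<one> x = x" if "x \<in> hpoints X" for x
    using that fun_cong[OF A.id_eq_one, of x] by simp
  show "hact X (g \<otimes> h) x = hact X g (hact X h x)"
    if "g \<in> hgroup X" "h \<in> hgroup X" "x \<in> hpoints X" for g h x
    using A.composition_rule[of x g h] that by simp
  show "hact X g \<in> extensional (hpoints X)" if "g \<in> hgroup X" for g
    using A.bij_prop0[of g] that by (simp add: Bij_def)
qed

lemma hact_inv:
  assumes X: "is_hat_set G T X" and g: "g \<in> hgroup X" and x: "x \<in> hpoints X"
  shows "hact X (inv g) (hact X g x) = x" "hact X g (hact X (inv g) x) = x"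
proof -
  note U = open_subgroupD[OF hat_set_open[OF X]]
  have "g \<in> carrier G" using g U(3) by blast
  thus "hact X (inv g) (hact X g x) = x" "hact X g (hact X (inv g) x) = x"
    using hact_mult[OF X U(6)[OF g] g x] hact_mult[OF X g U(6)[OF g] x] hact_one[OF X x] by simp_all
qed

text \<open>Stabilizers and orbits carry the acting group as an argument, because the same set is studied
  under many open subgroups of its group of definition.\<close>

definition stab :: "('g, 'x) hat_set \<Rightarrow> 'g set \<Rightarrow> 'x \<Rightarrow> 'g set" where
  "stab X V x = {v \<in> V. hact X v x = x}"

definition orb :: "('g, 'x) hat_set \<Rightarrow> 'g set \<Rightarrow> 'x \<Rightarrow> 'x set" where
  "orb X V x = (\<lambda>v. hact X v x) ` V"

lemma open_stab:
  assumes X: "is_hat_set G T X" and V: "open_subgroup G T V" "V \<subseteq> hgroup X" and x: "x \<in> hpoints X"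
  shows "open_subgroup G T (stab X V x)"
proof -
  interpret A: group_action "G\<lparr>carrier := hgroup X\<rparr>" "hpoints X" "hact X"
    using X by (simp add: is_hat_set_def)
  have "subgroup (stab X (hgroup X) x) G"
  proof (rule subgroupI)
    note U = open_subgroupD[OF hat_set_open[OF X]]
    show "stab X (hgroup X) x \<subseteq> carrier G" using U(3) by (auto simp: stab_def)
    show "stab X (hgroup X) x \<noteq> {}" using hact_one[OF X x] U(4) by (auto simp: stab_def)
    fix a assume a: "a \<in> stab X (hgroup X) x"
    thus "inv a \<in> stab X (hgroup X) x"
      using hact_inv(1)[OF X _ x, of a] U(6) by (auto simp: stab_def)
    fix b assume b: "b \<in> stab X (hgroup X) x"
    show "a \<otimes> b \<in> stab X (hgroup X) x"
      using a b U(5) hact_mult[OF X _ _ x, of a b] by (auto simp: stab_def)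
  qed
  moreover have "openin T (stab X (hgroup X) x)"
    using X x by (simp add: is_hat_set_def stabilizer_def stab_def)
  ultimately have "open_subgroup G T (stab X (hgroup X) x)" by (simp add: open_subgroup_def)
  moreover have "stab X V x = stab X (hgroup X) x \<inter> V" using V by (auto simp: stab_def)
  ultimately show ?thesis using open_subgroup_Int V by simp
qed

text \<open>It is enough that each point is fixed by some open subgroup: the stabilizer contains it and is
  therefore open.\<close>

lemma is_hat_setI:
  assumes U: "open_subgroup G T (hgroup X)"
    and cl: "\<And>g x. g \<in> hgroup X \<Longrightarrow> x \<in> hpoints X \<Longrightarrow> hact X g x \<in> hpoints X"
    and ext: "\<And>g. g \<in> hgroup X \<Longrightarrow> hact X g \<in> extensional (hpoints X)"
    and one: "\<And>x. x \<in> hpoints X \<Longrightarrow> hact X \<one> x = x"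
    and mult: "\<And>g h x. g \<in> hgroup X \<Longrightarrow> h \<in> hgroup X \<Longrightarrow> x \<in> hpoints X \<Longrightarrow>
           hact X (g \<otimes> h) x = hact X g (hact X h x)"
    and stab: "\<And>x. x \<in> hpoints X \<Longrightarrow>
           \<exists>W. open_subgroup G T W \<and> W \<subseteq> hgroup X \<and> (\<forall>w \<in> W. hact X w x = x)"
  shows "is_hat_set G T X"
proof -
  note UD = open_subgroupD[OF U]
  have carr: "g \<in> carrier G" if "g \<in> hgroup X" for g using that UD(3) by blast
  have inv: "hact X (inv g) (hact X g x) = x" "hact X g (hact X (inv g) x) = x"
    if "g \<in> hgroup X" "x \<in> hpoints X" for g x
    using mult[of "inv g" g x] mult[of g "inv g" x] that UD(6) one carr by simp_all
  have bij: "hact X g \<in> Bij (hpoints X)" if g: "g \<in> hgroup X" for g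
    unfolding Bij_def using g cl inv UD(6)
    by (auto intro!: bij_betw_byWitness[where f' = "hact X (inv g)"] ext)
  have "hact X \<in> hom (G\<lparr>carrier := hgroup X\<rparr>) (BijGroup (hpoints X))"
  proof (rule homI)
    fix g h assume gh: "g \<in> carrier (G\<lparr>carrier := hgroup X\<rparr>)" "h \<in> carrier (G\<lparr>carrier := hgroup X\<rparr>)"
    have "hact X (g \<otimes> h) = compose (hpoints X) (hact X g) (hact X h)"
      by (rule extensionalityI[where A = "hpoints X"])
         (use gh in \<open>simp_all add: ext UD(5) mult compose_def\<close>)
    thus "hact X (g \<otimes>\<^bsub>G\<lparr>carrier := hgroup X\<rparr>\<^esub> h) = hact X g \<otimes>\<^bsub>BijGroup (hpoints X)\<^esub> hact X h"
      using gh bij by (simp add: BijGroup_def)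
  qed (use bij in \<open>simp add: BijGroup_def\<close>)
  hence "group_action (G\<lparr>carrier := hgroup X\<rparr>) (hpoints X) (hact X)"
    by (simp add: group_action_def group_hom_def group_hom_axioms_def group_BijGroup
        subgroup.subgroup_is_group[OF UD(1)] is_group)
  moreover have "openin T (stabilizer (G\<lparr>carrier := hgroup X\<rparr>) (hact X) x)" if x: "x \<in> hpoints X" for x
  proof -
    from stab[OF x] obtain W where W: "open_subgroup G T W" "W \<subseteq> hgroup X" "\<forall>w \<in> W. hact X w x = x"
      by blast
    let ?S = "{g \<in> hgroup X. hact X g x = x}"
    have "subgroup ?S G"
    proof (rule subgroupI)
      show "?S \<subseteq> carrier G" using carr by auto
      show "?S \<noteq> {}" using UD(4) one x by auto
      show "inv a \<in> ?S" if "a \<in> ?S" for a using that inv(1)[of a x] x UD(6) by auto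
      show "a \<otimes> b \<in> ?S" if "a \<in> ?S" "b \<in> ?S" for a b
        using that UD(5) mult[of a b x] x by auto
    qed
    from open_subgroup_supergroup[OF W(1) this] W
    show ?thesis by (auto simp: stabilizer_def open_subgroup_def)
  qed
  ultimately show ?thesis using U by (simp add: is_hat_set_def)
qed


section \<open>Finitary subsets\<close>

text \<open>The conditions on \<open>X\<close> and \<open>V\<close> are part of the predicate so that a single hypothesis provides the
  whole setting of an action of an open subgroup on a subset.\<close>

definition stable_on :: "('g, 'x) hat_set \<Rightarrow> 'g set \<Rightarrow> 'x set \<Rightarrow> bool" where
  "stable_on X V S \<longleftrightarrow>
     is_hat_set G T X \<and> open_subgroup G T V \<and> V \<subseteq> hgroup X \<and> S \<subseteq> hpoints X \<and>
     (\<forall>v \<in> V. \<forall>x \<in> S. hact X v x \<in> S)"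

definition fin_on :: "('g, 'x) hat_set \<Rightarrow> 'g set \<Rightarrow> 'x set \<Rightarrow> bool" where
  "fin_on X V S \<longleftrightarrow> stable_on X V S \<and> finite (orb X V ` S)"

definition definable :: "('g, 'x) hat_set \<Rightarrow> 'x set \<Rightarrow> bool" where
  "definable X S \<longleftrightarrow> (\<exists>V. fin_on X V S)"

lemma stable_onD:
  assumes "stable_on X V S"
  shows "is_hat_set G T X" "open_subgroup G T V" "V \<subseteq> hgroup X" "S \<subseteq> hpoints X"
    "\<And>v x. v \<in> V \<Longrightarrow> x \<in> S \<Longrightarrow> hact X v x \<in> S"
  using assms by (auto simp: stable_on_def)

lemma fin_onD:
  assumes "fin_on X V S"
  shows "stable_on X V S" "finite (orb X V ` S)"
  using assms by (auto simp: fin_on_def)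

lemma stable_on_mono:
  assumes "stable_on X V S" "open_subgroup G T W" "W \<subseteq> V"
  shows "stable_on X W S"
  using assms by (fastforce simp: stable_on_def)

lemma orb_refl: "stable_on X V S \<Longrightarrow> x \<in> S \<Longrightarrow> x \<in> orb X V x"
  using hact_one open_subgroupD(4) by (force simp: orb_def stable_on_def)

lemma orb_subset: "stable_on X V S \<Longrightarrow> x \<in> S \<Longrightarrow> orb X V x \<subseteq> S"
  by (auto simp: orb_def stable_on_def)

lemma orb_eq:
  assumes S: "stable_on X V S" and x: "x \<in> S" and y: "y \<in> orb X V x"
  shows "orb X V y = orb X V x"
proof -
  note D = stable_onD[OF S] and V = open_subgroupD[OF stable_onD(2)[OF S]]
  from y obtain v where v: "v \<in> V" "y = hact X v x" by (auto simp: orb_def)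
  have xX: "x \<in> hpoints X" using x D(4) by blast
  have vU: "g \<in> hgroup X" if "g \<in> V" for g using that D(3) by blast
  have vx: "hact X w y = hact X (w \<otimes> v) x" if "w \<in> V" for w
    using that v hact_mult[OF D(1) vU vU xX] by simp
  have "hact X w x = hact X (w \<otimes> inv v) y" if w: "w \<in> V" for w
  proof -
    have "w \<otimes> inv v \<in> V" using w v V by blast
    hence "hact X (w \<otimes> inv v) y = hact X (w \<otimes> inv v \<otimes> v) x" by (rule vx)
    moreover have "w \<in> carrier G" "v \<in> carrier G" using w v V(3) by auto
    ultimately show ?thesis by (simp add: m_assoc)
  qed
  hence "orb X V x \<subseteq> orb X V y" using V(5,6) v(1) unfolding orb_def by blast
  moreover have "orb X V y \<subseteq> orb X V x" using vx V(5) v(1) unfolding orb_def by blast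
  ultimately show ?thesis by blast
qed

lemma orbs_disjoint:
  assumes S: "stable_on X V S" and "O1 \<in> orb X V ` S" "O2 \<in> orb X V ` S" "O1 \<noteq> O2"
  shows "O1 \<inter> O2 = {}"
proof -
  from assms obtain x y where xy: "x \<in> S" "O1 = orb X V x" "y \<in> S" "O2 = orb X V y" by blast
  have False if "z \<in> O1" "z \<in> O2" for z
    using orb_eq[OF S xy(1), of z] orb_eq[OF S xy(3), of z] that xy assms(4) by simp
  thus ?thesis by blast
qed

lemma Union_orbs: "stable_on X V S \<Longrightarrow> \<Union> (orb X V ` S) = S"
  using orb_refl[of X V S] orb_subset[of X V S] by blast

lemma stable_on_orb:
  assumes S: "stable_on X V S" and x: "x \<in> S"
  shows "stable_on X V (orb X V x)"
proof -
  have "hact X v y \<in> orb X V x" if "v \<in> V" "y \<in> orb X V x" for v y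
    using orb_eq[OF S x that(2)] that(1) by (auto simp: orb_def)
  thus ?thesis using S orb_subset[OF S x] by (auto simp: stable_on_def)
qed

lemma fin_on_orb:
  assumes S: "stable_on X V S" and x: "x \<in> S"
  shows "fin_on X V (orb X V x)"
proof -
  have "orb X V ` orb X V x \<subseteq> {orb X V x}" using orb_eq[OF S x] by blast
  hence "finite (orb X V ` orb X V x)" by (rule finite_subset) simp
  thus ?thesis using stable_on_orb[OF S x] by (simp add: fin_on_def)
qed

text \<open>Restricted to \<open>W\<close>, the orbit \<open>V x\<close> splits into the pieces \<open>W g x\<close>, and \<open>W g x\<close> only depends on
  the double coset of \<open>g\<close> for \<open>W\<close> and the stabilizer of \<open>x\<close>.  This is the one place where Roelcke
  precompactness enters.\<close>

lemma fin_on_subgroup: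
  assumes S: "fin_on X V S" and W: "open_subgroup G T W" "W \<subseteq> V"
  shows "fin_on X W S"
proof -
  note st = fin_onD(1)[OF S]
  note D = stable_onD[OF st] and V = open_subgroupD[OF stable_onD(2)[OF st]]
  have vU: "g \<in> hgroup X" if "g \<in> V" for g using that D(3) by blast
  have vG: "g \<in> carrier G" if "g \<in> V" for g using that V(3) by blast
  have 1: "finite (orb X W ` orb X V x)" if x: "x \<in> S" for x
  proof -
    define H where "H = stab X V x"
    have xX: "x \<in> hpoints X" using x D(4) by blast
    have H: "open_subgroup G T H" unfolding H_def using open_stab[OF D(1-3) xX] .
    define \<Phi> where "\<Phi> C = (\<lambda>g. hact X g x) ` C" for C
    have eq: "orb X W (hact X g x) = \<Phi> ((W #> g) <#> H)" if g: "g \<in> V" for g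
    proof
      show "orb X W (hact X g x) \<subseteq> \<Phi> ((W #> g) <#> H)"
      proof
        fix y assume "y \<in> orb X W (hact X g x)"
        then obtain w where w: "w \<in> W" "y = hact X w (hact X g x)" by (auto simp: orb_def)
        have "y = hact X (w \<otimes> g \<otimes> \<one>) x"
          using w W g vG hact_mult[OF D(1) vU vU xX, of w g] by (simp add: subsetD)
        moreover have "w \<otimes> g \<otimes> \<one> \<in> (W #> g) <#> H"
          using w open_subgroupD(4)[OF H] by (auto simp: set_mult_def r_coset_def)
        ultimately show "y \<in> \<Phi> ((W #> g) <#> H)" by (auto simp: \<Phi>_def)
      qed
      show "\<Phi> ((W #> g) <#> H) \<subseteq> orb X W (hact X g x)"
      proof
        fix y assume "y \<in> \<Phi> ((W #> g) <#> H)"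
        then obtain w h where wh: "w \<in> W" "h \<in> H" "y = hact X (w \<otimes> g \<otimes> h) x"
          by (auto simp: \<Phi>_def set_mult_def r_coset_def)
        have V': "w \<in> V" "h \<in> V" "hact X h x = x" using wh W by (auto simp: H_def stab_def)
        have "y = hact X (w \<otimes> g) (hact X h x)"
          unfolding wh(3) using V' g V(5) by (intro hact_mult[OF D(1) vU vU xX]) auto
        also have "\<dots> = hact X w (hact X g x)"
          unfolding V'(3) using V' g by (intro hact_mult[OF D(1) vU vU xX]) auto
        finally show "y \<in> orb X W (hact X g x)" using wh by (auto simp: orb_def)
      qed
    qed
    have "orb X W ` orb X V x \<subseteq> \<Phi> ` {(W #> g) <#> H | g. g \<in> carrier G}"
      using eq vG by (fastforce simp: orb_def)
    thus ?thesis using finite_double_cosets[OF W(1) H] finite_surj by blast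
  qed
  have "orb X W ` S = (\<Union>C \<in> orb X V ` S. orb X W ` C)"
    using Union_orbs[OF st] by blast
  moreover have "finite (orb X W ` C)" if "C \<in> orb X V ` S" for C using that 1 by blast
  ultimately have "finite (orb X W ` S)" using fin_onD(2)[OF S] by (simp del: UN_simps image_eqI)
  thus ?thesis using stable_on_mono[OF st W] by (simp add: fin_on_def)
qed

lemma fin_on_supergroup:
  assumes S: "fin_on X W S" and V: "stable_on X V S" "W \<subseteq> V"
  shows "fin_on X V S"
proof -
  note st = fin_onD(1)[OF S]
  have "orb X V x = (\<Union>y \<in> orb X W x. orb X V y)" if x: "x \<in> S" for x
  proof -
    have "orb X V y = orb X V x" if "y \<in> orb X W x" for y
      using that V(2) by (intro orb_eq[OF V(1) x]) (auto simp: orb_def)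
    thus ?thesis using orb_refl[OF st x] by blast
  qed
  hence "orb X V ` S = (\<lambda>C. \<Union>y \<in> C. orb X V y) ` (orb X W ` S)"
    by (force simp: image_image)
  thus ?thesis using fin_onD(2)[OF S] V(1) by (simp add: fin_on_def)
qed

text \<open>Two groups of definition are compared through their intersection: finitely many orbits split
  into finitely many when the group shrinks, and orbits only merge when it grows.\<close>

lemma fin_on_change:
  assumes S: "fin_on X V S" and W: "stable_on X W S"
  shows "fin_on X W S"
proof -
  have "open_subgroup G T (V \<inter> W)"
    using stable_onD(2)[OF fin_onD(1)[OF S]] stable_onD(2)[OF W] by (rule open_subgroup_Int)
  hence "fin_on X (V \<inter> W) S" by (rule fin_on_subgroup[OF S]) blast
  thus ?thesis using W by (rule fin_on_supergroup) blast
qed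

lemma fin_on_subset:
  assumes S: "fin_on X V S" and R: "R \<subseteq> S" "\<And>v x. v \<in> V \<Longrightarrow> x \<in> R \<Longrightarrow> hact X v x \<in> R"
  shows "fin_on X V R"
  using assms finite_subset[OF image_mono[OF R(1)]] by (auto simp: fin_on_def stable_on_def)

lemma fin_on_Un:
  assumes "fin_on X V S" "fin_on X V R"
  shows "fin_on X V (S \<union> R)"
  using assms by (auto simp: fin_on_def stable_on_def image_Un)

lemma common_group:
  assumes "definable X S" "definable X R"
  obtains V where "fin_on X V S" "fin_on X V R"
proof -
  from assms obtain V W where VW: "fin_on X V S" "fin_on X W R" by (auto simp: definable_def)
  have "open_subgroup G T (V \<inter> W)"
    using VW by (intro open_subgroup_Int) (auto simp: fin_on_def stable_on_def)
  hence "fin_on X (V \<inter> W) S" "fin_on X (V \<inter> W) R" using VW by (auto intro: fin_on_subgroup)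
  thus ?thesis by (rule that)
qed

lemma definable_Un: "definable X S \<Longrightarrow> definable X R \<Longrightarrow> definable X (S \<union> R)"
  by (metis common_group definable_def fin_on_Un)

lemma definable_hat_set: "definable X S \<Longrightarrow> is_hat_set G T X"
  by (auto simp: definable_def fin_on_def stable_on_def)

lemma definable_empty:
  assumes "is_hat_set G T X" shows "definable X {}"
  using assms hat_set_open by (auto simp: definable_def fin_on_def stable_on_def)

lemma definable_UN:
  assumes "is_hat_set G T X" "finite I" "\<And>i. i \<in> I \<Longrightarrow> definable X (D i)"
  shows "definable X (\<Union>i \<in> I. D i)"
  using assms(2,3) by (induction I rule: finite_induct) (auto simp: definable_empty assms(1) definable_Un)

lemma fin_on_singleton:
  assumes X: "is_hat_set G T X" and x: "x \<in> hpoints X"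
  shows "fin_on X (stab X (hgroup X) x) {x}"
  using X x open_stab[OF X hat_set_open[OF X] order_refl x]
  by (auto simp: fin_on_def stable_on_def stab_def)

lemma orbits_eq: "orbits (G\<lparr>carrier := V\<rparr>) S (hact X) = orb X V ` S"
  by (auto simp: orbits_def orbit_def orb_def)

lemma finitary_iff: "finitary_hat_set G T X \<longleftrightarrow> fin_on X (hgroup X) (hpoints X)"
  by (auto simp: finitary_hat_set_def orbits_eq fin_on_def stable_on_def hact_closed hat_set_open)

lemma fin_on_cong:
  assumes "fin_on X V S" "is_hat_set G T Y" "V \<subseteq> hgroup Y" "S \<subseteq> hpoints Y"
    "\<And>v x. v \<in> V \<Longrightarrow> x \<in> S \<Longrightarrow> hact Y v x = hact X v x"
  shows "fin_on Y V S"
proof -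
  have "orb Y V x = orb X V x" if "x \<in> S" for x using that assms(5) by (auto simp: orb_def)
  hence "orb Y V ` S = orb X V ` S" by auto
  thus ?thesis using assms by (auto simp: fin_on_def stable_on_def)
qed

lemma stable_hat_set:
  assumes S: "stable_on X V S"
  shows "is_hat_set G T \<lparr>hpoints = S, hgroup = V, hact = \<lambda>g. restrict (hact X g) S\<rparr>"
proof -
  note D = stable_onD[OF S]
  have VX: "v \<in> hgroup X" if "v \<in> V" for v using that D(3) by blast
  have SX: "x \<in> hpoints X" if "x \<in> S" for x using that D(4) by blast
  show ?thesis
  proof (rule is_hat_setI, simp_all)
    fix x assume x: "x \<in> S"
    have "open_subgroup G T (stab X V x)" using open_stab[OF D(1-3) SX[OF x]] .
    thus "\<exists>W. open_subgroup G T W \<and> W \<subseteq> V \<and> (\<forall>w \<in> W. hact X w x = x)"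
      by (intro exI[of _ "stab X V x"]) (auto simp: stab_def)
  qed (use D SX VX hact_one[OF D(1)] hact_mult[OF D(1)] open_subgroupD(5)[OF D(2)] in auto)
qed

lemma fin_on_finitary:
  assumes S: "fin_on X V S"
  shows "finitary_hat_set G T \<lparr>hpoints = S, hgroup = V, hact = \<lambda>g. restrict (hact X g) S\<rparr>"
proof -
  let ?Y = "\<lparr>hpoints = S, hgroup = V, hact = \<lambda>g. restrict (hact X g) S\<rparr>"
  have "fin_on ?Y V S" using stable_hat_set[OF fin_onD(1)[OF S]] by (rule fin_on_cong[OF S]) simp_all
  thus ?thesis by (simp add: finitary_iff)
qed

text \<open>The setwise stabilizer used by \<open>hat_sub\<close> is open because it contains \<open>V\<close>.\<close>

lemma stable_on_setwise_stabilizer: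
  assumes S: "stable_on X V S"
  shows "stable_on X {g \<in> hgroup X. hact X g ` S = S} S" "V \<subseteq> {g \<in> hgroup X. hact X g ` S = S}"
proof -
  note D = stable_onD[OF S]
  note V = open_subgroupD[OF D(2)] and U = open_subgroupD[OF hat_set_open[OF D(1)]]
  have SX: "x \<in> hpoints X" if "x \<in> S" for x using that D(4) by blast
  let ?W = "{g \<in> hgroup X. hact X g ` S = S}"
  show VW: "V \<subseteq> ?W"
  proof
    fix v assume v: "v \<in> V"
    hence vX: "v \<in> hgroup X" using D(3) by blast
    have "x \<in> hact X v ` S" if x: "x \<in> S" for x
      using hact_inv(2)[OF D(1) vX SX[OF x]] D(5)[OF V(6)[OF v] x] by (metis imageI)
    thus "v \<in> ?W" using vX D(5)[OF v] by auto
  qed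
  have "subgroup ?W G"
  proof (rule subgroupI)
    show "?W \<subseteq> carrier G" using U by auto
    show "?W \<noteq> {}" using VW V(4) by blast
    fix a assume a: "a \<in> ?W"
    have "hact X (inv a) ` S = hact X (inv a) ` hact X a ` S" using a by simp
    also have "\<dots> = S" unfolding image_image using hact_inv(1)[OF D(1) _ SX] a by simp
    finally show "inv a \<in> ?W" using a U by simp
    fix b assume b: "b \<in> ?W"
    have "hact X (a \<otimes> b) ` S = hact X a ` hact X b ` S"
      unfolding image_image using a b hact_mult[OF D(1) _ _ SX] by simp
    thus "a \<otimes> b \<in> ?W" using a b U by simp
  qed
  hence "open_subgroup G T ?W" using open_subgroup_supergroup[OF D(2) _ VW] by blast
  thus "stable_on X ?W S" using D by (auto simp: stable_on_def)
qed

lemma finitary_hat_sub: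
  assumes S: "definable X S"
  shows "finitary_hat_set G T (hat_sub X S)"
proof -
  from S obtain V where V: "fin_on X V S" by (auto simp: definable_def)
  from fin_on_change[OF V stable_on_setwise_stabilizer(1)[OF fin_onD(1)[OF V]]]
  show ?thesis unfolding hat_sub_def by (rule fin_on_finitary)
qed


section \<open>Finiteness along equivariant maps\<close>

lemma fin_on_image:
  assumes S: "fin_on Z V S" and R: "stable_on Y V R" and f: "R \<subseteq> f ` S"
    and eq: "\<And>v z. v \<in> V \<Longrightarrow> z \<in> S \<Longrightarrow> f (hact Z v z) = hact Y v (f z)"
  shows "fin_on Y V R"
proof -
  have "orb Y V (f z) = f ` orb Z V z" if "z \<in> S" for z
    using that eq by (auto simp: orb_def image_image)
  hence "orb Y V ` f ` S = (\<lambda>C. f ` C) ` (orb Z V ` S)" by (simp add: image_image)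
  hence "orb Y V ` R \<subseteq> (\<lambda>C. f ` C) ` (orb Z V ` S)" using image_mono[OF f, of "orb Y V"] by simp
  thus ?thesis using R fin_onD(2)[OF S] finite_surj by (auto simp: fin_on_def)
qed

lemma fiber_stable:
  assumes S: "stable_on Z V S" and R: "stable_on Y V R" and f: "f ` S \<subseteq> R"
    and eq: "\<And>v z. v \<in> V \<Longrightarrow> z \<in> S \<Longrightarrow> f (hact Z v z) = hact Y v (f z)" and y: "y \<in> R"
  shows "stable_on Z (stab Y V y) {z \<in> S. f z = y}"
proof -
  note D = stable_onD[OF S] and E = stable_onD[OF R]
  have "open_subgroup G T (stab Y V y)" using open_stab[OF E(1-3)] y E(4) by blast
  thus ?thesis using D eq by (auto simp: stable_on_def stab_def)
qed

text \<open>The \<open>V\<close>-orbits of \<open>S\<close> that meet the fiber over \<open>y\<close> cut it in single orbits of the stabilizer of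
  \<open>y\<close>.\<close>

lemma fiber_orb:
  assumes S: "stable_on Z V S" and R: "stable_on Y V R" and f: "f ` S \<subseteq> R"
    and eq: "\<And>v z. v \<in> V \<Longrightarrow> z \<in> S \<Longrightarrow> f (hact Z v z) = hact Y v (f z)"
    and z: "z \<in> S"
  shows "{w \<in> orb Z V z. f w = f z} = orb Z (stab Y V (f z)) z"
  using eq z by (auto simp: orb_def stab_def)

lemma fin_on_fiber:
  assumes S: "fin_on Z V S" and R: "stable_on Y V R" and f: "f ` S \<subseteq> R"
    and eq: "\<And>v z. v \<in> V \<Longrightarrow> z \<in> S \<Longrightarrow> f (hact Z v z) = hact Y v (f z)" and y: "y \<in> R"
  shows "fin_on Z (stab Y V y) {z \<in> S. f z = y}"
proof -
  have cut: "orb Z (stab Y V y) z \<in> (\<lambda>C. {w \<in> C. f w = y}) ` (orb Z V ` S)"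
    if "z \<in> S" "f z = y" for z
  proof (rule image_eqI)
    show "orb Z (stab Y V y) z = {w \<in> orb Z V z. f w = y}"
      using fiber_orb[OF fin_onD(1)[OF S] R f eq that(1)] that(2) by simp
    show "orb Z V z \<in> orb Z V ` S" using that(1) by simp
  qed
  have "orb Z (stab Y V y) ` {z \<in> S. f z = y} \<subseteq> (\<lambda>C. {w \<in> C. f w = y}) ` (orb Z V ` S)"
    by (intro image_subsetI cut) simp_all
  hence "finite (orb Z (stab Y V y) ` {z \<in> S. f z = y})"
    by (rule finite_subset[OF _ finite_imageI[OF fin_onD(2)[OF S]]])
  thus ?thesis
    using fiber_stable[where f = f, OF fin_onD(1)[OF S] R f eq y] by (simp add: fin_on_def)
qed

text \<open>Every \<open>V\<close>-orbit of \<open>S\<close> meets the fiber over one of finitely many representatives of the orbits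
  of \<open>R\<close>, and in each of these fibers the stabilizer has finitely many orbits.\<close>

lemma fin_on_total_space:
  assumes S: "stable_on Z V S" and R: "fin_on Y V R" and f: "f ` S \<subseteq> R"
    and eq: "\<And>v z. v \<in> V \<Longrightarrow> z \<in> S \<Longrightarrow> f (hact Z v z) = hact Y v (f z)"
    and fib: "\<And>y. y \<in> R \<Longrightarrow> fin_on Z (stab Y V y) {z \<in> S. f z = y}"
  shows "fin_on Z V S"
proof -
  note D = stable_onD[OF S] and E = stable_onD[OF fin_onD(1)[OF R]]
  have fin1: "finite (orb Z V ` {z \<in> S. f z = y})" if y: "y \<in> R" for y
  proof -
    have sub: "orb Z (stab Y V y) z \<subseteq> orb Z V z" for z by (auto simp: orb_def stab_def)
    have "orb Z V z = (\<Union>w \<in> orb Z (stab Y V y) z. orb Z V w)" if z: "z \<in> S" "f z = y" for z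
    proof -
      have "z \<in> orb Z (stab Y V y) z" using orb_refl[OF fin_onD(1)[OF fib[OF y]]] z by simp
      thus ?thesis using orb_eq[OF S z(1)] sub[of z] by blast
    qed
    hence "orb Z V ` {z \<in> S. f z = y}
        = (\<lambda>C. \<Union>w \<in> C. orb Z V w) ` (orb Z (stab Y V y) ` {z \<in> S. f z = y})"
      unfolding image_image by (intro image_cong) auto
    thus ?thesis using finite_imageI[OF fin_onD(2)[OF fib[OF y]]] by simp
  qed
  obtain rep where rep: "\<And>C. C \<in> orb Y V ` R \<Longrightarrow> rep C \<in> R \<and> orb Y V (rep C) = C"
    using bchoice[of "orb Y V ` R" "\<lambda>C y. y \<in> R \<and> orb Y V y = C"] by blast
  have "orb Z V z \<in> (\<Union>C \<in> orb Y V ` R. orb Z V ` {z \<in> S. f z = rep C})" if z: "z \<in> S" for z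
  proof -
    let ?C = "orb Y V (f z)"
    have C: "?C \<in> orb Y V ` R" using f z by blast
    have "rep ?C \<in> ?C" using rep[OF C] orb_refl[OF fin_onD(1)[OF R]] by metis
    then obtain v where v: "v \<in> V" "rep ?C = hact Y v (f z)" by (auto simp: orb_def)
    have "hact Z v z \<in> S" "f (hact Z v z) = rep ?C" using v D(5) z eq by auto
    moreover have "orb Z V (hact Z v z) = orb Z V z"
      using v by (intro orb_eq[OF S z]) (auto simp: orb_def)
    ultimately have "orb Z V z \<in> orb Z V ` {z \<in> S. f z = rep ?C}"
      by (intro image_eqI[of _ _ "hact Z v z"]) simp_all
    thus ?thesis using C by blast
  qed
  hence "orb Z V ` S \<subseteq> (\<Union>C \<in> orb Y V ` R. orb Z V ` {z \<in> S. f z = rep C})"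
    by (intro image_subsetI)
  moreover have "finite (\<Union>C \<in> orb Y V ` R. orb Z V ` {z \<in> S. f z = rep C})"
    by (intro finite_UN_I fin_onD(2)[OF R] fin1 conjunct1[OF rep])
  ultimately have "finite (orb Z V ` S)" by (rule finite_subset)
  thus ?thesis using S by (simp add: fin_on_def)
qed


section \<open>Translation and conjugation\<close>

text \<open>The map \<open>x \<mapsto> g x\<close> turns the action of \<open>v\<close> into that of \<open>g v g\<^sup>-\<^sup>1\<close>.\<close>

lemma fin_on_translate:
  assumes S: "fin_on X V S" and g: "g \<in> hgroup X"
  shows "fin_on X {g \<otimes> v \<otimes> inv g | v. v \<in> V} (hact X g ` S)"
proof -
  let ?C = "{g \<otimes> v \<otimes> inv g | v. v \<in> V}"
  note D = stable_onD[OF fin_onD(1)[OF S]]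
  note U = open_subgroupD[OF hat_set_open[OF D(1)]]
  have VX: "v \<in> hgroup X" if "v \<in> V" for v using that D(3) by blast
  have SX: "x \<in> hpoints X" if "x \<in> S" for x using that D(4) by blast
  have gG: "g \<in> carrier G" using g U(3) by blast
  have act: "hact X (g \<otimes> v \<otimes> inv g) (hact X g x) = hact X g (hact X v x)" if "v \<in> V" "x \<in> S" for v x
    using that g VX SX U(5,6) hact_closed[OF D(1)]
    by (simp add: hact_mult[OF D(1)] hact_inv[OF D(1)])
  have "open_subgroup G T ?C" by (rule open_subgroup_conj[OF D(2) gG])
  moreover have "?C \<subseteq> hgroup X" using VX g U(5,6) by blast
  moreover have "hact X g ` S \<subseteq> hpoints X" using hact_closed[OF D(1) g] SX by blast
  moreover have "hact X c y \<in> hact X g ` S" if "c \<in> ?C" "y \<in> hact X g ` S" for c y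
    using that act D(5) by auto
  ultimately have "stable_on X ?C (hact X g ` S)" using D(1) unfolding stable_on_def by blast
  moreover have "orb X ?C (hact X g x) = hact X g ` orb X V x" if "x \<in> S" for x
  proof -
    have "orb X ?C (hact X g x) = (\<lambda>v. hact X (g \<otimes> v \<otimes> inv g) (hact X g x)) ` V"
      unfolding orb_def by blast
    also have "\<dots> = hact X g ` orb X V x"
      unfolding orb_def image_image using act that by (intro image_cong) auto
    finally show ?thesis .
  qed
  hence "orb X ?C ` hact X g ` S = (\<lambda>O1. hact X g ` O1) ` (orb X V ` S)"
    unfolding image_image by (intro image_cong) auto
  ultimately show ?thesis using fin_onD(2)[OF S] by (simp add: fin_on_def)
qed

lemma finitary_hat_conj:
  assumes X: "finitary_hat_set G T X" and g: "g \<in> carrier G"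
  shows "finitary_hat_set G T (hat_conj G g X)"
proof -
  let ?U = "hgroup X" and ?C = "{g \<otimes> u \<otimes> inv g | u. u \<in> hgroup X}"
  have F: "fin_on X ?U (hpoints X)" using X by (simp add: finitary_iff)
  note D = stable_onD[OF fin_onD(1)[OF F]]
  note U = open_subgroupD[OF D(2)]
  note mem = conj_mem[OF U(3) g]
  have hs: "is_hat_set G T (hat_conj G g X)"
  proof (rule is_hat_setI)
    show "open_subgroup G T (hgroup (hat_conj G g X))"
      using open_subgroup_conj[OF D(2) g] by (simp add: hat_conj_def)
    fix x assume "x \<in> hpoints (hat_conj G g X)"
    hence x: "x \<in> hpoints X" by (simp add: hat_conj_def)
    show "hact (hat_conj G g X) \<one> x = x" using g x hact_one[OF D(1)] by (simp add: hat_conj_def)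
    let ?W = "{g \<otimes> u \<otimes> inv g | u. u \<in> stab X ?U x}"
    have st: "open_subgroup G T (stab X ?U x)" using open_stab[OF D(1-3) x] .
    have "hact (hat_conj G g X) w x = x" if "w \<in> ?W" for w
      using conj_mem[OF open_subgroupD(3)[OF st] g, of w] that by (simp add: hat_conj_def stab_def)
    moreover have "?W \<subseteq> hgroup (hat_conj G g X)" by (auto simp: hat_conj_def stab_def)
    ultimately show "\<exists>W. open_subgroup G T W \<and> W \<subseteq> hgroup (hat_conj G g X) \<and>
        (\<forall>w \<in> W. hact (hat_conj G g X) w x = x)"
      using open_subgroup_conj[OF st g] by blast
    fix a assume "a \<in> hgroup (hat_conj G g X)"
    hence a: "a \<in> carrier G" "inv g \<otimes> a \<otimes> g \<in> ?U" using mem[of a] by (simp_all add: hat_conj_def)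
    show "hact (hat_conj G g X) a x \<in> hpoints (hat_conj G g X)"
      using a D(5) x by (simp add: hat_conj_def)
    fix b assume "b \<in> hgroup (hat_conj G g X)"
    hence b: "b \<in> carrier G" "inv g \<otimes> b \<otimes> g \<in> ?U" using mem[of b] by (simp_all add: hat_conj_def)
    have "inv g \<otimes> (a \<otimes> b) \<otimes> g = (inv g \<otimes> a \<otimes> g) \<otimes> (inv g \<otimes> b \<otimes> g)"
      using g a b by (simp add: m_assoc inv_cancel_left)
    thus "hact (hat_conj G g X) (a \<otimes> b) x = hact (hat_conj G g X) a (hact (hat_conj G g X) b x)"
      using hact_mult[OF D(1) a(2) b(2) x] by (simp add: hat_conj_def)
  next
    fix a assume "a \<in> hgroup (hat_conj G g X)"
    hence "inv g \<otimes> a \<otimes> g \<in> ?U" using mem[of a] by (simp add: hat_conj_def)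
    thus "hact (hat_conj G g X) a \<in> extensional (hpoints (hat_conj G g X))"
      using hact_extensional[OF D(1)] by (simp add: hat_conj_def)
  qed
  have "orb (hat_conj G g X) ?C x = orb X ?U x" for x
  proof -
    have "orb (hat_conj G g X) ?C x = (\<lambda>u. hact X (inv g \<otimes> (g \<otimes> u \<otimes> inv g) \<otimes> g) x) ` ?U"
      unfolding orb_def hat_conj_def by auto
    also have "\<dots> = orb X ?U x"
      unfolding orb_def using U(3) g by (intro image_cong) (auto simp: conj_cancel)
    finally show ?thesis .
  qed
  hence "finite (orb (hat_conj G g X) ?C ` hpoints X)" using fin_onD(2)[OF F] by simp
  moreover have "hgroup (hat_conj G g X) = ?C" "hpoints (hat_conj G g X) = hpoints X"
    by (simp_all add: hat_conj_def)
  ultimately show ?thesis using hs unfolding finitary_hat_set_def orbits_eq by simp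
qed


section \<open>Copies on coset-space points\<close>

definition transport :: "('x \<Rightarrow> 'y) \<Rightarrow> ('g, 'x) hat_set \<Rightarrow> ('g, 'y) hat_set" where
  "transport e X = \<lparr>hpoints = e ` hpoints X, hgroup = hgroup X,
     hact = \<lambda>g. \<lambda>y \<in> e ` hpoints X. e (hact X g (inv_into (hpoints X) e y))\<rparr>"

lemma transport_finitary:
  assumes X: "finitary_hat_set G T X" and e: "inj_on e (hpoints X)"
  shows "finitary_hat_set G T (transport e X)"
    "\<And>g x. x \<in> hpoints X \<Longrightarrow> hact (transport e X) g (e x) = e (hact X g x)"
proof -
  have F: "fin_on X (hgroup X) (hpoints X)" using X by (simp add: finitary_iff)
  note D = stable_onD[OF fin_onD(1)[OF F]]
  show eq: "hact (transport e X) g (e x) = e (hact X g x)" if "x \<in> hpoints X" for g x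
    using that e by (simp add: transport_def)
  have "is_hat_set G T (transport e X)"
  proof (rule is_hat_setI)
    fix y assume "y \<in> hpoints (transport e X)"
    then obtain x where x: "x \<in> hpoints X" "y = e x" by (auto simp: transport_def)
    show "hact (transport e X) \<one> y = y" using x hact_one[OF D(1)] by (simp add: eq)
    have "hact (transport e X) w y = y" if "w \<in> stab X (hgroup X) x" for w
      using that x eq by (simp add: stab_def)
    moreover have "stab X (hgroup X) x \<subseteq> hgroup (transport e X)"
      by (auto simp: stab_def transport_def)
    ultimately show "\<exists>W. open_subgroup G T W \<and> W \<subseteq> hgroup (transport e X) \<and>
            (\<forall>w \<in> W. hact (transport e X) w y = y)"
      using open_stab[OF D(1-3) x(1)] by blast
    fix g assume g: "g \<in> hgroup (transport e X)"
    hence gX: "g \<in> hgroup X" by (simp add: transport_def)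
    show "hact (transport e X) g y \<in> hpoints (transport e X)"
      unfolding x(2) eq[OF x(1)] using D(5)[OF gX x(1)] by (simp add: transport_def)
    fix h assume "h \<in> hgroup (transport e X)"
    hence hX: "h \<in> hgroup X" by (simp add: transport_def)
    show "hact (transport e X) (g \<otimes> h) y = hact (transport e X) g (hact (transport e X) h y)"
      using x D(5) gX hX by (simp add: eq hact_mult[OF D(1)])
  qed (use D in \<open>simp_all add: transport_def\<close>)
  moreover from this have "stable_on (transport e X) (hgroup X) (e ` hpoints X)"
    using hact_closed hat_set_open by (fastforce simp: stable_on_def transport_def)
  hence "fin_on (transport e X) (hgroup X) (e ` hpoints X)"
    by (rule fin_on_image[OF F _ order_refl]) (simp add: eq)
  ultimately show "finitary_hat_set G T (transport e X)"
    by (simp add: finitary_iff transport_def)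
qed

text \<open>Measures are defined on hat-sets with points in \<open>nat \<times> 'g set\<close> only.  A copy is the form in which
  a finitary subset is passed to a measure.\<close>

definition copy_of ::
  "('g, 'x) hat_set \<Rightarrow> 'g set \<Rightarrow> 'x set \<Rightarrow> ('x \<Rightarrow> nat \<times> 'g set) \<Rightarrow> ('g, nat \<times> 'g set) hat_set \<Rightarrow> bool"
  where "copy_of X V S e Y \<longleftrightarrow>
     fin_on X V S \<and> finitary_hat_set G T Y \<and> hgroup Y = V \<and> bij_betw e S (hpoints Y) \<and>
     (\<forall>v \<in> V. \<forall>x \<in> S. e (hact X v x) = hact Y v (e x))"

text \<open>Unlike in \<open>hat_universe\<close>, the group of definition of the copy is prescribed.\<close>

lemma copy_exists:
  assumes S: "fin_on X V S"
  obtains e Y where "copy_of X V S e Y"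
proof -
  let ?X = "\<lparr>hpoints = S, hgroup = V, hact = \<lambda>g. restrict (hact X g) S\<rparr>"
  have X: "finitary_hat_set G T ?X" using S by (rule fin_on_finitary)
  from hat_universe[OF is_group this] obtain Y :: "('g, nat \<times> 'g set) hat_set" and e
    where e: "bij_betw e S (hpoints Y)" by (auto simp: hat_isomorphic_def)
  hence "inj_on e (hpoints ?X)" by (simp add: bij_betw_def)
  from transport_finitary[OF X this] have "copy_of X V S e (transport e ?X)"
    using S e by (auto simp: copy_of_def transport_def bij_betw_def)
  thus ?thesis by (rule that)
qed

end


section \<open>Measures of definable sets\<close>

locale hat_integration = pro_oligomorphic_group G T + k: cring k
  for G :: "('g, 'm) monoid_scheme" (structure) and T :: "'g topology"
    and k :: "('k, 'n) ring_scheme" +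
  fixes \<mu> :: "('g, 'k) hat_fun"
  assumes measure: "hat_measure G T k \<mu>"
begin

lemmas measure_closed = measure[unfolded hat_measure_def, THEN conjunct1, rule_format]
lemmas measure_iso = measure[unfolded hat_measure_def, THEN conjunct2, THEN conjunct1, rule_format]
lemmas measure_point = measure[unfolded hat_measure_def, THEN conjunct2, THEN conjunct2, THEN conjunct1, rule_format]
lemmas measure_sum = measure[unfolded hat_measure_def, THEN conjunct2, THEN conjunct2, THEN conjunct2, THEN conjunct1, rule_format]
lemmas measure_conj = measure[unfolded hat_measure_def, THEN conjunct2, THEN conjunct2, THEN conjunct2, THEN conjunct2, THEN conjunct1, rule_format]
lemmas measure_fiber = measure[unfolded hat_measure_def, THEN conjunct2, THEN conjunct2, THEN conjunct2, THEN conjunct2, THEN conjunct2, rule_format]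

text \<open>The choice made in \<open>mval\<close> is immaterial: two sets isomorphic to \<open>A\<close> are isomorphic to each other.
  Only stability of \<open>A\<close> under its action is needed for that, so \<open>A\<close> may be a disjoint sum of copies.\<close>

lemma mval_eq:
  assumes cl: "\<And>g x. g \<in> hgroup A \<Longrightarrow> x \<in> hpoints A \<Longrightarrow> hact A g x \<in> hpoints A"
    and Y: "finitary_hat_set G T Y" and iso: "hat_isomorphic G T A Y"
  shows "mval G T \<mu> A = \<mu> Y"
proof -
  define Z :: "('g, nat \<times> 'g set) hat_set"
    where "Z = (SOME Z. finitary_hat_set G T Z \<and> hat_isomorphic G T A Z)"
  have "finitary_hat_set G T Z \<and> hat_isomorphic G T A Z"
    unfolding Z_def by (rule someI[of _ Y]) (use Y iso in blast)
  then obtain f V where Z: "finitary_hat_set G T Z" and f: "bij_betw f (hpoints A) (hpoints Z)"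
    and V: "open_subgroup G T V" "V \<subseteq> hgroup A \<inter> hgroup Z"
      "\<And>v x. v \<in> V \<Longrightarrow> x \<in> hpoints A \<Longrightarrow> f (hact A v x) = hact Z v (f x)"
    by (auto simp: hat_isomorphic_def hat_map_def)
  from iso obtain h W where h: "bij_betw h (hpoints A) (hpoints Y)"
    and W: "open_subgroup G T W" "W \<subseteq> hgroup A \<inter> hgroup Y"
      "\<And>v x. v \<in> W \<Longrightarrow> x \<in> hpoints A \<Longrightarrow> h (hact A v x) = hact Y v (h x)"
    by (auto simp: hat_isomorphic_def hat_map_def)
  define r where "r = inv_into (hpoints A) f"
  have r: "r (f x) = x" if "x \<in> hpoints A" for x
    using f that by (simp add: r_def bij_betw_def)
  have bij: "bij_betw (h \<circ> r) (hpoints Z) (hpoints Y)"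
    unfolding r_def by (rule bij_betw_trans[OF bij_betw_inv_into[OF f] h])
  moreover have "(h \<circ> r) (hact Z v z) = hact Y v ((h \<circ> r) z)"
    if v: "v \<in> V \<inter> W" and z: "z \<in> hpoints Z" for v z
  proof -
    from z f obtain x where x: "x \<in> hpoints A" "z = f x" by (auto simp: bij_betw_def)
    hence "hact Z v z = f (hact A v x)" using V v by simp
    thus ?thesis using x v V(2) W cl by (simp add: r subset_iff)
  qed
  moreover have "V \<inter> W \<subseteq> hgroup Z \<inter> hgroup Y" using V(2) W(2) by blast
  ultimately have "hat_map G T Z Y (h \<circ> r)"
    using open_subgroup_Int[OF V(1) W(1)] bij_betw_imp_funcset[OF bij] unfolding hat_map_def
    by (intro conjI exI[of _ "V \<inter> W"] ballI) simp_all
  hence "hat_isomorphic G T Z Y" using bij by (auto simp: hat_isomorphic_def)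
  hence "\<mu> Z = \<mu> Y" using measure_iso Z Y by blast
  thus ?thesis by (simp add: mval_def Z_def)
qed

definition meas :: "('g, 'x) hat_set \<Rightarrow> 'x set \<Rightarrow> 'k" where
  "meas X S = mval G T \<mu> (hat_sub X S)"

lemma meas_eq:
  assumes S: "fin_on X V S" and Y: "finitary_hat_set G T Y" "V \<subseteq> hgroup Y"
    and e: "bij_betw e S (hpoints Y)" "\<And>v x. v \<in> V \<Longrightarrow> x \<in> S \<Longrightarrow> e (hact X v x) = hact Y v (e x)"
  shows "meas X S = \<mu> Y"
  unfolding meas_def
proof (rule mval_eq[OF _ Y(1)])
  show "hact (hat_sub X S) g x \<in> hpoints (hat_sub X S)"
    if "g \<in> hgroup (hat_sub X S)" "x \<in> hpoints (hat_sub X S)" for g x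
    using that by (auto simp: hat_sub_def)
  note D = stable_onD[OF fin_onD(1)[OF S]]
  have "V \<subseteq> hgroup (hat_sub X S)"
    using stable_on_setwise_stabilizer(2)[OF fin_onD(1)[OF S]] by (simp add: hat_sub_def)
  thus "hat_isomorphic G T (hat_sub X S) Y"
    unfolding hat_isomorphic_def hat_map_def using D Y e
    by (intro exI[of _ e] conjI exI[of _ V]) (auto simp: hat_sub_def bij_betw_def)
qed

lemma meas_copy:
  assumes "copy_of X V S e Y" shows "meas X S = \<mu> Y"
  using assms by (intro meas_eq[of X V S Y e]) (auto simp: copy_of_def)

lemma meas_closed:
  assumes "definable X S" shows "meas X S \<in> carrier k"
proof -
  from assms obtain V where "fin_on X V S" by (auto simp: definable_def)
  then obtain e Y where Y: "copy_of X V S e Y" by (rule copy_exists)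
  thus ?thesis using measure_closed[of Y] meas_copy[OF Y] by (auto simp: copy_of_def)
qed

lemma meas_singleton:
  assumes X: "is_hat_set G T X" and x: "x \<in> hpoints X"
  shows "meas X {x} = \<one>\<^bsub>k\<^esub>"
proof -
  obtain e Y where Y: "copy_of X (stab X (hgroup X) x) {x} e Y"
    using copy_exists[OF fin_on_singleton[OF X x]] .
  hence "hpoints Y = {e x}" by (auto simp: copy_of_def bij_betw_def)
  moreover have "finitary_hat_set G T Y" using Y by (simp add: copy_of_def)
  ultimately have "\<mu> Y = \<one>\<^bsub>k\<^esub>" using measure_point by blast
  thus ?thesis by (simp add: meas_copy[OF Y])
qed

text \<open>With a common group \<open>V\<close> for \<open>S\<close> and \<open>R\<close>, the disjoint sum of their copies is isomorphic to a copy of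
  the union.\<close>

lemma meas_Un:
  assumes "definable X S" "definable X R" and dis: "S \<inter> R = {}"
  shows "meas X (S \<union> R) = meas X S \<oplus>\<^bsub>k\<^esub> meas X R"
proof -
  from assms(1,2) obtain V where V: "fin_on X V S" "fin_on X V R" by (rule common_group)
  obtain e1 Y1 where 1: "copy_of X V S e1 Y1" using copy_exists[OF V(1)] .
  obtain e2 Y2 where 2: "copy_of X V R e2 Y2" using copy_exists[OF V(2)] .
  obtain e Y where Y: "copy_of X V (S \<union> R) e Y" using copy_exists[OF fin_on_Un[OF V]] .
  note D = stable_onD[OF fin_onD(1)[OF V(1)]]
  have D': "\<And>v x. v \<in> V \<Longrightarrow> x \<in> R \<Longrightarrow> hact X v x \<in> R"
    using stable_onD(5)[OF fin_onD(1)[OF V(2)]] .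
  let ?Z = "hat_sum Y1 Y2"
  define r where "r = case_sum (inv_into S e1) (inv_into R e2)"
  have r: "\<And>x. x \<in> S \<Longrightarrow> r (Inl (e1 x)) = x" "\<And>x. x \<in> R \<Longrightarrow> r (Inr (e2 x)) = x"
    using 1 2 by (simp_all add: r_def copy_of_def bij_betw_def)
  have pts: "hpoints ?Z = Inl ` e1 ` S \<union> Inr ` e2 ` R"
    using 1 2 by (auto simp: hat_sum_def copy_of_def bij_betw_def Plus_def)
  have "finitary_hat_set G T Y1" "finitary_hat_set G T Y2"
    using 1 2 by (simp_all add: copy_of_def)
  hence "mval G T \<mu> ?Z = \<mu> Y1 \<oplus>\<^bsub>k\<^esub> \<mu> Y2" using measure_sum by blast
  moreover have "mval G T \<mu> ?Z = \<mu> Y"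
  proof (rule mval_eq)
    have gZ: "hgroup ?Z = V" using 1 2 by (simp add: hat_sum_def copy_of_def)
    have actZ: "hact ?Z v (Inl (e1 x)) = Inl (e1 (hact X v x))" if "v \<in> V" "x \<in> S" for v x
      using that 1 by (auto simp: hat_sum_def copy_of_def bij_betw_def)
    have actZ': "hact ?Z v (Inr (e2 x)) = Inr (e2 (hact X v x))" if "v \<in> V" "x \<in> R" for v x
      using that 2 by (auto simp: hat_sum_def copy_of_def bij_betw_def)
    show "hact ?Z g z \<in> hpoints ?Z" if "g \<in> hgroup ?Z" "z \<in> hpoints ?Z" for g z
      using that actZ actZ' D(5) D' unfolding gZ pts by fastforce
    show "finitary_hat_set G T Y" using Y by (simp add: copy_of_def)
    have rb: "bij_betw r (hpoints ?Z) (S \<union> R)"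
      by (rule bij_betw_byWitness[where f' = "\<lambda>x. if x \<in> S then Inl (e1 x) else Inr (e2 x)"])
         (use dis in \<open>auto simp: pts r\<close>)
    have eb: "bij_betw e (S \<union> R) (hpoints Y)" using Y by (simp add: copy_of_def)
    have "e (r (hact ?Z v z)) = hact Y v (e (r z))" if v: "v \<in> V" and z: "z \<in> hpoints ?Z" for v z
    proof -
      have eY: "e (hact X v x) = hact Y v (e x)" if "x \<in> S \<union> R" for x
        using Y v that by (simp add: copy_of_def)
      from z consider x where "x \<in> S" "z = Inl (e1 x)" | x where "x \<in> R" "z = Inr (e2 x)"
        unfolding pts by blast
      thus ?thesis
        by cases (use v D(5) D' in \<open>simp_all add: actZ actZ' r eY\<close>)
    qed
    moreover have "V \<subseteq> hgroup ?Z \<inter> hgroup Y" using Y gZ by (simp add: copy_of_def)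
    ultimately show "hat_isomorphic G T ?Z Y"
      unfolding hat_isomorphic_def hat_map_def
      using bij_betw_trans[OF rb eb] D(2) bij_betw_imp_funcset[OF bij_betw_trans[OF rb eb]]
      by (intro exI[of _ "e \<circ> r"] conjI exI[of _ V]) auto
  qed
  ultimately show ?thesis by (simp add: meas_copy[OF 1] meas_copy[OF 2] meas_copy[OF Y])
qed

lemma meas_empty:
  assumes X: "is_hat_set G T X" shows "meas X {} = \<zero>\<^bsub>k\<^esub>"
  using meas_Un[OF definable_empty[OF X] definable_empty[OF X]] meas_closed[OF definable_empty[OF X]]
  by simp

lemma meas_UN:
  assumes X: "is_hat_set G T X" and I: "finite I" and D: "\<And>i. i \<in> I \<Longrightarrow> definable X (D i)"
    and dis: "disjoint_family_on D I"
  shows "meas X (\<Union>i \<in> I. D i) = (\<Oplus>\<^bsub>k\<^esub>i \<in> I. meas X (D i))"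
  using I D dis
proof (induction I rule: finite_induct)
  case empty
  thus ?case by (simp add: meas_empty X)
next
  case (insert a I)
  have dis: "disjoint_family_on D I" "D a \<inter> (\<Union>i \<in> I. D i) = {}"
    using insert.prems(2) insert.hyps(2) by (auto simp: disjoint_family_on_def)
  have "meas X (D a \<union> (\<Union>i \<in> I. D i)) = meas X (D a) \<oplus>\<^bsub>k\<^esub> meas X (\<Union>i \<in> I. D i)"
    using insert dis X by (intro meas_Un definable_UN) auto
  thus ?case using insert dis by (auto simp: meas_closed)
qed

text \<open>Via \<open>x \<mapsto> g x\<close> the translate is a copy of the conjugate of \<open>S\<close> by \<open>g\<close>, and measures do not see
  conjugation.\<close>

lemma meas_translate:
  assumes S: "definable X S" and g: "g \<in> hgroup X"
  shows "meas X (hact X g ` S) = meas X S"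
proof -
  from S obtain V where V: "fin_on X V S" by (auto simp: definable_def)
  let ?C = "{g \<otimes> v \<otimes> inv g | v. v \<in> V}"
  note D = stable_onD[OF fin_onD(1)[OF V]]
  note U = open_subgroupD[OF hat_set_open[OF D(1)]]
  have gG: "g \<in> carrier G" using g U(3) by blast
  have VX: "v \<in> hgroup X" if "v \<in> V" for v using that D(3) by blast
  have SX: "x \<in> hpoints X" if "x \<in> S" for x using that D(4) by blast
  obtain e Y where Y: "copy_of X V S e Y" using copy_exists[OF V] .
  have fY: "finitary_hat_set G T Y" using Y by (simp add: copy_of_def)
  have inj: "hact X (inv g) (hact X g x) = x" if "x \<in> S" for x
    using hact_inv(1)[OF D(1) g SX[OF that]] .
  have "meas X (hact X g ` S) = \<mu> (hat_conj G g Y)"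
  proof (rule meas_eq[OF fin_on_translate[OF V g] finitary_hat_conj[OF fY gG]])
    show "?C \<subseteq> hgroup (hat_conj G g Y)" using Y by (auto simp: hat_conj_def copy_of_def)
    have "bij_betw (hact X (inv g)) (hact X g ` S) S"
      by (rule bij_betw_byWitness[where f' = "hact X g"]) (auto simp: inj)
    hence "bij_betw (e \<circ> hact X (inv g)) (hact X g ` S) (hpoints Y)"
      by (rule bij_betw_trans) (use Y in \<open>simp add: copy_of_def\<close>)
    thus "bij_betw (e \<circ> hact X (inv g)) (hact X g ` S) (hpoints (hat_conj G g Y))"
      by (simp add: hat_conj_def)
    fix c y assume "c \<in> ?C" "y \<in> hact X g ` S"
    then obtain v x where c: "v \<in> V" "c = g \<otimes> v \<otimes> inv g" and x: "x \<in> S" "y = hact X g x" by blast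
    have "hact X c y = hact X g (hact X v x)"
      unfolding c(2) x(2) using c(1) x(1) g VX SX U(5,6) hact_closed[OF D(1)]
      by (simp add: hact_mult[OF D(1)] hact_inv[OF D(1)])
    moreover have "inv g \<otimes> c \<otimes> g = v" unfolding c(2) using gG VX[OF c(1)] U(3) by (auto intro: conj_cancel)
    ultimately show "(e \<circ> hact X (inv g)) (hact X c y)
        = hact (hat_conj G g Y) c ((e \<circ> hact X (inv g)) y)"
      using Y c(1) x D(5) by (simp add: inj hat_conj_def copy_of_def)
  qed
  also have "\<dots> = \<mu> Y" using measure_conj fY gG by blast
  also have "\<dots> = meas X S" by (simp add: meas_copy[OF Y])
  finally show ?thesis .
qed

lemma meas_bij:
  assumes S: "fin_on X V S" and Y: "stable_on Y V R" and e: "bij_betw e S R"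
    and eq: "\<And>v x. v \<in> V \<Longrightarrow> x \<in> S \<Longrightarrow> e (hact X v x) = hact Y v (e x)"
  shows "meas X S = meas Y R"
proof -
  have R: "fin_on Y V R" using e by (intro fin_on_image[OF S Y _ eq]) (simp_all add: bij_betw_def)
  then obtain d Z where Z: "copy_of Y V R d Z" by (rule copy_exists)
  have eR: "e x \<in> R" if "x \<in> S" for x using e that by (auto simp: bij_betw_def)
  have "meas X S = \<mu> Z"
    using Z eR by (intro meas_eq[OF S _ _ bij_betw_trans[OF e]]) (auto simp: copy_of_def eq)
  thus ?thesis by (simp add: meas_copy[OF Z])
qed

lemma copy_transitive:
  assumes A: "stable_on A V P" and a: "a \<in> P" and c: "copy_of A V (orb A V a) c A'"
  shows "transitive_hat_set G T V A'"
proof -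
  have fA: "finitary_hat_set G T A'" and gA: "hgroup A' = V" using c by (simp_all add: copy_of_def)
  have ga: "group_action (G\<lparr>carrier := V\<rparr>) (hpoints A') (hact A')"
    using fA gA by (auto simp: finitary_hat_set_def is_hat_set_def)
  have pts: "hpoints A' = c ` orb A V a" using c by (simp add: copy_of_def bij_betw_def)
  have "\<exists>v \<in> V. hact A' v x = y" if xy: "x \<in> hpoints A'" "y \<in> hpoints A'" for x y
  proof -
    from xy obtain x' y' where x': "x' \<in> orb A V a" "x = c x'" and y': "y' \<in> orb A V a" "y = c y'"
      unfolding pts by blast
    have "y' \<in> orb A V x'" using y' orb_eq[OF A a x'(1)] by simp
    then obtain v where "v \<in> V" "y' = hact A v x'" by (auto simp: orb_def)
    thus ?thesis using x' y' c by (auto simp: copy_of_def)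
  qed
  moreover have "hpoints A' \<noteq> {}" unfolding pts using orb_refl[OF A a] by blast
  ultimately show ?thesis using fA gA ga
    by (auto simp: transitive_hat_set_def transitive_action_def transitive_action_axioms_def
        finitary_hat_set_def)
qed

text \<open>An orbit and its image are transitive for the same group \<open>V\<close>, which is what the product axiom of a
  measure requires.  The axiom speaks of copies, so the map and its fiber are carried over to them.\<close>

lemma meas_orb:
  assumes S: "stable_on Z V S" and R: "stable_on Y V R" and f: "f ` S \<subseteq> R"
    and eq: "\<And>v z. v \<in> V \<Longrightarrow> z \<in> S \<Longrightarrow> f (hact Z v z) = hact Y v (f z)" and z: "z \<in> S"
  shows "meas Z (orb Z V z) = meas Z {w \<in> orb Z V z. f w = f z} \<otimes>\<^bsub>k\<^esub> meas Y (orb Y V (f z))"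
proof -
  have fz: "f z \<in> R" using f z by blast
  note D = stable_onD[OF S]
  obtain e Z' where Z': "copy_of Z V (orb Z V z) e Z'" using copy_exists[OF fin_on_orb[OF S z]] .
  obtain d Y' where Y': "copy_of Y V (orb Y V (f z)) d Y'" using copy_exists[OF fin_on_orb[OF R fz]] .
  define r where "r = inv_into (orb Z V z) e"
  have r: "r (e x) = x" if "x \<in> orb Z V z" for x
    using Z' that by (simp add: r_def copy_of_def bij_betw_def)
  define f' where "f' = d \<circ> f \<circ> r"
  have OS: "x \<in> S" if "x \<in> orb Z V z" for x using orb_subset[OF S z] that by blast
  have fO: "f x \<in> orb Y V (f z)" if "x \<in> orb Z V z" for x
    using that eq z by (auto simp: orb_def)
  have pts: "hpoints Z' = e ` orb Z V z" using Z' by (simp add: copy_of_def bij_betw_def)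
  have dY: "d y \<in> hpoints Y'" if "y \<in> orb Y V (f z)" for y
    using Y' that by (auto simp: copy_of_def bij_betw_def)
  have O_st: "stable_on Z V (orb Z V z)" by (rule stable_on_orb[OF S z])
  have f'_in: "f' \<in> hpoints Z' \<rightarrow> hpoints Y'"
    unfolding pts f'_def by (auto simp: r intro!: dY fO)
  have f'_eq: "\<forall>v \<in> V. \<forall>x \<in> hpoints Z'. f' (hact Z' v x) = hact Y' v (f' x)"
  proof (intro ballI)
    fix v x assume v: "v \<in> V" and "x \<in> hpoints Z'"
    then obtain w where w: "w \<in> orb Z V z" "x = e w" unfolding pts by blast
    have vw: "hact Z v w \<in> orb Z V z" by (rule stable_onD(5)[OF O_st v w(1)])
    have "hact Z' v x = e (hact Z v w)" using Z' v w by (simp add: copy_of_def)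
    hence "f' (hact Z' v x) = d (hact Y v (f w))" using vw v OS[OF w(1)] by (simp add: f'_def r eq)
    also have "\<dots> = hact Y' v (d (f w))" using Y' v fO[OF w(1)] by (simp add: copy_of_def)
    finally show "f' (hact Z' v x) = hact Y' v (f' x)" using w by (simp add: f'_def r)
  qed
  have zO: "z \<in> orb Z V z" by (rule orb_refl[OF S z])
  have "d (f z) \<in> hpoints Y'" by (intro dY fO zO)
  hence "\<mu> Z' = \<mu> (hat_sub Z' {x \<in> hpoints Z'. f' x = d (f z)}) \<otimes>\<^bsub>k\<^esub> \<mu> Y'"
    using D(2) copy_transitive[OF S z Z'] copy_transitive[OF R fz Y'] f'_in f'_eq
    by (intro measure_fiber[of V]) blast
  moreover have "\<mu> (hat_sub Z' {x \<in> hpoints Z'. f' x = d (f z)}) = meas Z {w \<in> orb Z V z. f w = f z}"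
  proof -
    let ?W = "stab Y V (f z)"
    let ?F = "{w \<in> orb Z V z. f w = f z}" and ?F' = "{x \<in> hpoints Z'. f' x = d (f z)}"
    have F: "fin_on Z ?W ?F"
      using fO by (intro fin_on_fiber[OF fin_on_orb[OF S z] R]) (use f eq fz OS in auto)
    note FD = stable_onD[OF fin_onD(1)[OF F]]
    have inj: "f' (e w) = d (f z) \<longleftrightarrow> f w = f z" if "w \<in> orb Z V z" for w
      using Y' that fO[OF that] fO[OF zO] by (auto simp: f'_def r copy_of_def bij_betw_def dest: inj_onD)
    have F'_eq: "?F' = e ` ?F" unfolding pts using inj by auto
    have bij: "bij_betw e ?F ?F'"
      unfolding F'_eq using Z' by (auto simp: copy_of_def bij_betw_def intro: inj_on_subset)
    have WV: "?W \<subseteq> V" by (auto simp: stab_def)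
    have act: "e (hact Z v x) = hact Z' v (e x)" if "v \<in> ?W" "x \<in> ?F" for v x
      using that WV Z' by (auto simp: copy_of_def)
    have "hact Z' v x \<in> ?F'" if "v \<in> ?W" "x \<in> ?F'" for v x
    proof -
      from that(2) obtain w where w: "w \<in> ?F" "x = e w" unfolding F'_eq by blast
      have "hact Z' v x = e (hact Z v w)" using act[OF that(1) w(1)] w(2) by simp
      thus ?thesis unfolding F'_eq using FD(5)[OF that(1) w(1)] by (rule image_eqI)
    qed
    moreover have "is_hat_set G T Z'" "V = hgroup Z'" using Z' by (simp_all add: copy_of_def finitary_hat_set_def)
    ultimately have st: "stable_on Z' ?W ?F'" using FD(2) WV unfolding stable_on_def by blast
    have "fin_on Z' ?W ?F'" by (rule fin_on_image[OF F st _ act]) (simp add: F'_eq)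
    hence "finitary_hat_set G T (hat_sub Z' ?F')" by (intro finitary_hat_sub) (auto simp: definable_def)
    moreover have "?W \<subseteq> hgroup (hat_sub Z' ?F')"
      using stable_on_setwise_stabilizer(2)[OF st] by (simp add: hat_sub_def)
    ultimately have "meas Z ?F = \<mu> (hat_sub Z' ?F')"
      using bij act by (intro meas_eq[OF F]) (auto simp: hat_sub_def F'_eq)
    thus ?thesis by simp
  qed
  ultimately show ?thesis by (simp add: meas_copy[OF Z'] meas_copy[OF Y'])
qed


section \<open>Integrals of invariant functions\<close>

text \<open>In contrast to \<open>hat_integral\<close> the domain of integration is a set, and the value zero is kept in
  the sum, where it contributes nothing.\<close>

definition integ :: "('g, 'x) hat_set \<Rightarrow> 'x set \<Rightarrow> ('x \<Rightarrow> 'k) \<Rightarrow> 'k" where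
  "integ X S F = (\<Oplus>\<^bsub>k\<^esub>c \<in> F ` S. c \<otimes>\<^bsub>k\<^esub> meas X {x \<in> S. F x = c})"

definition inv_fun :: "('g, 'x) hat_set \<Rightarrow> 'g set \<Rightarrow> 'x set \<Rightarrow> ('x \<Rightarrow> 'k) \<Rightarrow> bool" where
  "inv_fun X V S F \<longleftrightarrow> F \<in> S \<rightarrow> carrier k \<and> (\<forall>v \<in> V. \<forall>x \<in> S. F (hact X v x) = F x)"

lemma inv_funD:
  assumes "inv_fun X V S F"
  shows "\<And>x. x \<in> S \<Longrightarrow> F x \<in> carrier k" "\<And>v x. v \<in> V \<Longrightarrow> x \<in> S \<Longrightarrow> F (hact X v x) = F x"
  using assms by (auto simp: inv_fun_def)

lemma inv_fun_subset: "inv_fun X V S F \<Longrightarrow> W \<subseteq> V \<Longrightarrow> R \<subseteq> S \<Longrightarrow> inv_fun X W R F"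
  unfolding inv_fun_def by blast

lemma integ_cong:
  assumes "\<And>x. x \<in> S \<Longrightarrow> F x = F' x" shows "integ X S F = integ X S F'"
proof -
  have "F ` S = F' ` S" using assms by (intro image_cong) auto
  moreover have "{x \<in> S. F x = c} = {x \<in> S. F' x = c}" for c using assms by auto
  ultimately show ?thesis by (simp add: integ_def)
qed

text \<open>This is how integrals are computed.  Parts may be empty and different parts may carry the same
  value, so the orbits of any convenient group, or their traces on a fiber, can serve as parts.\<close>

lemma integ_partition:
  assumes I: "finite I" and D: "\<And>i. i \<in> I \<Longrightarrow> definable X (D i)" and dis: "disjoint_family_on D I"
    and S: "S = (\<Union>i \<in> I. D i)" and c: "c \<in> I \<rightarrow> carrier k"
    and F: "\<And>i x. i \<in> I \<Longrightarrow> x \<in> D i \<Longrightarrow> F x = c i"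
  shows "integ X S F = (\<Oplus>\<^bsub>k\<^esub>i \<in> I. c i \<otimes>\<^bsub>k\<^esub> meas X (D i))"
proof -
  have X: "is_hat_set G T X" if "i \<in> I" for i using definable_hat_set[OF D[OF that]] .
  have level: "meas X {x \<in> S. F x = b} = (\<Oplus>\<^bsub>k\<^esub>i \<in> {i \<in> I. c i = b}. meas X (D i))" if "b \<in> c ` I" for b
  proof -
    have "{x \<in> S. F x = b} = (\<Union>i \<in> {i \<in> I. c i = b}. D i)" using S F by auto
    moreover have "disjoint_family_on D {i \<in> I. c i = b}" using dis by (auto simp: disjoint_family_on_def)
    ultimately show ?thesis using that I D X by (auto intro!: meas_UN)
  qed
  have mc: "(\<Oplus>\<^bsub>k\<^esub>i \<in> {i \<in> I. c i = b}. meas X (D i)) \<in> carrier k" for b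
    using D by (auto intro!: k.finsum_closed meas_closed)
  have "integ X S F = (\<Oplus>\<^bsub>k\<^esub>b \<in> c ` I. b \<otimes>\<^bsub>k\<^esub> meas X {x \<in> S. F x = b})"
    unfolding integ_def
  proof (rule k.add.finprod_mono_neutral_cong_left)
    show "finite (c ` I)" using I by simp
    show "F ` S \<subseteq> c ` I" using S F by auto
    show "(\<lambda>b. b \<otimes>\<^bsub>k\<^esub> meas X {x \<in> S. F x = b}) \<in> c ` I \<rightarrow> carrier k"
      using c mc level by (auto simp: Pi_def)
    fix b assume b: "b \<in> c ` I - F ` S"
    hence e: "{x \<in> S. F x = b} = {}" by blast
    from b obtain i where i: "i \<in> I" "b = c i" by blast
    show "b \<otimes>\<^bsub>k\<^esub> meas X {x \<in> S. F x = b} = \<zero>\<^bsub>k\<^esub>"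
      unfolding e meas_empty[OF X[OF i(1)]] using i funcset_mem[OF c i(1)] by simp
  qed simp
  also have "\<dots> = (\<Oplus>\<^bsub>k\<^esub>b \<in> c ` I. \<Oplus>\<^bsub>k\<^esub>i \<in> {i \<in> I. c i = b}. c i \<otimes>\<^bsub>k\<^esub> meas X (D i))"
  proof (rule k.finsum_cong')
    show "(\<lambda>b. \<Oplus>\<^bsub>k\<^esub>i \<in> {i \<in> I. c i = b}. c i \<otimes>\<^bsub>k\<^esub> meas X (D i)) \<in> c ` I \<rightarrow> carrier k"
      using c D by (auto simp: Pi_def intro!: k.finsum_closed meas_closed)
    fix b assume b: "b \<in> c ` I"
    have "b \<otimes>\<^bsub>k\<^esub> meas X {x \<in> S. F x = b} = (\<Oplus>\<^bsub>k\<^esub>i \<in> {i \<in> I. c i = b}. b \<otimes>\<^bsub>k\<^esub> meas X (D i))"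
      unfolding level[OF b] using I b c D
      by (intro k.finsum_rdistr) (auto simp: Pi_def intro!: meas_closed)
    also have "\<dots> = (\<Oplus>\<^bsub>k\<^esub>i \<in> {i \<in> I. c i = b}. c i \<otimes>\<^bsub>k\<^esub> meas X (D i))"
      using c D by (intro k.finsum_cong') (auto simp: Pi_def intro!: meas_closed)
    finally show "b \<otimes>\<^bsub>k\<^esub> meas X {x \<in> S. F x = b}
        = (\<Oplus>\<^bsub>k\<^esub>i \<in> {i \<in> I. c i = b}. c i \<otimes>\<^bsub>k\<^esub> meas X (D i))" .
  qed simp
  also have "\<dots> = (\<Oplus>\<^bsub>k\<^esub>i \<in> I. c i \<otimes>\<^bsub>k\<^esub> meas X (D i))"
    using I c D by (intro k.finsum_group) (auto simp: Pi_def intro!: meas_closed)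
  finally show ?thesis .
qed

text \<open>For an invariant \<open>F\<close> and an orbit \<open>C\<close> the value does not depend on the choice.\<close>

definition orb_val :: "('x \<Rightarrow> 'k) \<Rightarrow> 'x set \<Rightarrow> 'k" where
  "orb_val F C = F (SOME x. x \<in> C)"

lemma orb_val:
  assumes S: "stable_on X V S" and F: "inv_fun X V S F" and C: "C \<in> orb X V ` S" and x: "x \<in> C"
  shows "orb_val F C = F x" "orb_val F C \<in> carrier k"
proof -
  from C obtain y where y: "y \<in> S" "C = orb X V y" by blast
  have const: "F w = F y" if "w \<in> C" for w using that y inv_funD(2)[OF F] by (auto simp: orb_def)
  have "(SOME x. x \<in> C) \<in> C" using x by (rule someI)
  thus "orb_val F C = F x" using const x by (simp add: orb_val_def)
  thus "orb_val F C \<in> carrier k" using const[OF x] inv_funD(1)[OF F y(1)] by simp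
qed

lemma orb_val_closed:
  assumes S: "stable_on X V S" and F: "inv_fun X V S F"
  shows "orb_val F \<in> orb X V ` S \<rightarrow> carrier k"
  using orb_val(2)[OF S F] orb_refl[OF S] by blast

lemma orbs_disjoint_family: "stable_on X V S \<Longrightarrow> disjoint_family_on (\<lambda>C. C) (orb X V ` S)"
  using orbs_disjoint unfolding disjoint_family_on_def by blast

lemma orb_definable:
  assumes S: "stable_on X V S" and C: "C \<in> orb X V ` S"
  shows "definable X C"
proof -
  from C obtain x where x: "x \<in> S" "C = orb X V x" by blast
  show ?thesis unfolding definable_def x(2) using fin_on_orb[OF S x(1)] by blast
qed

lemma integ_orbits:
  assumes S: "fin_on X V S" and F: "inv_fun X V S F"
  shows "integ X S F = (\<Oplus>\<^bsub>k\<^esub>C \<in> orb X V ` S. orb_val F C \<otimes>\<^bsub>k\<^esub> meas X C)"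
proof (rule integ_partition)
  note st = fin_onD(1)[OF S]
  show "disjoint_family_on (\<lambda>C. C) (orb X V ` S)" by (rule orbs_disjoint_family[OF st])
  show "S = (\<Union>C \<in> orb X V ` S. C)" using Union_orbs[OF st] by simp
  show "definable X C" if "C \<in> orb X V ` S" for C by (rule orb_definable[OF st that])
  show "F x = orb_val F C" if "C \<in> orb X V ` S" "x \<in> C" for C x by (rule orb_val(1)[OF st F that, symmetric])
qed (use fin_onD[OF S] orb_val_closed[OF _ F] in auto)

lemma inv_fun_finite_range:
  assumes S: "fin_on X V S" and F: "inv_fun X V S F"
  shows "finite (F ` S)"
proof (rule finite_subset)
  note st = fin_onD(1)[OF S]
  show "F ` S \<subseteq> orb_val F ` orb X V ` S"
  proof
    fix c assume "c \<in> F ` S"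
    then obtain x where x: "x \<in> S" "c = F x" by blast
    have "c = orb_val F (orb X V x)"
      unfolding x(2) by (rule orb_val(1)[OF st F _ orb_refl[OF st x(1)], symmetric]) (use x in simp)
    thus "c \<in> orb_val F ` orb X V ` S" using x by blast
  qed
  show "finite (orb_val F ` orb X V ` S)" using fin_onD(2)[OF S] by simp
qed

lemma integ_closed:
  assumes S: "fin_on X V S" and F: "inv_fun X V S F"
  shows "integ X S F \<in> carrier k"
  unfolding integ_orbits[OF assms] using orb_val_closed[OF fin_onD(1)[OF S] F] orb_definable[OF fin_onD(1)[OF S]]
  by (intro k.finsum_closed) (auto simp: Pi_def intro!: k.m_closed meas_closed)

lemma integ_cmult:
  assumes S: "fin_on X V S" and F: "inv_fun X V S F" and a: "a \<in> carrier k"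
  shows "integ X S (\<lambda>x. a \<otimes>\<^bsub>k\<^esub> F x) = a \<otimes>\<^bsub>k\<^esub> integ X S F"
proof -
  note st = fin_onD(1)[OF S]
  have F': "inv_fun X V S (\<lambda>x. a \<otimes>\<^bsub>k\<^esub> F x)" using F a by (auto simp: inv_fun_def Pi_def)
  have m: "meas X C \<in> carrier k" if "C \<in> orb X V ` S" for C using meas_closed[OF orb_definable[OF st that]] .
  note o = orb_val_closed[OF st F, THEN funcset_mem]
  have "a \<otimes>\<^bsub>k\<^esub> integ X S F = (\<Oplus>\<^bsub>k\<^esub>C \<in> orb X V ` S. a \<otimes>\<^bsub>k\<^esub> (orb_val F C \<otimes>\<^bsub>k\<^esub> meas X C))"
    unfolding integ_orbits[OF S F] using fin_onD(2)[OF S] a m o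
    by (intro k.finsum_rdistr) (auto simp: Pi_def)
  also have "\<dots> = integ X S (\<lambda>x. a \<otimes>\<^bsub>k\<^esub> F x)"
    unfolding integ_orbits[OF S F'] using m o a
    by (intro k.finsum_cong') (auto simp: orb_val_def k.m_assoc)
  finally show ?thesis by simp
qed

lemma integ_Un:
  assumes S: "fin_on X V S" and R: "fin_on X V R" and dis: "S \<inter> R = {}" and F: "inv_fun X V (S \<union> R) F"
  shows "integ X (S \<union> R) F = integ X S F \<oplus>\<^bsub>k\<^esub> integ X R F"
proof -
  have F': "inv_fun X V S F" "inv_fun X V R F" using inv_fun_subset[OF F] by auto
  note st = fin_onD(1)[OF S] fin_onD(1)[OF R]
  have m: "orb_val F C \<otimes>\<^bsub>k\<^esub> meas X C \<in> carrier k" if "C \<in> orb X V ` S \<union> orb X V ` R" for C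
    using that meas_closed[OF orb_definable[OF st(1)]] meas_closed[OF orb_definable[OF st(2)]]
      orb_val_closed[OF st(1) F'(1)] orb_val_closed[OF st(2) F'(2)] by (auto simp: Pi_def)
  have "orb X V ` S \<inter> orb X V ` R = {}"
  proof (rule ccontr)
    assume "orb X V ` S \<inter> orb X V ` R \<noteq> {}"
    then obtain x y where "x \<in> S" "y \<in> R" "orb X V x = orb X V y" by auto
    hence "y \<in> S" using orb_refl[OF st(2)] orb_subset[OF st(1)] by blast
    thus False using \<open>y \<in> R\<close> dis by blast
  qed
  thus ?thesis
    unfolding integ_orbits[OF S F'(1)] integ_orbits[OF R F'(2)] integ_orbits[OF fin_on_Un[OF S R] F]
      image_Un using fin_onD(2)[OF S] fin_onD(2)[OF R] m
    by (intro k.finsum_Un_disjoint) auto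
qed

lemma integ_finite:
  assumes X: "is_hat_set G T X" and S: "finite S" "S \<subseteq> hpoints X" and F: "F \<in> S \<rightarrow> carrier k"
  shows "integ X S F = (\<Oplus>\<^bsub>k\<^esub>x \<in> S. F x)"
proof -
  have "definable X {x}" if "x \<in> S" for x
    using fin_on_singleton[OF X] that S(2) unfolding definable_def by blast
  hence "integ X S F = (\<Oplus>\<^bsub>k\<^esub>x \<in> S. F x \<otimes>\<^bsub>k\<^esub> meas X {x})"
    using S(1) F by (intro integ_partition) (auto simp: disjoint_family_on_def)
  also have "\<dots> = (\<Oplus>\<^bsub>k\<^esub>x \<in> S. F x)"
  proof (rule k.finsum_cong')
    fix x assume "x \<in> S"
    thus "F x \<otimes>\<^bsub>k\<^esub> meas X {x} = F x" using S(2) F by (simp add: meas_singleton[OF X] subset_iff Pi_def)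
  qed (use F in auto)
  finally show ?thesis .
qed

lemma integ_zero:
  assumes S: "definable X S"
  shows "integ X S (\<lambda>_. \<zero>\<^bsub>k\<^esub>) = \<zero>\<^bsub>k\<^esub>"
  using integ_partition[of "{()}" X "\<lambda>_. S" S "\<lambda>_. \<zero>\<^bsub>k\<^esub>" "\<lambda>_. \<zero>\<^bsub>k\<^esub>"] S meas_closed[OF S]
  by (simp add: disjoint_family_on_def)

lemma integ_translate:
  assumes S: "fin_on X V S" and g: "g \<in> hgroup X" and F: "inv_fun X V S (\<lambda>x. F (hact X g x))"
  shows "integ X (hact X g ` S) F = integ X S (\<lambda>x. F (hact X g x))"
proof -
  have "meas X {y \<in> hact X g ` S. F y = c} = meas X {x \<in> S. F (hact X g x) = c}" for c
  proof -
    have "{y \<in> hact X g ` S. F y = c} = hact X g ` {x \<in> S. F (hact X g x) = c}" by auto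
    moreover have "fin_on X V {x \<in> S. F (hact X g x) = c}"
      using stable_onD(5)[OF fin_onD(1)[OF S]] inv_funD(2)[OF F] by (intro fin_on_subset[OF S]) auto
    hence "definable X {x \<in> S. F (hact X g x) = c}" unfolding definable_def by blast
    from meas_translate[OF this g] calculation show ?thesis by simp
  qed
  thus ?thesis by (simp add: integ_def image_image)
qed


section \<open>Fubini\<close>

text \<open>Translation by \<open>v\<close> maps the fiber over \<open>y\<close> onto the fiber over \<open>v y\<close>.\<close>

lemma integ_fiber_invariant:
  assumes S: "fin_on Z V S" and R: "stable_on Y V R" and f: "f ` S \<subseteq> R"
    and eq: "\<And>v z. v \<in> V \<Longrightarrow> z \<in> S \<Longrightarrow> f (hact Z v z) = hact Y v (f z)" and F: "inv_fun Z V S F"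
  shows "inv_fun Y V R (\<lambda>y. integ Z {z \<in> S. f z = y} F)"
proof -
  note D = stable_onD[OF fin_onD(1)[OF S]] and E = stable_onD[OF R]
  note V = open_subgroupD[OF D(2)]
  have fib: "fin_on Z (stab Y V y) {z \<in> S. f z = y}" if "y \<in> R" for y
    by (rule fin_on_fiber[OF S R f eq that])
  have Ff: "inv_fun Z (stab Y V y) {z \<in> S. f z = y} F" for y
    by (rule inv_fun_subset[OF F]) (auto simp: stab_def)
  have "integ Z {z \<in> S. f z = hact Y v y} F = integ Z {z \<in> S. f z = y} F" if v: "v \<in> V" and y: "y \<in> R" for v y
  proof -
    have vZ: "v \<in> hgroup Z" and vY: "v \<in> hgroup Y" and yY: "y \<in> hpoints Y" using v y D(3) E(3,4) by auto
    have "{z \<in> S. f z = hact Y v y} = hact Z v ` {z \<in> S. f z = y}"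
    proof
      show "hact Z v ` {z \<in> S. f z = y} \<subseteq> {z \<in> S. f z = hact Y v y}" using v D(5) eq by auto
      show "{z \<in> S. f z = hact Y v y} \<subseteq> hact Z v ` {z \<in> S. f z = y}"
      proof
        fix z assume z: "z \<in> {z \<in> S. f z = hact Y v y}"
        let ?w = "hact Z (inv v) z"
        have "?w \<in> S" using z V(6)[OF v] D(5) by auto
        moreover have "f ?w = y" using z eq[OF V(6)[OF v], of z] hact_inv(1)[OF E(1) vY yY] by simp
        moreover have "z = hact Z v ?w" using hact_inv(2)[OF D(1) vZ] z D(4) by auto
        ultimately show "z \<in> hact Z v ` {z \<in> S. f z = y}" by blast
      qed
    qed
    moreover have Fv: "F (hact Z v z) = F z" if "z \<in> S" for z using inv_funD(2)[OF F v that] .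
    have "inv_fun Z (stab Y V y) {z \<in> S. f z = y} (\<lambda>z. F (hact Z v z))"
      using Ff[of y] fib[OF y] Fv stable_onD(5)[OF fin_onD(1)[OF fib[OF y]]] by (auto simp: inv_fun_def Pi_def)
    ultimately have "integ Z {z \<in> S. f z = hact Y v y} F
        = integ Z {z \<in> S. f z = y} (\<lambda>z. F (hact Z v z))"
      using integ_translate[OF fib[OF y] vZ] by simp
    also have "\<dots> = integ Z {z \<in> S. f z = y} F" using Fv by (intro integ_cong) auto
    finally show ?thesis .
  qed
  thus ?thesis using integ_closed[OF fib Ff] by (auto simp: inv_fun_def)
qed

text \<open>Both sides are sums over the orbits \<open>C\<close> of \<open>S\<close>.  On the right \<open>C\<close> contributes, for each orbit of \<open>R\<close>,
  the measure of a fiber of \<open>C\<close> over that orbit times the measure of the orbit; by \<open>meas_orb\<close> this is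
  the measure of \<open>C\<close> for the image of \<open>C\<close>, and zero for the other orbits.\<close>

theorem fubini:
  assumes S: "fin_on Z V S" and R: "fin_on Y V R" and f: "f ` S \<subseteq> R"
    and eq: "\<And>v z. v \<in> V \<Longrightarrow> z \<in> S \<Longrightarrow> f (hact Z v z) = hact Y v (f z)" and F: "inv_fun Z V S F"
  shows "integ Z S F = integ Y R (\<lambda>y. integ Z {z \<in> S. f z = y} F)"
proof -
  let ?g = "\<lambda>y. integ Z {z \<in> S. f z = y} F"
  let ?I = "orb Z V ` S" and ?J = "orb Y V ` R"
  note st = fin_onD(1)[OF S] and stR = fin_onD(1)[OF R]
  have g: "inv_fun Y V R ?g" by (rule integ_fiber_invariant[OF S stR f eq F])
  define rep where "rep C = (SOME y. y \<in> C)" for C :: "'b set"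
  have rep: "rep P \<in> P" "rep P \<in> R" if P: "P \<in> ?J" for P
  proof -
    obtain y where y: "y \<in> R" "P = orb Y V y" using P by blast
    show "rep P \<in> P" unfolding rep_def y(2) using orb_refl[OF stR y(1)] by (rule someI)
    thus "rep P \<in> R" using orb_subset[OF stR y(1)] y(2) by blast
  qed
  have vc: "orb_val F C \<in> carrier k" if "C \<in> ?I" for C
    using orb_val_closed[OF st F] that by (rule funcset_mem)
  have piece: "definable Z {w \<in> C. f w = y}" if C: "C \<in> ?I" and y: "y \<in> R" for C y
  proof -
    have "C \<subseteq> S" using C orb_subset[OF st] by blast
    moreover have "fin_on Z V C" using C fin_on_orb[OF st] by blast
    ultimately have "fin_on Z (stab Y V y) {w \<in> C. f w = y}"
      using f eq y by (intro fin_on_fiber[OF _ stR]) auto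
    thus ?thesis by (auto simp: definable_def)
  qed
  note pc = meas_closed[OF piece]
  have mc: "meas Z C \<in> carrier k" if "C \<in> ?I" for C using meas_closed[OF orb_definable[OF st that]] .
  have mP: "meas Y P \<in> carrier k" if "P \<in> ?J" for P using meas_closed[OF orb_definable[OF stR that]] .
  have inner: "?g y = (\<Oplus>\<^bsub>k\<^esub>C \<in> ?I. orb_val F C \<otimes>\<^bsub>k\<^esub> meas Z {w \<in> C. f w = y})" if y: "y \<in> R" for y
  proof (rule integ_partition)
    show "disjoint_family_on (\<lambda>C. {w \<in> C. f w = y}) ?I"
      using orbs_disjoint[OF st] unfolding disjoint_family_on_def by blast
    show "{z \<in> S. f z = y} = (\<Union>C \<in> ?I. {w \<in> C. f w = y})" using Union_orbs[OF st] by blast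
    show "F x = orb_val F C" if "C \<in> ?I" "x \<in> {w \<in> C. f w = y}" for C x
      using orb_val(1)[OF st F that(1), of x] that(2) by simp
  qed (use fin_onD(2)[OF S] vc piece y in auto)
  \<comment> \<open>Over the orbits of \<open>R\<close> other than the image of \<open>C\<close> the pieces of \<open>C\<close> are empty.\<close>
  have one: "(\<Oplus>\<^bsub>k\<^esub>P \<in> ?J. orb_val F C \<otimes>\<^bsub>k\<^esub> meas Z {w \<in> C. f w = rep P} \<otimes>\<^bsub>k\<^esub> meas Y P)
      = orb_val F C \<otimes>\<^bsub>k\<^esub> meas Z C" if C: "C \<in> ?I" for C
  proof -
    obtain z0 where z0: "z0 \<in> S" "C = orb Z V z0" using C by blast
    let ?P = "orb Y V (f z0)"
    have fz0: "f z0 \<in> R" and P: "?P \<in> ?J" using z0 f by auto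
    have fC: "f w \<in> ?P" if w: "w \<in> C" for w
    proof -
      from w obtain v where "v \<in> V" "w = hact Z v z0" unfolding z0(2) orb_def by blast
      thus ?thesis using eq[OF _ z0(1)] unfolding orb_def by blast
    qed
    obtain v where v: "v \<in> V" "rep ?P = hact Y v (f z0)" using rep(1)[OF P] by (auto simp: orb_def)
    define z where "z = hact Z v z0"
    have z: "z \<in> S" "f z = rep ?P" "z \<in> C"
      using stable_onD(5)[OF st v(1) z0(1)] eq[OF v(1) z0(1)] v
      by (simp_all add: z_def z0(2) orb_def)
    have Cz: "C = orb Z V z" using orb_eq[OF st z0(1)] z(3) z0(2) by simp
    have Pz: "?P = orb Y V (f z)" using orb_eq[OF stR fz0] rep(1)[OF P] z(2) by simp
    have "orb_val F C \<otimes>\<^bsub>k\<^esub> meas Z {w \<in> C. f w = rep P} \<otimes>\<^bsub>k\<^esub> meas Y P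
        = (if ?P = P then orb_val F C \<otimes>\<^bsub>k\<^esub> meas Z C else \<zero>\<^bsub>k\<^esub>)" if P': "P \<in> ?J" for P
    proof (cases "?P = P")
      case True
      have zP: "f z = rep P" using z(2) unfolding True .
      have PP: "orb Y V (rep P) = P" using Pz unfolding True zP by (rule sym)
      have "meas Z C = meas Z {w \<in> C. f w = f z} \<otimes>\<^bsub>k\<^esub> meas Y (orb Y V (f z))"
        unfolding Cz by (rule meas_orb[OF st stR f eq z(1)])
      hence "meas Z C = meas Z {w \<in> C. f w = rep P} \<otimes>\<^bsub>k\<^esub> meas Y P" unfolding zP PP .
      thus ?thesis using True vc[OF C] pc[OF C rep(2)[OF P']] mP[OF P'] by (simp add: k.m_assoc)
    next
      case False
      have e: "{w \<in> C. f w = rep P} = {}" using fC rep(1)[OF P'] orbs_disjoint[OF stR P P' False] by fastforce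
      show ?thesis unfolding e meas_empty[OF stable_onD(1)[OF st]]
        using False vc[OF C] mP[OF P'] by simp
    qed
    hence "(\<Oplus>\<^bsub>k\<^esub>P \<in> ?J. orb_val F C \<otimes>\<^bsub>k\<^esub> meas Z {w \<in> C. f w = rep P} \<otimes>\<^bsub>k\<^esub> meas Y P)
        = (\<Oplus>\<^bsub>k\<^esub>P \<in> ?J. if ?P = P then orb_val F C \<otimes>\<^bsub>k\<^esub> meas Z C else \<zero>\<^bsub>k\<^esub>)"
      using vc[OF C] mc[OF C] by (intro k.finsum_cong') auto
    also have "\<dots> = orb_val F C \<otimes>\<^bsub>k\<^esub> meas Z C"
      using k.finsum_singleton[OF P fin_onD(2)[OF R], of "\<lambda>_. orb_val F C \<otimes>\<^bsub>k\<^esub> meas Z C"] vc[OF C] mc[OF C]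
      by simp
    finally show ?thesis .
  qed
  have "integ Y R ?g = (\<Oplus>\<^bsub>k\<^esub>P \<in> ?J. ?g (rep P) \<otimes>\<^bsub>k\<^esub> meas Y P)"
    unfolding integ_orbits[OF R g] by (simp add: orb_val_def rep_def)
  also have "\<dots> = (\<Oplus>\<^bsub>k\<^esub>P \<in> ?J. \<Oplus>\<^bsub>k\<^esub>C \<in> ?I.
      orb_val F C \<otimes>\<^bsub>k\<^esub> meas Z {w \<in> C. f w = rep P} \<otimes>\<^bsub>k\<^esub> meas Y P)"
  proof (rule k.finsum_cong')
    fix P assume P: "P \<in> ?J"
    show "?g (rep P) \<otimes>\<^bsub>k\<^esub> meas Y P
      = (\<Oplus>\<^bsub>k\<^esub>C \<in> ?I. orb_val F C \<otimes>\<^bsub>k\<^esub> meas Z {w \<in> C. f w = rep P} \<otimes>\<^bsub>k\<^esub> meas Y P)"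
      unfolding inner[OF rep(2)[OF P]] using fin_onD(2)[OF S] mP[OF P] vc pc[OF _ rep(2)[OF P]]
      by (intro k.finsum_ldistr) auto
  qed (use vc pc[OF _ rep(2)] mP in \<open>auto intro!: k.finsum_closed\<close>)
  also have "\<dots> = (\<Oplus>\<^bsub>k\<^esub>C \<in> ?I. \<Oplus>\<^bsub>k\<^esub>P \<in> ?J.
      orb_val F C \<otimes>\<^bsub>k\<^esub> meas Z {w \<in> C. f w = rep P} \<otimes>\<^bsub>k\<^esub> meas Y P)"
    using fin_onD(2)[OF S] fin_onD(2)[OF R] vc pc[OF _ rep(2)] mP by (intro k.finsum_swap) auto
  also have "\<dots> = (\<Oplus>\<^bsub>k\<^esub>C \<in> ?I. orb_val F C \<otimes>\<^bsub>k\<^esub> meas Z C)"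
    using one vc mc by (intro k.finsum_cong') auto
  also have "\<dots> = integ Z S F" by (rule integ_orbits[OF S F, symmetric])
  finally show ?thesis by simp
qed

lemma integ_bij:
  assumes S: "fin_on X V S" and R: "stable_on Y V R" and e: "bij_betw e S R"
    and eq: "\<And>v x. v \<in> V \<Longrightarrow> x \<in> S \<Longrightarrow> e (hact X v x) = hact Y v (e x)"
    and F: "inv_fun Y V R F"
  shows "integ Y R F = integ X S (\<lambda>x. F (e x))"
proof -
  have eS: "e x \<in> R" if "x \<in> S" for x using e that by (auto simp: bij_betw_def)
  have meq: "meas Y {y \<in> R. F y = c} = meas X {x \<in> S. F (e x) = c}" for c
  proof (rule meas_bij[symmetric])
    show "fin_on X V {x \<in> S. F (e x) = c}"
      using stable_onD(5)[OF fin_onD(1)[OF S]] inv_funD(2)[OF F] eq eS by (intro fin_on_subset[OF S]) auto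
    show "stable_on Y V {y \<in> R. F y = c}"
      using R inv_funD(2)[OF F] by (auto simp: stable_on_def)
    show "bij_betw e {x \<in> S. F (e x) = c} {y \<in> R. F y = c}"
      using e by (auto simp: bij_betw_def inj_on_def)
  qed (use eq in auto)
  have "F ` R = (\<lambda>x. F (e x)) ` S" using e by (auto simp: bij_betw_def)
  thus ?thesis by (simp add: integ_def meq)
qed

section \<open>Localization at the fixed points\<close>

text \<open>Let \<open>R\<close> be the set of points moved by \<open>\<sigma>\<close>.  The fibers of the quotient of \<open>R\<close> by the powers of \<open>\<sigma>\<close>
  have \<open>p\<close> points with the same value of \<open>F\<close>, so the integral over each fiber is a multiple of \<open>p\<close>, and
  the integral over \<open>R\<close> vanishes by Fubini.\<close>

theorem integ_fixed_points:
  fixes p :: nat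
  assumes p: "prime p" and char: "[p] \<cdot>\<^bsub>k\<^esub> \<one>\<^bsub>k\<^esub> = \<zero>\<^bsub>k\<^esub>"
    and S: "fin_on Z V S" and F: "inv_fun Z V S F"
    and \<sigma>S: "\<And>z. z \<in> S \<Longrightarrow> \<sigma> z \<in> S"
    and \<sigma>V: "\<And>v z. v \<in> V \<Longrightarrow> z \<in> S \<Longrightarrow> \<sigma> (hact Z v z) = hact Z v (\<sigma> z)"
    and \<sigma>p: "\<And>z. z \<in> S \<Longrightarrow> (\<sigma> ^^ p) z = z"
    and \<sigma>F: "\<And>z. z \<in> S \<Longrightarrow> F (\<sigma> z) = F z"
  shows "integ Z S F = integ Z {z \<in> S. \<sigma> z = z} F"
proof -
  note st = fin_onD(1)[OF S]
  note D = stable_onD[OF st]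
  note V = open_subgroupD[OF D(2)]
  have VZ: "v \<in> hgroup Z" if "v \<in> V" for v using that D(3) by blast
  have SZ: "z \<in> hpoints Z" if "z \<in> S" for z using that D(4) by blast
  let ?E = "{z \<in> S. \<sigma> z = z}"
  define R where "R = {z \<in> S. \<sigma> z \<noteq> z}"
  have RS: "z \<in> S" if "z \<in> R" for z using that by (simp add: R_def)
  have cancel: "x = y" if "v \<in> V" "x \<in> S" "y \<in> S" "hact Z v x = hact Z v y" for v x y
    using that hact_inv(1)[OF D(1) VZ SZ] by metis
  have E: "fin_on Z V ?E" using D(5) \<sigma>V by (intro fin_on_subset[OF S]) auto
  have R: "fin_on Z V R"
  proof (rule fin_on_subset[OF S])
    fix v z assume v: "v \<in> V" and z: "z \<in> R"
    have "\<sigma> (hact Z v z) \<noteq> hact Z v z"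
    proof
      assume "\<sigma> (hact Z v z) = hact Z v z"
      hence "hact Z v (\<sigma> z) = hact Z v z" using \<sigma>V[OF v RS[OF z]] by simp
      from cancel[OF v \<sigma>S[OF RS[OF z]] RS[OF z] this] z show False by (simp add: R_def)
    qed
    thus "hact Z v z \<in> R" using D(5)[OF v RS[OF z]] by (simp add: R_def)
  qed (use RS in blast)
  have FR: "inv_fun Z V R F" by (rule inv_fun_subset[OF F]) (auto simp: R_def)
  have ER: "?E \<union> R = S" "?E \<inter> R = {}" by (auto simp: R_def)
  have pow_S: "(\<sigma> ^^ i) z \<in> S" if "z \<in> S" for i z using that by (induction i) (auto intro: \<sigma>S)
  have pow_V: "(\<sigma> ^^ i) (hact Z v z) = hact Z v ((\<sigma> ^^ i) z)" if "v \<in> V" "z \<in> S" for i v z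
    using that by (induction i) (simp_all add: \<sigma>V pow_S)
  have pow_F: "F ((\<sigma> ^^ i) z) = F z" if "z \<in> S" for i z
    using that by (induction i) (simp_all add: \<sigma>F pow_S)
  define q where "q z = (\<lambda>i. (\<sigma> ^^ i) z) ` {..<p}" for z
  have p0: "0 < p" using p by (simp add: prime_gt_0_nat)
  have zq: "z \<in> q z" for z unfolding q_def using p0 by (intro image_eqI[of _ _ 0]) auto
  have card: "card (q z) = p" and qq: "q ((\<sigma> ^^ i) z) = q z" if "z \<in> R" for z i
    using funpow_orbit[OF p \<sigma>p[OF RS[OF that]]] that by (simp_all add: q_def R_def)
  have qV: "hact Z v ` q z = q (hact Z v z)" if "v \<in> V" "z \<in> S" for v z
    unfolding q_def image_image using pow_V[OF that] by simp
  have R_V: "hact Z v z \<in> R" if "v \<in> V" "z \<in> R" for v z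
    using stable_onD(5)[OF fin_onD(1)[OF R]] that .
  define Q where "Q = \<lparr>hpoints = q ` R, hgroup = V, hact = \<lambda>g. \<lambda>C \<in> q ` R. hact Z g ` C\<rparr>"
  have Qact: "hact Q v (q z) = q (hact Z v z)" if "v \<in> V" "z \<in> R" for v z
    using that qV[OF that(1) RS[OF that(2)]] by (simp add: Q_def)
  have "is_hat_set G T Q"
  proof (rule is_hat_setI)
    fix C assume "C \<in> hpoints Q"
    then obtain z where z: "z \<in> R" "C = q z" by (auto simp: Q_def)
    have zZ: "z \<in> hpoints Z" by (intro SZ RS z)
    show "hact Q \<one> C = C" using Qact[OF V(4) z(1)] z hact_one[OF D(1) zZ] by simp
    have "hact Q w C = C" if "w \<in> stab Z V z" for w
      using that Qact[of w z] z by (simp add: stab_def)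
    moreover have "stab Z V z \<subseteq> hgroup Q" by (auto simp: stab_def Q_def)
    ultimately show "\<exists>W. open_subgroup G T W \<and> W \<subseteq> hgroup Q \<and> (\<forall>w \<in> W. hact Q w C = C)"
      using open_stab[OF D(1-3) zZ] by blast
    fix g assume "g \<in> hgroup Q"
    hence g: "g \<in> V" by (simp add: Q_def)
    show "hact Q g C \<in> hpoints Q" using Qact[OF g z(1)] R_V[OF g z(1)] z(2) by (simp add: Q_def)
    fix h assume "h \<in> hgroup Q"
    hence h: "h \<in> V" by (simp add: Q_def)
    have "hact Q (g \<otimes> h) C = q (hact Z (g \<otimes> h) z)" unfolding z(2) by (rule Qact[OF V(5)[OF g h] z(1)])
    also have "\<dots> = hact Q g (hact Q h C)"
      unfolding z(2) hact_mult[OF D(1) VZ[OF g] VZ[OF h] zZ] Qact[OF h z(1)]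
      by (rule Qact[OF g R_V[OF h z(1)], symmetric])
    finally show "hact Q (g \<otimes> h) C = hact Q g (hact Q h C)" .
  qed (use D(2) in \<open>simp_all add: Q_def\<close>)
  hence stQ: "stable_on Q V (q ` R)"
    using D(2) Qact R_V unfolding stable_on_def by (auto simp: Q_def)
  have qeq: "q (hact Z v z) = hact Q v (q z)" if "v \<in> V" "z \<in> R" for v z
    using Qact[OF that] by simp
  have finQ: "fin_on Q V (q ` R)" by (rule fin_on_image[OF R stQ order_refl qeq])
  have fiber0: "integ Z {w \<in> R. q w = C} F = \<zero>\<^bsub>k\<^esub>" if "C \<in> q ` R" for C
  proof -
    from that obtain z where z: "z \<in> R" "C = q z" by blast
    have Fz: "F z \<in> carrier k" using inv_funD(1)[OF FR z(1)] .
    have qR: "(\<sigma> ^^ i) z \<in> R" for i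
    proof -
      have "\<sigma> ((\<sigma> ^^ i) z) \<noteq> (\<sigma> ^^ i) z"
      proof
        assume fx: "\<sigma> ((\<sigma> ^^ i) z) = (\<sigma> ^^ i) z"
        hence "(\<sigma> ^^ j) ((\<sigma> ^^ i) z) = (\<sigma> ^^ i) z" for j by (induction j) simp_all
        hence "q ((\<sigma> ^^ i) z) = {(\<sigma> ^^ i) z}" unfolding q_def using p0 by auto
        hence "card (q z) = 1" using qq[OF z(1)] by simp
        thus False using card[OF z(1)] p by simp
      qed
      thus ?thesis using pow_S[OF RS[OF z(1)]] by (simp add: R_def)
    qed
    have "{w \<in> R. q w = q z} = q z"
    proof
      show "{w \<in> R. q w = q z} \<subseteq> q z" using zq by blast
      show "q z \<subseteq> {w \<in> R. q w = q z}"
      proof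
        fix w assume "w \<in> q z"
        then obtain i where "w = (\<sigma> ^^ i) z" unfolding q_def by blast
        thus "w \<in> {w \<in> R. q w = q z}" using qR qq[OF z(1)] by simp
      qed
    qed
    hence eq: "{w \<in> R. q w = C} = q z" using z(2) by simp
    have qz_R: "q z \<subseteq> R" using eq by blast
    have Fq: "F w = F z" if "w \<in> q z" for w using that pow_F[OF RS[OF z(1)]] by (auto simp: q_def)
    have "integ Z (q z) F = (\<Oplus>\<^bsub>k\<^esub>w \<in> q z. F w)"
      using qz_R RS SZ Fq Fz by (intro integ_finite[OF D(1)]) (auto simp: q_def)
    also have "\<dots> = (\<Oplus>\<^bsub>k\<^esub>w \<in> q z. F z)" using Fq Fz by (intro k.finsum_cong') auto
    also have "\<dots> = [p] \<cdot>\<^bsub>k\<^esub> F z" using k.add.finprod_const[OF Fz, of "q z"] card[OF z(1)] by simp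
    also have "\<dots> = ([p] \<cdot>\<^bsub>k\<^esub> \<one>\<^bsub>k\<^esub>) \<otimes>\<^bsub>k\<^esub> F z" using k.add_pow_ldistr[of "\<one>\<^bsub>k\<^esub>" "F z" p] Fz by simp
    also have "\<dots> = \<zero>\<^bsub>k\<^esub>" using Fz by (simp add: char)
    finally show ?thesis by (simp add: eq)
  qed
  have "integ Z R F = integ Q (q ` R) (\<lambda>C. integ Z {w \<in> R. q w = C} F)"
    by (rule fubini[OF R finQ order_refl qeq FR])
  also have "\<dots> = integ Q (q ` R) (\<lambda>_. \<zero>\<^bsub>k\<^esub>)" using fiber0 by (rule integ_cong)
  also have "\<dots> = \<zero>\<^bsub>k\<^esub>" using finQ unfolding definable_def by (intro integ_zero) (auto simp: definable_def)
  finally have "integ Z R F = \<zero>\<^bsub>k\<^esub>" .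
  moreover have "integ Z S F = integ Z ?E F \<oplus>\<^bsub>k\<^esub> integ Z R F"
    using integ_Un[OF E R ER(2)] F ER(1) by simp
  ultimately show ?thesis
    using integ_closed[OF E] inv_fun_subset[OF F order_refl, of ?E] by simp
qed

end


section \<open>Lists of points\<close>

text \<open>Powers of all exponents sit in one hat-set, so that the exponent is not part of a type.\<close>

definition hat_lists :: "('g, 'x) hat_set \<Rightarrow> ('g, 'x list) hat_set" where
  "hat_lists X = \<lparr>hpoints = lists (hpoints X), hgroup = hgroup X,
     hact = \<lambda>g. \<lambda>l \<in> lists (hpoints X). map (hact X g) l\<rparr>"

definition lists_of :: "('g, 'x) hat_set \<Rightarrow> nat \<Rightarrow> 'x list set" where
  "lists_of X n = {l \<in> lists (hpoints X). length l = n}"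

locale hat_matrices = hat_integration G T k \<mu>
  for G :: "('g, 'm) monoid_scheme" (structure) and T :: "'g topology"
    and k :: "('k, 'n) ring_scheme" and \<mu> :: "('g, 'k) hat_fun" +
  fixes X :: "('g, 'x) hat_set"
  assumes finitary: "finitary_hat_set G T X"
begin

abbreviation P where "P \<equiv> hpoints X"
abbreviation U where "U \<equiv> hgroup X"
abbreviation L where "L \<equiv> hat_lists X"

lemma X_fin_on: "open_subgroup G T V \<Longrightarrow> V \<subseteq> U \<Longrightarrow> fin_on X V P"
  using fin_on_subgroup finitary finitary_iff by blast

lemma X_hat_set: "is_hat_set G T X"
  using finitary by (simp add: finitary_hat_set_def)

lemmas act_closed = hact_closed[OF X_hat_set]
lemmas open_U = hat_set_open[OF X_hat_set]

lemma L_act: "l \<in> lists P \<Longrightarrow> hact L g l = map (hact X g) l"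
  by (simp add: hat_lists_def)

lemma stab_list:
  assumes "l \<in> lists P"
  shows "\<exists>W. open_subgroup G T W \<and> W \<subseteq> U \<and> (\<forall>w \<in> W. map (hact X w) l = l)"
  using assms
proof (induction l)
  case Nil
  thus ?case using open_U by auto
next
  case (Cons x l)
  then obtain W where W: "open_subgroup G T W" "W \<subseteq> U" "\<forall>w \<in> W. map (hact X w) l = l" by auto
  have "open_subgroup G T (stab X W x)" using open_stab[OF X_hat_set W(1,2)] Cons by simp
  thus ?case using W by (intro exI[of _ "stab X W x"]) (auto simp: stab_def)
qed

lemma L_hat_set: "is_hat_set G T L"
proof (rule is_hat_setI)
  show "open_subgroup G T (hgroup L)" using open_U by (simp add: hat_lists_def)
  fix l assume "l \<in> hpoints L"
  hence l: "l \<in> lists P" by (simp add: hat_lists_def)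
  show "hact L \<one> l = l" using l hact_one[OF X_hat_set] by (auto simp: L_act intro: map_idI)
  show "\<exists>W. open_subgroup G T W \<and> W \<subseteq> hgroup L \<and> (\<forall>w \<in> W. hact L w l = l)"
    using stab_list[OF l] L_act[OF l] by (simp add: hat_lists_def)
  fix g assume "g \<in> hgroup L"
  hence g: "g \<in> U" by (simp add: hat_lists_def)
  have cl: "map (hact X g) l \<in> lists P" if "g \<in> U" for g using l act_closed that by auto
  thus "hact L g l \<in> hpoints L" using g L_act[OF l] by (simp add: hat_lists_def)
  fix h assume "h \<in> hgroup L"
  hence h: "h \<in> U" by (simp add: hat_lists_def)
  have "hact L (g \<otimes> h) l = map (hact X g) (map (hact X h) l)"
    using l g h hact_mult[OF X_hat_set] by (auto simp: L_act)
  thus "hact L (g \<otimes> h) l = hact L g (hact L h l)" using l cl[OF h] by (simp add: L_act)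
qed (simp add: hat_lists_def)

lemma stable_lists_of:
  assumes V: "open_subgroup G T V" "V \<subseteq> U"
  shows "stable_on L V (lists_of X n)"
  unfolding stable_on_def
proof (intro conjI ballI)
  fix v l assume v: "v \<in> V" and l: "l \<in> lists_of X n"
  have "v \<in> U" using v V(2) by blast
  thus "hact L v l \<in> lists_of X n" using l act_closed by (auto simp: lists_of_def L_act)
qed (use V L_hat_set in \<open>auto simp: lists_of_def hat_lists_def\<close>)

lemma lists_of_Suc: "lists_of X (Suc n) = (\<Union>x \<in> P. (#) x ` lists_of X n)"
  by (fastforce simp: lists_of_def length_Suc_conv)

lemma hd_equivariant:
  assumes "v \<in> V" "l \<in> lists_of X (Suc n)"
  shows "hd (hact L v l) = hact X v (hd l)"
  using assms by (cases l) (auto simp: lists_of_def L_act)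

lemma hd_lists: "hd ` lists_of X (Suc n) \<subseteq> P"
  by (auto simp: lists_of_Suc)

lemma hd_fiber: "x \<in> P \<Longrightarrow> {l \<in> lists_of X (Suc n). hd l = x} = (#) x ` lists_of X n"
  by (auto simp: lists_of_Suc)

lemma fin_lists_of:
  assumes V: "open_subgroup G T V" "V \<subseteq> U"
  shows "fin_on L V (lists_of X n)"
  using V
proof (induction n arbitrary: V)
  case 0
  have "lists_of X 0 = {[]}" by (auto simp: lists_of_def)
  thus ?case using stable_lists_of[OF 0, of 0] by (simp add: fin_on_def)
next
  case (Suc n)
  show ?case
  proof (rule fin_on_total_space[OF stable_lists_of[OF Suc.prems] X_fin_on[OF Suc.prems] hd_lists hd_equivariant])
    fix x assume x: "x \<in> P"
    let ?W = "stab X V x"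
    have W: "open_subgroup G T ?W" "?W \<subseteq> U"
      using open_stab[OF X_hat_set Suc.prems x] Suc.prems(2) by (auto simp: stab_def)
    have eq: "x # hact L v l = hact L v (x # l)" if "v \<in> ?W" "l \<in> lists_of X n" for v l
      using that x by (simp add: L_act lists_of_def stab_def)
    have "stable_on L ?W {l \<in> lists_of X (Suc n). hd l = x}"
      by (rule fiber_stable[OF stable_lists_of[OF Suc.prems] fin_onD(1)[OF X_fin_on[OF Suc.prems]]
            hd_lists hd_equivariant x])
    thus "fin_on L ?W {l \<in> lists_of X (Suc n). hd l = x}"
      by (rule fin_on_image[OF Suc.IH[OF W] _ _ eq]) (simp add: hd_fiber[OF x])
  qed
qed

abbreviation J :: "nat \<Rightarrow> ('x list \<Rightarrow> 'k) \<Rightarrow> 'k" where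
  "J n F \<equiv> integ L (lists_of X n) F"

lemma J_0:
  assumes "F [] \<in> carrier k"
  shows "J 0 F = F []"
proof -
  have "lists_of X 0 = {[]}" by (auto simp: lists_of_def)
  moreover have "[] \<in> hpoints L" by (simp add: hat_lists_def)
  ultimately show ?thesis using assms integ_finite[OF L_hat_set, of "{[]}" F] by simp
qed

text \<open>Fubini for the first entry.  The fiber over \<open>x\<close> consists of the lists \<open>x # l\<close>, and prepending \<open>x\<close> is
  equivariant for the stabilizer of \<open>x\<close> only; this is why the group shrinks in the last claim.\<close>

lemma J_Suc:
  assumes V: "open_subgroup G T V" "V \<subseteq> U" and F: "inv_fun L V (lists_of X (Suc n)) F"
  shows "J (Suc n) F = integ X P (\<lambda>x. J n (\<lambda>l. F (x # l)))"
    and "inv_fun X V P (\<lambda>x. J n (\<lambda>l. F (x # l)))"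
    and "x \<in> P \<Longrightarrow> inv_fun L (stab X V x) (lists_of X n) (\<lambda>l. F (x # l))"
proof -
  note S = fin_lists_of[OF V, of "Suc n"] and R = X_fin_on[OF V]
  have invc: "inv_fun L (stab X V x) (lists_of X n) (\<lambda>l. F (x # l))" if x: "x \<in> P" for x
    unfolding inv_fun_def
  proof (intro conjI ballI funcsetI)
    fix l assume l: "l \<in> lists_of X n"
    have xl: "x # l \<in> lists_of X (Suc n)" using l x by (auto simp: lists_of_Suc)
    show "F (x # l) \<in> carrier k" by (rule inv_funD(1)[OF F xl])
    fix v assume v: "v \<in> stab X V x"
    have "x # hact L v l = hact L v (x # l)" using v l x by (simp add: L_act lists_of_def stab_def)
    thus "F (x # hact L v l) = F (x # l)" using inv_funD(2)[OF F _ xl, of v] v by (simp add: stab_def)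
  qed
  thus "x \<in> P \<Longrightarrow> inv_fun L (stab X V x) (lists_of X n) (\<lambda>l. F (x # l))" .
  have fib: "integ L {l \<in> lists_of X (Suc n). hd l = x} F = J n (\<lambda>l. F (x # l))" if x: "x \<in> P" for x
  proof (rule integ_bij)
    let ?W = "stab X V x"
    have W: "open_subgroup G T ?W" "?W \<subseteq> U"
      using open_stab[OF X_hat_set V x] V(2) by (auto simp: stab_def)
    show "fin_on L ?W (lists_of X n)" by (rule fin_lists_of[OF W])
    show "stable_on L ?W {l \<in> lists_of X (Suc n). hd l = x}"
      by (rule fiber_stable[OF stable_lists_of[OF V] fin_onD(1)[OF R] hd_lists hd_equivariant x])
    show "bij_betw ((#) x) (lists_of X n) {l \<in> lists_of X (Suc n). hd l = x}"
      unfolding hd_fiber[OF x] by (intro bij_betw_imageI) auto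
    show "x # hact L v l = hact L v (x # l)" if "v \<in> ?W" "l \<in> lists_of X n" for v l
      using that x by (simp add: L_act lists_of_def stab_def)
    show "inv_fun L ?W {l \<in> lists_of X (Suc n). hd l = x} F"
      by (rule inv_fun_subset[OF F]) (auto simp: stab_def)
  qed
  have "J (Suc n) F = integ X P (\<lambda>x. integ L {l \<in> lists_of X (Suc n). hd l = x} F)"
    by (rule fubini[OF S R hd_lists hd_equivariant F])
  also have "\<dots> = integ X P (\<lambda>x. J n (\<lambda>l. F (x # l)))" using fib by (rule integ_cong)
  finally show "J (Suc n) F = integ X P (\<lambda>x. J n (\<lambda>l. F (x # l)))" .
  have "inv_fun X V P (\<lambda>x. integ L {l \<in> lists_of X (Suc n). hd l = x} F)"
    by (rule integ_fiber_invariant[OF S fin_onD(1)[OF R] hd_lists hd_equivariant F])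
  thus "inv_fun X V P (\<lambda>x. J n (\<lambda>l. F (x # l)))"
    using fib act_closed V(2) unfolding inv_fun_def by (auto simp: Pi_def subset_iff)
qed

text \<open>Both iterated integrals are integrals over the lists of length two, which reversal exchanges.\<close>

lemma integ_swap:
  assumes V: "open_subgroup G T V" "V \<subseteq> U"
    and cl: "\<And>x y. x \<in> P \<Longrightarrow> y \<in> P \<Longrightarrow> H x y \<in> carrier k"
    and H: "\<And>v x y. v \<in> V \<Longrightarrow> x \<in> P \<Longrightarrow> y \<in> P \<Longrightarrow> H (hact X v x) (hact X v y) = H x y"
  shows "integ X P (\<lambda>x. integ X P (\<lambda>y. H x y)) = integ X P (\<lambda>y. integ X P (\<lambda>x. H x y))"
proof -
  have J2: "J 2 (\<lambda>l. h (l ! 0) (l ! 1)) = integ X P (\<lambda>x. integ X P (\<lambda>y. h x y))"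
    if hcl: "\<And>x y. x \<in> P \<Longrightarrow> y \<in> P \<Longrightarrow> h x y \<in> carrier k"
      and h: "\<And>v x y. v \<in> V \<Longrightarrow> x \<in> P \<Longrightarrow> y \<in> P \<Longrightarrow> h (hact X v x) (hact X v y) = h x y" for h
  proof -
    let ?F = "\<lambda>l. h (l ! 0) (l ! 1)"
    have F: "inv_fun L V (lists_of X (Suc 1)) ?F"
      using hcl h by (auto simp: inv_fun_def lists_of_def L_act length_Suc_conv)
    have "J (Suc 1) ?F = integ X P (\<lambda>x. J 1 (\<lambda>l. ?F (x # l)))" by (rule J_Suc(1)[OF V F])
    also have "\<dots> = integ X P (\<lambda>x. integ X P (\<lambda>y. h x y))"
    proof (rule integ_cong)
      fix x assume x: "x \<in> P"
      have W: "open_subgroup G T (stab X V x)" "stab X V x \<subseteq> U"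
        using open_stab[OF X_hat_set V x] V(2) by (auto simp: stab_def)
      have "J (Suc 0) (\<lambda>l. ?F (x # l)) = integ X P (\<lambda>y. J 0 (\<lambda>l. ?F (x # y # l)))"
        using J_Suc(1)[OF W, of 0] J_Suc(3)[OF V F x] by simp
      also have "\<dots> = integ X P (\<lambda>y. h x y)"
        using x hcl by (intro integ_cong) (simp add: J_0)
      finally show "J 1 (\<lambda>l. ?F (x # l)) = integ X P (\<lambda>y. h x y)" by simp
    qed
    finally show ?thesis by (simp add: numeral_2_eq_2)
  qed
  have "J 2 (\<lambda>l. H (l ! 0) (l ! 1)) = J 2 (\<lambda>l. H (rev l ! 0) (rev l ! 1))"
  proof (rule integ_bij[OF fin_lists_of[OF V] stable_lists_of[OF V]])
    show "bij_betw rev (lists_of X 2) (lists_of X 2)"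
      by (rule bij_betw_byWitness[where f' = rev]) (auto simp: lists_of_def)
    show "rev (hact L v l) = hact L v (rev l)" if "v \<in> V" "l \<in> lists_of X 2" for v l
    proof -
      have "l \<in> lists P" "rev l \<in> lists P" using that by (auto simp: lists_of_def)
      thus ?thesis by (simp add: L_act rev_map)
    qed
    show "inv_fun L V (lists_of X 2) (\<lambda>l. H (l ! 0) (l ! 1))"
      using cl H by (auto simp: inv_fun_def lists_of_def L_act length_Suc_conv numeral_2_eq_2)
  qed
  also have "\<dots> = J 2 (\<lambda>l. H (l ! 1) (l ! 0))"
    by (intro integ_cong) (auto simp: lists_of_def length_Suc_conv numeral_2_eq_2)
  finally show ?thesis using J2[of H] J2[of "\<lambda>x y. H y x"] cl H by simp
qed


section \<open>The algebra of kernels\<close>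

text \<open>Invariant functions on \<open>X \<times> X\<close> include all Schwartz functions, and they are easily seen to be closed
  under multiplication.\<close>

definition inv_kernel :: "'g set \<Rightarrow> ('x \<times> 'x \<Rightarrow> 'k) \<Rightarrow> bool" where
  "inv_kernel V A \<longleftrightarrow> open_subgroup G T V \<and> V \<subseteq> U \<and> A \<in> P \<times> P \<rightarrow>\<^sub>E carrier k \<and>
     (\<forall>v \<in> V. \<forall>x \<in> P. \<forall>y \<in> P. A (hact X v x, hact X v y) = A (x, y))"

lemma inv_kernelD:
  assumes "inv_kernel V A"
  shows "open_subgroup G T V" "V \<subseteq> U" "\<And>x y. x \<in> P \<Longrightarrow> y \<in> P \<Longrightarrow> A (x, y) \<in> carrier k"
    "\<And>v x y. v \<in> V \<Longrightarrow> x \<in> P \<Longrightarrow> y \<in> P \<Longrightarrow> A (hact X v x, hact X v y) = A (x, y)"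
    "A \<in> extensional (P \<times> P)"
  using assms by (auto simp: inv_kernel_def PiE_def)

lemma inv_kernel_mono: "inv_kernel V A \<Longrightarrow> open_subgroup G T W \<Longrightarrow> W \<subseteq> V \<Longrightarrow> inv_kernel W A"
  unfolding inv_kernel_def by blast

definition kernels :: "('x \<times> 'x \<Rightarrow> 'k) set" where
  "kernels = {A. \<exists>V. inv_kernel V A}"

lemma common_kernel_group:
  assumes "A \<in> kernels" "B \<in> kernels"
  obtains V where "inv_kernel V A" "inv_kernel V B"
proof -
  from assms obtain V W where "inv_kernel V A" "inv_kernel W B" by (auto simp: kernels_def)
  hence "inv_kernel (V \<inter> W) A" "inv_kernel (V \<inter> W) B"
    using open_subgroup_Int inv_kernelD(1) by (auto intro: inv_kernel_mono)
  thus ?thesis by (rule that)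
qed

definition kmult :: "('x \<times> 'x \<Rightarrow> 'k) \<Rightarrow> ('x \<times> 'x \<Rightarrow> 'k) \<Rightarrow> 'x \<times> 'x \<Rightarrow> 'k" where
  "kmult A B = (\<lambda>(x, z) \<in> P \<times> P. integ X P (\<lambda>y. A (x, y) \<otimes>\<^bsub>k\<^esub> B (y, z)))"

definition ktrace :: "('x \<times> 'x \<Rightarrow> 'k) \<Rightarrow> 'k" where
  "ktrace A = integ X P (\<lambda>x. A (x, x))"

lemma two_point_stab:
  assumes V: "open_subgroup G T V" "V \<subseteq> U" and xz: "x \<in> P" "z \<in> P"
  shows "open_subgroup G T (stab X (stab X V x) z)" "stab X (stab X V x) z \<subseteq> U"
proof -
  have "open_subgroup G T (stab X V x)" "stab X V x \<subseteq> U"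
    using open_stab[OF X_hat_set V xz(1)] V(2) by (auto simp: stab_def)
  from open_stab[OF X_hat_set this xz(2)] this(2)
  show "open_subgroup G T (stab X (stab X V x) z)" "stab X (stab X V x) z \<subseteq> U"
    by (auto simp: stab_def)
qed

lemma kmult_integrand:
  assumes A: "inv_kernel V A" and B: "inv_kernel V B" and xz: "x \<in> P" "z \<in> P"
  shows "inv_fun X (stab X (stab X V x) z) P (\<lambda>y. A (x, y) \<otimes>\<^bsub>k\<^esub> B (y, z))"
  unfolding inv_fun_def
proof (intro conjI ballI funcsetI)
  fix y assume y: "y \<in> P"
  show "A (x, y) \<otimes>\<^bsub>k\<^esub> B (y, z) \<in> carrier k" using inv_kernelD(3)[OF A] inv_kernelD(3)[OF B] xz y by simp
  fix v assume v: "v \<in> stab X (stab X V x) z"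
  show "A (x, hact X v y) \<otimes>\<^bsub>k\<^esub> B (hact X v y, z) = A (x, y) \<otimes>\<^bsub>k\<^esub> B (y, z)"
    using v inv_kernelD(4)[OF A, of v x y] inv_kernelD(4)[OF B, of v y z] xz y by (simp add: stab_def)
qed

lemma kmult_apply:
  "x \<in> P \<Longrightarrow> z \<in> P \<Longrightarrow> kmult A B (x, z) = integ X P (\<lambda>y. A (x, y) \<otimes>\<^bsub>k\<^esub> B (y, z))"
  by (simp add: kmult_def)

lemma inv_kernel_kmult:
  assumes A: "inv_kernel V A" and B: "inv_kernel V B"
  shows "inv_kernel V (kmult A B)"
  unfolding inv_kernel_def
proof (intro conjI ballI)
  note V = inv_kernelD(1,2)[OF A]
  show "open_subgroup G T V" "V \<subseteq> U" by (rule V)+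
  show "kmult A B \<in> P \<times> P \<rightarrow>\<^sub>E carrier k"
    using integ_closed[OF X_fin_on[OF two_point_stab[OF V]] kmult_integrand[OF A B]]
    by (auto simp: kmult_def)
  fix v x z assume v: "v \<in> V" and xz: "x \<in> P" "z \<in> P"
  have vU: "v \<in> U" using v V(2) by blast
  let ?F = "\<lambda>y. A (hact X v x, y) \<otimes>\<^bsub>k\<^esub> B (y, hact X v z)"
  have Fv: "?F (hact X v y) = A (x, y) \<otimes>\<^bsub>k\<^esub> B (y, z)" if "y \<in> P" for y
    using inv_kernelD(4)[OF A v xz(1) that] inv_kernelD(4)[OF B v that xz(2)] by simp
  have "inv_fun X (stab X (stab X V x) z) P (\<lambda>y. ?F (hact X v y))"
    using kmult_integrand[OF A B xz] Fv two_point_stab(2)[OF V xz] act_closed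
    by (auto simp: inv_fun_def Pi_def subset_iff)
  from integ_translate[OF X_fin_on[OF two_point_stab[OF V xz]] vU this]
  have "integ X (hact X v ` P) ?F = integ X P (\<lambda>y. ?F (hact X v y))" .
  also have "\<dots> = integ X P (\<lambda>y. A (x, y) \<otimes>\<^bsub>k\<^esub> B (y, z))" using Fv by (rule integ_cong)
  also have "hact X v ` P = P"
  proof
    show "hact X v ` P \<subseteq> P" using act_closed[OF vU] by blast
    show "P \<subseteq> hact X v ` P"
      using hact_inv(2)[OF X_hat_set vU] act_closed open_subgroupD(6)[OF open_U vU] by (metis imageI subsetI)
  qed
  finally show "kmult A B (hact X v x, hact X v z) = kmult A B (x, z)"
    using xz act_closed[OF vU] by (simp add: kmult_apply)
qed

lemma kmult_closed: "A \<in> kernels \<Longrightarrow> B \<in> kernels \<Longrightarrow> kmult A B \<in> kernels"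
  by (metis (mono_tags) common_kernel_group inv_kernel_kmult kernels_def mem_Collect_eq)

lemma kernel_eqI:
  assumes "A \<in> kernels" "B \<in> kernels" "\<And>x y. x \<in> P \<Longrightarrow> y \<in> P \<Longrightarrow> A (x, y) = B (x, y)"
  shows "A = B"
  using assms inv_kernelD(5) by (intro extensionalityI[of A "P \<times> P" B]) (auto simp: kernels_def)

text \<open>Both sides are double integrals of \<open>A (x, y) B (y, z) C (z, w)\<close> over \<open>y\<close> and \<open>z\<close>, in the two orders.\<close>

lemma kmult_assoc:
  assumes "A \<in> kernels" "B \<in> kernels" "C \<in> kernels"
  shows "kmult (kmult A B) C = kmult A (kmult B C)"
proof (rule kernel_eqI)
  show "kmult (kmult A B) C \<in> kernels" "kmult A (kmult B C) \<in> kernels"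
    using assms by (simp_all add: kmult_closed)
  fix x w assume xw: "x \<in> P" "w \<in> P"
  obtain V where A: "inv_kernel V A" and B: "inv_kernel V B"
    using common_kernel_group[OF assms(1,2)] .
  obtain V' where AB: "inv_kernel V' (kmult A B)" and C: "inv_kernel V' C"
    using common_kernel_group[OF kmult_closed[OF assms(1,2)] assms(3)] .
  define W where "W = V \<inter> V'"
  have W: "open_subgroup G T W" unfolding W_def by (intro open_subgroup_Int inv_kernelD(1)[OF A] inv_kernelD(1)[OF C])
  have A: "inv_kernel W A" and B: "inv_kernel W B" and C: "inv_kernel W C"
    using A B C W by (auto simp: W_def intro: inv_kernel_mono)
  note W = inv_kernelD(1,2)[OF A]
  note cl = inv_kernelD(3)[OF A] inv_kernelD(3)[OF B] inv_kernelD(3)[OF C]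
  let ?H = "\<lambda>y z. A (x, y) \<otimes>\<^bsub>k\<^esub> B (y, z) \<otimes>\<^bsub>k\<^esub> C (z, w)"
  have "kmult (kmult A B) C (x, w) = integ X P (\<lambda>z. kmult A B (x, z) \<otimes>\<^bsub>k\<^esub> C (z, w))"
    by (rule kmult_apply[OF xw])
  also have "\<dots> = integ X P (\<lambda>z. integ X P (\<lambda>y. ?H y z))"
  proof (rule integ_cong)
    fix z assume z: "z \<in> P"
    have "kmult A B (x, z) \<otimes>\<^bsub>k\<^esub> C (z, w) = C (z, w) \<otimes>\<^bsub>k\<^esub> integ X P (\<lambda>y. A (x, y) \<otimes>\<^bsub>k\<^esub> B (y, z))"
      using inv_kernelD(3)[OF inv_kernel_kmult[OF A B] xw(1) z] cl(3)[OF z xw(2)]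
      by (simp add: k.m_comm kmult_apply[OF xw(1) z])
    also have "\<dots> = integ X P (\<lambda>y. C (z, w) \<otimes>\<^bsub>k\<^esub> (A (x, y) \<otimes>\<^bsub>k\<^esub> B (y, z)))"
      by (rule integ_cmult[symmetric, OF X_fin_on[OF two_point_stab[OF W xw(1) z]]
            kmult_integrand[OF A B xw(1) z] cl(3)[OF z xw(2)]])
    also have "\<dots> = integ X P (\<lambda>y. ?H y z)"
      using cl xw z by (intro integ_cong) (simp add: k.m_comm)
    finally show "kmult A B (x, z) \<otimes>\<^bsub>k\<^esub> C (z, w) = integ X P (\<lambda>y. ?H y z)" .
  qed
  also have "\<dots> = integ X P (\<lambda>y. integ X P (\<lambda>z. ?H y z))"
  proof (rule integ_swap[symmetric, OF two_point_stab[OF W xw]])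
    show "?H y z \<in> carrier k" if "y \<in> P" "z \<in> P" for y z using cl xw that by simp
    show "?H (hact X v y) (hact X v z) = ?H y z"
      if "v \<in> stab X (stab X W x) w" "y \<in> P" "z \<in> P" for v y z
      using that xw inv_kernelD(4)[OF A, of v x y] inv_kernelD(4)[OF B, of v y z]
        inv_kernelD(4)[OF C, of v z w] by (simp add: stab_def)
  qed
  also have "\<dots> = integ X P (\<lambda>y. A (x, y) \<otimes>\<^bsub>k\<^esub> kmult B C (y, w))"
  proof (rule integ_cong)
    fix y assume y: "y \<in> P"
    have "A (x, y) \<otimes>\<^bsub>k\<^esub> kmult B C (y, w) = integ X P (\<lambda>z. A (x, y) \<otimes>\<^bsub>k\<^esub> (B (y, z) \<otimes>\<^bsub>k\<^esub> C (z, w)))"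
      unfolding kmult_apply[OF y xw(2)]
      by (rule integ_cmult[symmetric, OF X_fin_on[OF two_point_stab[OF W y xw(2)]]
            kmult_integrand[OF B C y xw(2)] cl(1)[OF xw(1) y]])
    also have "\<dots> = integ X P (\<lambda>z. ?H y z)"
      using cl xw y by (intro integ_cong) (simp add: k.m_assoc)
    finally show "integ X P (\<lambda>z. ?H y z) = A (x, y) \<otimes>\<^bsub>k\<^esub> kmult B C (y, w)" by simp
  qed
  also have "\<dots> = kmult A (kmult B C) (x, w)" by (rule kmult_apply[OF xw, symmetric])
  finally show "kmult (kmult A B) C (x, w) = kmult A (kmult B C) (x, w)" .
qed

definition kone :: "'x \<times> 'x \<Rightarrow> 'k" where
  "kone = (\<lambda>(x, z) \<in> P \<times> P. if x = z then \<one>\<^bsub>k\<^esub> else \<zero>\<^bsub>k\<^esub>)"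

definition kzero :: "'x \<times> 'x \<Rightarrow> 'k" where
  "kzero = (\<lambda>_ \<in> P \<times> P. \<zero>\<^bsub>k\<^esub>)"

lemma kone_closed: "kone \<in> kernels"
proof -
  have "x = y" if "v \<in> U" "x \<in> P" "y \<in> P" "hact X v x = hact X v y" for v x y
    using that hact_inv(1)[OF X_hat_set] by metis
  hence "inv_kernel U kone"
    using open_U act_closed by (auto simp: inv_kernel_def kone_def)
  thus ?thesis by (auto simp: kernels_def)
qed

lemma kzero_closed: "kzero \<in> kernels"
proof -
  have "inv_kernel U kzero" using open_U act_closed by (auto simp: inv_kernel_def kzero_def)
  thus ?thesis by (auto simp: kernels_def)
qed

lemma integ_delta:
  assumes x: "x \<in> P" and a: "a \<in> carrier k"
  shows "integ X P (\<lambda>y. if y = x then a else \<zero>\<^bsub>k\<^esub>) = a"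
proof -
  let ?W = "stab X U x"
  have W: "open_subgroup G T ?W" "?W \<subseteq> U"
    using open_stab[OF X_hat_set open_U order_refl x] by (auto simp: stab_def)
  have "hact X v y \<noteq> x" if v: "v \<in> ?W" and y: "y \<in> P" "y \<noteq> x" for v y
  proof
    assume "hact X v y = x"
    hence "hact X v y = hact X v x" using v by (simp add: stab_def)
    thus False using hact_inv(1)[OF X_hat_set _ y(1), of v] hact_inv(1)[OF X_hat_set _ x, of v] v y
      by (simp add: stab_def)
  qed
  hence "fin_on X ?W (P - {x})"
    using act_closed W(2) by (intro fin_on_subset[OF X_fin_on[OF W]]) auto
  hence D: "definable X (P - {x})" "definable X {x}"
    using fin_on_singleton[OF X_hat_set x] by (auto simp: definable_def)
  have "integ X P (\<lambda>y. if y = x then a else \<zero>\<^bsub>k\<^esub>) =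
      (\<Oplus>\<^bsub>k\<^esub>b \<in> {True, False}. (if b then a else \<zero>\<^bsub>k\<^esub>) \<otimes>\<^bsub>k\<^esub> meas X (if b then {x} else P - {x}))"
    using x a D by (intro integ_partition) (auto simp: disjoint_family_on_def)
  also have "\<dots> = a" using a meas_closed[OF D(1)] by (simp add: meas_singleton[OF X_hat_set x])
  finally show ?thesis .
qed

definition kernel_monoid :: "('x \<times> 'x \<Rightarrow> 'k) monoid" where
  "kernel_monoid = \<lparr>carrier = kernels, monoid.mult = kmult, one = kone\<rparr>"

lemma kernels_in_carrier: "A \<in> kernels \<Longrightarrow> x \<in> P \<Longrightarrow> y \<in> P \<Longrightarrow> A (x, y) \<in> carrier k"
  by (auto simp: kernels_def dest: inv_kernelD(3))

sublocale K: monoid kernel_monoid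
proof (rule monoidI, simp_all add: kernel_monoid_def kmult_closed kone_closed kmult_assoc)
  fix A assume A: "A \<in> kernels"
  show "kmult kone A = A"
  proof (rule kernel_eqI[OF kmult_closed[OF kone_closed A] A])
    fix x z assume xz: "x \<in> P" "z \<in> P"
    have "kmult kone A (x, z) = integ X P (\<lambda>y. if y = x then A (x, z) else \<zero>\<^bsub>k\<^esub>)"
      unfolding kmult_apply[OF xz] using xz kernels_in_carrier[OF A]
      by (intro integ_cong) (auto simp: kone_def)
    thus "kmult kone A (x, z) = A (x, z)" using integ_delta kernels_in_carrier[OF A] xz by simp
  qed
  show "kmult A kone = A"
  proof (rule kernel_eqI[OF kmult_closed[OF A kone_closed] A])
    fix x z assume xz: "x \<in> P" "z \<in> P"
    have "kmult A kone (x, z) = integ X P (\<lambda>y. if y = z then A (x, z) else \<zero>\<^bsub>k\<^esub>)"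
      unfolding kmult_apply[OF xz] using xz kernels_in_carrier[OF A]
      by (intro integ_cong) (auto simp: kone_def)
    thus "kmult A kone (x, z) = A (x, z)" using integ_delta kernels_in_carrier[OF A] xz by simp
  qed
qed


section \<open>Traces as cyclic integrals\<close>

text \<open>The three functions are products of entries: along the walk from \<open>x\<close> through \<open>l\<close> to \<open>z\<close>, along the
  closed walk through \<open>l\<close>, and over the loops at the points of \<open>l\<close>.\<close>

fun path :: "('x \<times> 'x \<Rightarrow> 'k) \<Rightarrow> 'x \<Rightarrow> 'x list \<Rightarrow> 'x \<Rightarrow> 'k" where
  "path A x [] z = A (x, z)"
| "path A x (y # l) z = A (x, y) \<otimes>\<^bsub>k\<^esub> path A y l z"

fun cycle :: "('x \<times> 'x \<Rightarrow> 'k) \<Rightarrow> 'x list \<Rightarrow> 'k" where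
  "cycle A [] = \<one>\<^bsub>k\<^esub>"
| "cycle A (x # l) = path A x l x"

fun diag :: "('x \<times> 'x \<Rightarrow> 'k) \<Rightarrow> 'x list \<Rightarrow> 'k" where
  "diag A [] = \<one>\<^bsub>k\<^esub>"
| "diag A (x # l) = A (x, x) \<otimes>\<^bsub>k\<^esub> diag A l"

lemma path_closed:
  assumes "A \<in> kernels"
  shows "x \<in> P \<Longrightarrow> z \<in> P \<Longrightarrow> l \<in> lists P \<Longrightarrow> path A x l z \<in> carrier k"
  by (induction l arbitrary: x) (auto simp: kernels_in_carrier[OF assms])

lemma path_invariant:
  assumes A: "inv_kernel V A" and v: "v \<in> V"
  shows "x \<in> P \<Longrightarrow> z \<in> P \<Longrightarrow> l \<in> lists P \<Longrightarrow>
    path A (hact X v x) (map (hact X v) l) (hact X v z) = path A x l z"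
  by (induction l arbitrary: x) (auto simp: inv_kernelD(4)[OF A v])

lemma diag_closed:
  assumes "A \<in> kernels"
  shows "l \<in> lists P \<Longrightarrow> diag A l \<in> carrier k"
  by (induction l) (auto simp: kernels_in_carrier[OF assms])

lemma diag_invariant:
  assumes A: "inv_kernel V A" and v: "v \<in> V"
  shows "l \<in> lists P \<Longrightarrow> diag A (map (hact X v) l) = diag A l"
  by (induction l) (auto simp: inv_kernelD(4)[OF A v])

lemma inv_fun_path:
  assumes A: "inv_kernel V A" and xz: "x \<in> P" "z \<in> P"
  shows "inv_fun L (stab X (stab X V x) z) (lists_of X n) (\<lambda>l. path A x l z)"
  unfolding inv_fun_def
proof (intro conjI ballI funcsetI)
  have Ak: "A \<in> kernels" using A by (auto simp: kernels_def)
  fix l assume "l \<in> lists_of X n"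
  hence l: "l \<in> lists P" by (simp add: lists_of_def)
  show "path A x l z \<in> carrier k" by (rule path_closed[OF Ak xz l])
  show "path A x (hact L v l) z = path A x l z" if "v \<in> stab X (stab X V x) z" for v
    using path_invariant[OF A _ xz l, of v] that by (simp add: stab_def L_act[OF l])
qed

lemma inv_fun_cycle:
  assumes A: "inv_kernel V A"
  shows "inv_fun L V (lists_of X n) (cycle A)"
  unfolding inv_fun_def
proof (intro conjI ballI funcsetI)
  have Ak: "A \<in> kernels" using A by (auto simp: kernels_def)
  fix l assume "l \<in> lists_of X n"
  hence l: "l \<in> lists P" by (simp add: lists_of_def)
  show "cycle A l \<in> carrier k" using path_closed[OF Ak] l by (cases l) auto
  show "cycle A (hact L v l) = cycle A l" if "v \<in> V" for v
    unfolding L_act[OF l] using path_invariant[OF A that] l by (cases l) auto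
qed

lemma inv_fun_diag:
  assumes A: "inv_kernel V A"
  shows "inv_fun L V (lists_of X n) (diag A)"
  unfolding inv_fun_def
proof (intro conjI ballI funcsetI)
  have Ak: "A \<in> kernels" using A by (auto simp: kernels_def)
  fix l assume "l \<in> lists_of X n"
  hence l: "l \<in> lists P" by (simp add: lists_of_def)
  show "diag A l \<in> carrier k" by (rule diag_closed[OF Ak l])
  show "diag A (hact L v l) = diag A l" if "v \<in> V" for v
    unfolding L_act[OF l] by (rule diag_invariant[OF A that l])
qed

abbreviation kpow :: "('x \<times> 'x \<Rightarrow> 'k) \<Rightarrow> nat \<Rightarrow> 'x \<times> 'x \<Rightarrow> 'k" where
  "kpow A n \<equiv> A [^]\<^bsub>kernel_monoid\<^esub> n"

lemma kernel_monoid_simps [simp]: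
  "carrier kernel_monoid = kernels" "A \<otimes>\<^bsub>kernel_monoid\<^esub> B = kmult A B" "\<one>\<^bsub>kernel_monoid\<^esub> = kone"
  by (simp_all add: kernel_monoid_def)

lemma kpow_path:
  assumes A: "inv_kernel V A" and xz: "x \<in> P" "z \<in> P"
  shows "kpow A (Suc n) (x, z) = J n (\<lambda>l. path A x l z)"
  using xz(1)
proof (induction n arbitrary: x)
  case 0
  have Ak: "A \<in> kernels" using A by (auto simp: kernels_def)
  have "J 0 (\<lambda>l. path A x l z) = A (x, z)" using kernels_in_carrier[OF Ak 0 xz(2)] by (simp add: J_0)
  thus ?case using K.l_one[of A] Ak by simp
next
  case (Suc n)
  note V = inv_kernelD(1,2)[OF A]
  have Ak: "A \<in> kernels" using A by (auto simp: kernels_def)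
  have "kpow A (Suc (Suc n)) = kmult A (kpow A (Suc n))" using K.nat_pow_Suc2[of A "Suc n"] Ak by simp
  hence "kpow A (Suc (Suc n)) (x, z) = integ X P (\<lambda>y. A (x, y) \<otimes>\<^bsub>k\<^esub> kpow A (Suc n) (y, z))"
    by (simp only: kmult_apply[OF Suc.prems xz(2)])
  also have "\<dots> = integ X P (\<lambda>y. J n (\<lambda>l. path A x (y # l) z))"
  proof (rule integ_cong)
    fix y assume y: "y \<in> P"
    have "A (x, y) \<otimes>\<^bsub>k\<^esub> kpow A (Suc n) (y, z) = A (x, y) \<otimes>\<^bsub>k\<^esub> J n (\<lambda>l. path A y l z)"
      by (simp only: Suc.IH[OF y])
    also have "\<dots> = J n (\<lambda>l. A (x, y) \<otimes>\<^bsub>k\<^esub> path A y l z)"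
      by (rule integ_cmult[symmetric, OF fin_lists_of[OF two_point_stab[OF V y xz(2)]]
            inv_fun_path[OF A y xz(2)] kernels_in_carrier[OF Ak Suc.prems y]])
    finally show "A (x, y) \<otimes>\<^bsub>k\<^esub> kpow A (Suc n) (y, z) = J n (\<lambda>l. path A x (y # l) z)" by simp
  qed
  also have "\<dots> = J (Suc n) (\<lambda>l. path A x l z)"
    by (rule J_Suc(1)[symmetric, OF two_point_stab[OF V Suc.prems xz(2)] inv_fun_path[OF A Suc.prems xz(2)]])
  finally show ?case .
qed

lemma ktrace_kpow:
  assumes A: "inv_kernel V A"
  shows "ktrace (kpow A (Suc n)) = J (Suc n) (cycle A)"
proof -
  have "J (Suc n) (cycle A) = integ X P (\<lambda>x. J n (\<lambda>l. cycle A (x # l)))"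
    by (rule J_Suc(1)[OF inv_kernelD(1,2)[OF A] inv_fun_cycle[OF A]])
  also have "\<dots> = ktrace (kpow A (Suc n))"
    unfolding ktrace_def by (rule integ_cong) (simp only: kpow_path[OF A] cycle.simps)
  finally show ?thesis by simp
qed

lemma inv_fun_trace:
  assumes A: "inv_kernel V A"
  shows "inv_fun X V P (\<lambda>x. A (x, x))"
  using inv_kernelD[OF A] by (auto simp: inv_fun_def)

lemma ktrace_closed:
  assumes A: "inv_kernel V A" shows "ktrace A \<in> carrier k"
  unfolding ktrace_def by (rule integ_closed[OF X_fin_on[OF inv_kernelD(1,2)[OF A]] inv_fun_trace[OF A]])

lemma ktrace_power:
  assumes A: "inv_kernel V A"
  shows "ktrace A [^]\<^bsub>k\<^esub> n = J n (diag A)"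
proof (induction n)
  case 0
  show ?case by (simp add: J_0)
next
  case (Suc n)
  note V = inv_kernelD(1,2)[OF A]
  have Ak: "A \<in> kernels" using A by (auto simp: kernels_def)
  let ?t = "ktrace A [^]\<^bsub>k\<^esub> n"
  have t: "?t \<in> carrier k" using ktrace_closed[OF A] by simp
  have "J (Suc n) (diag A) = integ X P (\<lambda>x. J n (\<lambda>l. A (x, x) \<otimes>\<^bsub>k\<^esub> diag A l))"
    using J_Suc(1)[OF V inv_fun_diag[OF A], of n] by simp
  also have "\<dots> = integ X P (\<lambda>x. ?t \<otimes>\<^bsub>k\<^esub> A (x, x))"
  proof (rule integ_cong)
    fix x assume x: "x \<in> P"
    have "J n (\<lambda>l. A (x, x) \<otimes>\<^bsub>k\<^esub> diag A l) = A (x, x) \<otimes>\<^bsub>k\<^esub> J n (diag A)"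
      by (rule integ_cmult[OF fin_lists_of[OF V] inv_fun_diag[OF A] kernels_in_carrier[OF Ak x x]])
    thus "J n (\<lambda>l. A (x, x) \<otimes>\<^bsub>k\<^esub> diag A l) = ?t \<otimes>\<^bsub>k\<^esub> A (x, x)"
      using t kernels_in_carrier[OF Ak x x] by (simp add: Suc.IH[symmetric] k.m_comm)
  qed
  also have "\<dots> = ?t \<otimes>\<^bsub>k\<^esub> integ X P (\<lambda>x. A (x, x))"
    by (rule integ_cmult[OF X_fin_on[OF V] inv_fun_trace[OF A] t])
  also have "\<dots> = ?t \<otimes>\<^bsub>k\<^esub> ktrace A" by (simp only: ktrace_def)
  finally show ?case by simp
qed

lemma path_snoc:
  assumes A: "A \<in> kernels"
  shows "x \<in> P \<Longrightarrow> y \<in> P \<Longrightarrow> z \<in> P \<Longrightarrow> l \<in> lists P \<Longrightarrow>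
    path A x (l @ [y]) z = path A x l y \<otimes>\<^bsub>k\<^esub> A (y, z)"
  by (induction l arbitrary: x) (auto simp: kernels_in_carrier[OF A] path_closed[OF A] k.m_assoc)

lemma cycle_rotate1:
  assumes A: "A \<in> kernels" and l: "l \<in> lists P"
  shows "cycle A (rotate1 l) = cycle A l"
proof (cases l rule: list.exhaust)
  case (Cons x l')
  show ?thesis
  proof (cases l')
    case Nil
    thus ?thesis using Cons by simp
  next
    case (Cons y l'')
    thus ?thesis using \<open>l = x # l'\<close> l A
      by (simp add: path_snoc path_closed kernels_in_carrier k.m_comm)
  qed
qed simp

lemma diag_snoc:
  assumes A: "A \<in> kernels" and x: "x \<in> P"
  shows "l \<in> lists P \<Longrightarrow> diag A (l @ [x]) = A (x, x) \<otimes>\<^bsub>k\<^esub> diag A l"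
  by (induction l) (auto simp: x kernels_in_carrier[OF A] diag_closed[OF A] k.m_lcomm)

lemma diag_rotate1:
  assumes A: "A \<in> kernels" and l: "l \<in> lists P"
  shows "diag A (rotate1 l) = diag A l"
  using l by (cases l) (auto simp: diag_snoc[OF A])

text \<open>A list that is fixed by a rotation by one step is constant.\<close>

lemma cycle_eq_diag:
  assumes A: "A \<in> kernels" and l: "l \<in> lists P" and rot: "rotate1 l = l"
  shows "cycle A l = diag A l"
proof (cases l)
  case (Cons x l')
  have "l' @ [x] = x # l' \<Longrightarrow> l' \<in> lists P \<Longrightarrow> path A x l' x = A (x, x) \<otimes>\<^bsub>k\<^esub> diag A l'" for l'
  proof (induction l')
    case Nil
    thus ?case using Cons l by (simp add: kernels_in_carrier[OF A])
  next
    case (Cons y l'')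
    thus ?case by simp
  qed
  thus ?thesis using Cons l rot by simp
qed simp

text \<open>Both sides are integrals over lists of length \<open>p\<close>, and both localize at the lists fixed by rotation,
  where the integrands agree.\<close>

theorem ktrace_prime_power:
  fixes p :: nat
  assumes p: "prime p" and char: "[p] \<cdot>\<^bsub>k\<^esub> \<one>\<^bsub>k\<^esub> = \<zero>\<^bsub>k\<^esub>" and A: "A \<in> kernels"
  shows "ktrace (kpow A p) = ktrace A [^]\<^bsub>k\<^esub> p"
proof -
  from A obtain V where V: "inv_kernel V A" by (auto simp: kernels_def)
  note oV = inv_kernelD(1,2)[OF V]
  let ?S = "lists_of X p"
  have Sl: "l \<in> lists P" if "l \<in> ?S" for l using that by (simp add: lists_of_def)
  have loc: "J p F = integ L {l \<in> ?S. rotate1 l = l} F"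
    if F: "inv_fun L V ?S F" and rot: "\<And>l. l \<in> lists P \<Longrightarrow> F (rotate1 l) = F l" for F
  proof (rule integ_fixed_points[OF p char fin_lists_of[OF oV] F])
    fix l assume l: "l \<in> ?S"
    show "rotate1 l \<in> ?S" using l by (auto simp: lists_of_def)
    hence r: "rotate1 l \<in> lists P" by (rule Sl)
    show "rotate1 (hact L v l) = hact L v (rotate1 l)" for v
      by (simp add: L_act[OF Sl[OF l]] L_act[OF r] rotate1_map)
    have "rotate p l = l" using l by (intro rotate_id) (simp add: lists_of_def)
    thus "(rotate1 ^^ p) l = l" by (simp add: rotate_def)
    show "F (rotate1 l) = F l" by (rule rot[OF Sl[OF l]])
  qed
  obtain n where n: "p = Suc n" using p by (cases p) auto
  have "ktrace (kpow A p) = J p (cycle A)" unfolding n by (rule ktrace_kpow[OF V])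
  also have "\<dots> = integ L {l \<in> ?S. rotate1 l = l} (cycle A)"
    by (rule loc[OF inv_fun_cycle[OF V] cycle_rotate1[OF A]])
  also have "\<dots> = integ L {l \<in> ?S. rotate1 l = l} (diag A)"
    using Sl by (intro integ_cong cycle_eq_diag[OF A]) auto
  also have "\<dots> = J p (diag A)"
    by (rule loc[OF inv_fun_diag[OF V] diag_rotate1[OF A], symmetric])
  also have "\<dots> = ktrace A [^]\<^bsub>k\<^esub> p" by (rule ktrace_power[OF V, symmetric])
  finally show ?thesis .
qed

lemma kmult_kzero:
  assumes B: "B \<in> kernels" shows "kmult kzero B = kzero"
proof (rule kernel_eqI[OF kmult_closed[OF kzero_closed B] kzero_closed])
  fix x z assume xz: "x \<in> P" "z \<in> P"
  have "kmult kzero B (x, z) = integ X P (\<lambda>_. \<zero>\<^bsub>k\<^esub>)"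
    unfolding kmult_apply[OF xz] using xz kernels_in_carrier[OF B] by (intro integ_cong) (simp add: kzero_def)
  also have "\<dots> = \<zero>\<^bsub>k\<^esub>"
    using X_fin_on[OF open_U order_refl] by (intro integ_zero) (auto simp: definable_def)
  finally show "kmult kzero B (x, z) = kzero (x, z)" using xz by (simp add: kzero_def)
qed

text \<open>Raise the exponent to a power of \<open>p\<close> that is at least \<open>n\<close>.\<close>

theorem ktrace_nilpotent_char_p:
  fixes p n :: nat
  assumes p: "prime p" and char: "[p] \<cdot>\<^bsub>k\<^esub> \<one>\<^bsub>k\<^esub> = \<zero>\<^bsub>k\<^esub>" and red: "reduced_ring k"
    and A: "A \<in> kernels" and nil: "kpow A n = kzero"
  shows "ktrace A = \<zero>\<^bsub>k\<^esub>"
proof -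
  have Ap: "kpow A m \<in> kernels" for m using K.nat_pow_closed[of A m] A by simp
  have iter: "ktrace (kpow A (p ^ e)) = ktrace A [^]\<^bsub>k\<^esub> (p ^ e)" for e
  proof (induction e)
    case 0
    show ?case using K.nat_pow_eone[of A] A ktrace_closed by (auto simp: kernels_def)
  next
    case (Suc e)
    have tc: "ktrace A \<in> carrier k" using A ktrace_closed by (auto simp: kernels_def)
    have "ktrace (kpow A (p ^ Suc e)) = ktrace (kpow (kpow A (p ^ e)) p)"
      using K.nat_pow_pow[of A "p ^ e" p] A by (simp add: mult.commute)
    also have "\<dots> = (ktrace A [^]\<^bsub>k\<^esub> (p ^ e)) [^]\<^bsub>k\<^esub> p"
      by (simp add: ktrace_prime_power[OF p char Ap] Suc.IH)
    finally show ?case using tc by (simp add: k.nat_pow_pow mult.commute)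
  qed
  have "2 ^ n \<le> p ^ n" using prime_ge_2_nat[OF p] by (intro power_mono) simp_all
  hence "n \<le> p ^ n" using less_exp[of n] by linarith
  hence "kpow A (p ^ n) = kmult (kpow A n) (kpow A (p ^ n - n))"
    using K.nat_pow_mult[of A n "p ^ n - n"] A by simp
  hence "kpow A (p ^ n) = kzero" using nil kmult_kzero[OF Ap] by simp
  moreover have "ktrace kzero = integ X P (\<lambda>_. \<zero>\<^bsub>k\<^esub>)"
    unfolding ktrace_def by (rule integ_cong) (simp add: kzero_def)
  moreover have "integ X P (\<lambda>_. \<zero>\<^bsub>k\<^esub>) = \<zero>\<^bsub>k\<^esub>"
    using X_fin_on[OF open_U order_refl] by (intro integ_zero) (auto simp: definable_def)
  ultimately have "ktrace A [^]\<^bsub>k\<^esub> (p ^ n) = \<zero>\<^bsub>k\<^esub>" using iter[of n] by simp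
  moreover have "ktrace A \<in> carrier k" using A ktrace_closed by (auto simp: kernels_def)
  ultimately show ?thesis using red by (auto simp: reduced_ring_def nilpotent_elem_def)
qed


section \<open>Matrices as kernels\<close>

lemma hat_integral_eq:
  assumes V: "open_subgroup G T V" "V \<subseteq> U" and F: "inv_fun X V P F"
  shows "hat_integral G T k \<mu> X F = integ X P F"
proof -
  have "finite (F ` P)" by (rule inv_fun_finite_range[OF X_fin_on[OF V] F])
  moreover have "meas X {x \<in> P. F x = c} \<in> carrier k" for c
  proof -
    have "fin_on X V {x \<in> P. F x = c}"
      using act_closed V(2) inv_funD(2)[OF F] by (intro fin_on_subset[OF X_fin_on[OF V]]) auto
    thus ?thesis unfolding definable_def by (intro meas_closed) (auto simp: definable_def)
  qed
  ultimately show ?thesis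
    unfolding hat_integral_def integ_def meas_def[symmetric]
  proof (intro k.add.finprod_mono_neutral_cong_left)
    fix c assume "c \<in> F ` P - (F ` P - {\<zero>\<^bsub>k\<^esub>})"
    hence "c = \<zero>\<^bsub>k\<^esub>" by blast
    thus "c \<otimes>\<^bsub>k\<^esub> meas X {x \<in> P. F x = c} = \<zero>\<^bsub>k\<^esub>"
      using \<open>\<And>c. meas X {x \<in> P. F x = c} \<in> carrier k\<close> by simp
  qed (use inv_funD(1)[OF F] in auto)
qed

lemma hat_mat_kernels:
  assumes "A \<in> carrier (hat_mat G T k \<mu> X)" shows "A \<in> kernels"
proof -
  from assms have A: "A \<in> schwartz G T k (hat_prod X X)" by (simp add: hat_mat_def)
  then obtain V where V: "open_subgroup G T V" "V \<subseteq> U"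
    "\<And>v x y. v \<in> V \<Longrightarrow> x \<in> P \<Longrightarrow> y \<in> P \<Longrightarrow> A (hact (hat_prod X X) v (x, y)) = A (x, y)"
    by (auto simp: schwartz_def hat_prod_def)
  moreover have "A \<in> P \<times> P \<rightarrow>\<^sub>E carrier k" using A by (auto simp: schwartz_def hat_prod_def)
  ultimately have "inv_kernel V A" by (simp add: inv_kernel_def hat_prod_def)
  thus ?thesis by (auto simp: kernels_def)
qed

lemma hat_mat_mult:
  assumes "A \<in> kernels" "B \<in> kernels"
  shows "A \<otimes>\<^bsub>hat_mat G T k \<mu> X\<^esub> B = kmult A B"
proof -
  obtain V where A: "inv_kernel V A" and B: "inv_kernel V B" using common_kernel_group[OF assms] .
  note V = inv_kernelD(1,2)[OF A]
  have "hat_integral G T k \<mu> X (\<lambda>y \<in> P. A (x, y) \<otimes>\<^bsub>k\<^esub> B (y, z)) = integ X P (\<lambda>y. A (x, y) \<otimes>\<^bsub>k\<^esub> B (y, z))"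
    if xz: "x \<in> P" "z \<in> P" for x z
  proof -
    let ?W = "stab X (stab X V x) z"
    note W = two_point_stab[OF V xz]
    have "inv_fun X ?W P (\<lambda>y \<in> P. A (x, y) \<otimes>\<^bsub>k\<^esub> B (y, z))"
      using kmult_integrand[OF A B xz] act_closed W(2) by (auto simp: inv_fun_def Pi_def subset_iff)
    from hat_integral_eq[OF W this] show ?thesis by (simp cong: integ_cong)
  qed
  thus ?thesis by (auto simp: hat_mat_def kmult_def fun_eq_iff restrict_def)
qed

lemma hat_mat_pow:
  assumes A: "A \<in> kernels"
  shows "A [^]\<^bsub>hat_mat G T k \<mu> X\<^esub> (n :: nat) = kpow A n"
proof (induction n)
  case 0
  show ?case by (simp add: nat_pow_def hat_mat_def kone_def)
next
  case (Suc n)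
  have "kpow A n \<in> kernels" using K.nat_pow_closed[of A n] A by simp
  thus ?case using Suc A by (simp add: nat_pow_def hat_mat_mult)
qed

lemma hat_trace_eq:
  assumes A: "A \<in> kernels"
  shows "hat_trace G T k \<mu> X A = ktrace A"
proof -
  from A obtain V where V: "inv_kernel V A" by (auto simp: kernels_def)
  have "inv_fun X V P (\<lambda>x \<in> P. A (x, x))"
    using inv_fun_trace[OF V] act_closed inv_kernelD(2)[OF V] by (auto simp: inv_fun_def Pi_def subset_iff)
  from hat_integral_eq[OF inv_kernelD(1,2)[OF V] this] show ?thesis
    by (simp add: hat_trace_def ktrace_def cong: integ_cong)
qed

end


section \<open>Specialization of a measure\<close>

text \<open>A homomorphism that is defined only on a subring \<open>R\<close> containing the values of the measure still turns
  the measure into one with values in \<open>F\<close>.  Integrals are finite sums of products of values of the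
  function and of the measure, hence compatible with \<open>\<phi>\<close> as long as the function takes values in \<open>R\<close>.\<close>

locale hat_specialization = hat_matrices G T k \<mu> X + F: cring F
  for G :: "('g, 'm) monoid_scheme" (structure) and T :: "'g topology"
    and k :: "('k, 'n) ring_scheme" and \<mu> :: "('g, 'k) hat_fun" and X :: "('g, 'x) hat_set"
    and F :: "('f, 'q) ring_scheme" +
  fixes R :: "'k set" and \<phi> :: "'k \<Rightarrow> 'f"
  assumes R: "subring R k" and \<mu>_in_R: "\<And>Y. finitary_hat_set G T Y \<Longrightarrow> \<mu> Y \<in> R"
    and \<phi>: "\<phi> \<in> ring_hom (k\<lparr>carrier := R\<rparr>) F"
begin

lemma \<phi>_simps [simp]:
  "\<And>a. a \<in> R \<Longrightarrow> \<phi> a \<in> carrier F"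
  "\<And>a b. a \<in> R \<Longrightarrow> b \<in> R \<Longrightarrow> \<phi> (a \<oplus>\<^bsub>k\<^esub> b) = \<phi> a \<oplus>\<^bsub>F\<^esub> \<phi> b"
  "\<And>a b. a \<in> R \<Longrightarrow> b \<in> R \<Longrightarrow> \<phi> (a \<otimes>\<^bsub>k\<^esub> b) = \<phi> a \<otimes>\<^bsub>F\<^esub> \<phi> b"
  "\<phi> \<one>\<^bsub>k\<^esub> = \<one>\<^bsub>F\<^esub>"
  "\<phi> \<zero>\<^bsub>k\<^esub> = \<zero>\<^bsub>F\<^esub>"
proof -
  show "\<phi> \<zero>\<^bsub>k\<^esub> = \<zero>\<^bsub>F\<^esub>"
    using ring_hom_zero[OF \<phi> k.subring_is_ring[OF R] F.ring_axioms] by simp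
qed (use \<phi> in \<open>auto simp: ring_hom_def\<close>)

lemmas R_simps [simp] =
  subringE(2)[OF R] subringE(3)[OF R] subringE(6)[OF R] subringE(7)[OF R]

lemma R_carrier: "a \<in> R \<Longrightarrow> a \<in> carrier k"
  using subringE(1)[OF R] by blast

lemma mval_push: "mval G T (\<lambda>Y. \<phi> (\<mu> Y)) A = \<phi> (mval G T \<mu> A)"
  by (simp add: mval_def)

sublocale sp: hat_matrices G T F "\<lambda>Y. \<phi> (\<mu> Y)" X
proof unfold_locales
  show "hat_measure G T F (\<lambda>Y. \<phi> (\<mu> Y))"
    unfolding hat_measure_def mval_push
  proof (intro conjI allI impI; (elim conjE)?)
    fix Y Y' :: "('g, nat \<times> 'g set) hat_set"
    assume Y: "finitary_hat_set G T Y"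
    show "\<phi> (\<mu> Y) \<in> carrier F" by (simp add: \<mu>_in_R[OF Y])
    show "\<phi> (\<mu> Y) = \<one>\<^bsub>F\<^esub>" if "hpoints Y = {x}" for x using measure_point[of Y x] Y that by simp
    show "\<phi> (\<mu> (hat_conj G g Y)) = \<phi> (\<mu> Y)" if "g \<in> carrier G" for g
      using measure_conj[of Y g] Y that by simp
    assume Y': "finitary_hat_set G T Y'"
    show "\<phi> (\<mu> Y) = \<phi> (\<mu> Y')" if "hat_isomorphic G T Y Y'" using measure_iso[of Y Y'] Y Y' that by simp
    show "\<phi> (mval G T \<mu> (hat_sum Y Y')) = \<phi> (\<mu> Y) \<oplus>\<^bsub>F\<^esub> \<phi> (\<mu> Y')"
      using measure_sum[of Y Y'] Y Y' \<mu>_in_R by simp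
  next
    fix V f y and Y Y' :: "('g, nat \<times> 'g set) hat_set"
    assume V: "open_subgroup G T V" and Y: "transitive_hat_set G T V Y" "transitive_hat_set G T V Y'"
      and f: "f \<in> hpoints Y \<rightarrow> hpoints Y'" and y: "y \<in> hpoints Y'"
      and eq: "\<forall>u \<in> V. \<forall>x \<in> hpoints Y. f (hact Y u x) = hact Y' u (f x)"
    have fin: "fin_on Z V (hpoints Z) \<and> finitary_hat_set G T Z" if Z: "transitive_hat_set G T V Z"
      for Z :: "('g, nat \<times> 'g set) hat_set"
    proof -
      have hs: "is_hat_set G T Z" "hgroup Z = V" using Z by (simp_all add: transitive_hat_set_def)
      interpret tr: transitive_action "G\<lparr>carrier := V\<rparr>" "hpoints Z" "hact Z"
        using Z by (simp add: transitive_hat_set_def)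
      have st: "stable_on Z V (hpoints Z)"
        using hs hat_set_open[OF hs(1)] hact_closed[OF hs(1)] by (auto simp: stable_on_def)
      have "orb Z V x = hpoints Z" if "x \<in> hpoints Z" for x
      proof
        show "orb Z V x \<subseteq> hpoints Z" by (rule orb_subset[OF st that])
        show "hpoints Z \<subseteq> orb Z V x" using tr.unique_orbit[OF that] by (force simp: orb_def)
      qed
      hence "orb Z V ` hpoints Z \<subseteq> {hpoints Z}" by blast
      hence "finite (orb Z V ` hpoints Z)" by (rule finite_subset) simp
      hence "fin_on Z V (hpoints Z)" using st by (simp add: fin_on_def)
      thus ?thesis using finitary_iff[of Z] hs(2) by simp
    qed
    have "fin_on Y (stab Y' V y) {x \<in> hpoints Y. f x = y}"
      using f eq y fin[OF Y(1)] fin[OF Y(2)]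
      by (intro fin_on_fiber[of Y V "hpoints Y" Y' "hpoints Y'"]) (auto simp: fin_on_def)
    hence "finitary_hat_set G T (hat_sub Y {x \<in> hpoints Y. f x = y})"
      by (intro finitary_hat_sub) (auto simp: definable_def)
    moreover have "\<mu> Y = \<mu> (hat_sub Y {x \<in> hpoints Y. f x = y}) \<otimes>\<^bsub>k\<^esub> \<mu> Y'"
      using V Y f y eq by (intro measure_fiber[of V]) simp
    ultimately show "\<phi> (\<mu> Y) = \<phi> (\<mu> (hat_sub Y {x \<in> hpoints Y. f x = y})) \<otimes>\<^bsub>F\<^esub> \<phi> (\<mu> Y')"
      using fin[OF Y(2)] \<mu>_in_R by simp
  qed
qed (rule finitary)

lemma finsum_push:
  assumes "finite I" "h \<in> I \<rightarrow> R"
  shows "(\<Oplus>\<^bsub>k\<^esub>i \<in> I. h i) \<in> R \<and> \<phi> (\<Oplus>\<^bsub>k\<^esub>i \<in> I. h i) = (\<Oplus>\<^bsub>F\<^esub>i \<in> I. \<phi> (h i))"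
  using assms
proof (induction I rule: finite_induct)
  case (insert a I)
  moreover have "h \<in> insert a I \<rightarrow> carrier k" using insert.prems R_carrier by auto
  ultimately show ?case by (auto simp: Pi_def)
qed simp

lemma meas_push:
  assumes "definable Y S"
  shows "meas Y S \<in> R" "sp.meas Y S = \<phi> (meas Y S)"
proof -
  from assms obtain V where "fin_on Y V S" by (auto simp: definable_def)
  then obtain e Z where Z: "copy_of Y V S e Z" by (rule copy_exists)
  hence "\<mu> Z \<in> R" by (intro \<mu>_in_R) (simp add: copy_of_def)
  thus "meas Y S \<in> R" by (simp add: meas_copy[OF Z])
  show "sp.meas Y S = \<phi> (meas Y S)" by (simp add: sp.meas_def meas_def mval_push)
qed

lemma integ_push:
  assumes S: "fin_on Y V S" and f: "inv_fun Y V S f" and fR: "\<And>x. x \<in> S \<Longrightarrow> f x \<in> R"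
  shows "integ Y S f \<in> R" "sp.integ Y S (\<lambda>x. \<phi> (f x)) = \<phi> (integ Y S f)"
proof -
  note st = fin_onD(1)[OF S]
  have f': "sp.inv_fun Y V S (\<lambda>x. \<phi> (f x))"
    using inv_funD(2)[OF f] fR by (auto simp: sp.inv_fun_def)
  have vR: "orb_val f C \<in> R" if "C \<in> orb Y V ` S" for C
  proof -
    from that obtain x where x: "x \<in> S" "C = orb Y V x" by blast
    have "x \<in> C" unfolding x(2) by (rule orb_refl[OF st x(1)])
    thus ?thesis using orb_val(1)[OF st f that] fR[OF x(1)] by simp
  qed
  have mR: "meas Y C \<in> R" "sp.meas Y C = \<phi> (meas Y C)" if "C \<in> orb Y V ` S" for C
    using meas_push[OF orb_definable[OF st that]] by simp_all
  have t: "(\<lambda>C. orb_val f C \<otimes>\<^bsub>k\<^esub> meas Y C) \<in> orb Y V ` S \<rightarrow> R" using vR mR by auto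
  show "integ Y S f \<in> R" unfolding integ_orbits[OF S f] using finsum_push[OF fin_onD(2)[OF S] t] by simp
  have "sp.integ Y S (\<lambda>x. \<phi> (f x))
      = (\<Oplus>\<^bsub>F\<^esub>C \<in> orb Y V ` S. sp.orb_val (\<lambda>x. \<phi> (f x)) C \<otimes>\<^bsub>F\<^esub> sp.meas Y C)"
    by (rule sp.integ_orbits[OF S f'])
  also have "\<dots> = (\<Oplus>\<^bsub>F\<^esub>C \<in> orb Y V ` S. \<phi> (orb_val f C \<otimes>\<^bsub>k\<^esub> meas Y C))"
  proof (rule F.finsum_cong')
    fix C assume C: "C \<in> orb Y V ` S"
    have "sp.orb_val (\<lambda>x. \<phi> (f x)) C = \<phi> (orb_val f C)" by (simp add: sp.orb_val_def orb_val_def)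
    thus "sp.orb_val (\<lambda>x. \<phi> (f x)) C \<otimes>\<^bsub>F\<^esub> sp.meas Y C = \<phi> (orb_val f C \<otimes>\<^bsub>k\<^esub> meas Y C)"
      using vR[OF C] mR[OF C] by simp
  qed (use vR mR in auto)
  also have "\<dots> = \<phi> (integ Y S f)"
    unfolding integ_orbits[OF S f] using finsum_push[OF fin_onD(2)[OF S] t] by simp
  finally show "sp.integ Y S (\<lambda>x. \<phi> (f x)) = \<phi> (integ Y S f)" .
qed

definition push :: "('x \<times> 'x \<Rightarrow> 'k) \<Rightarrow> 'x \<times> 'x \<Rightarrow> 'f" where
  "push A = (\<lambda>p \<in> P \<times> P. \<phi> (A p))"

lemma push_inv_kernel:
  assumes A: "inv_kernel V A" and AR: "A ` (P \<times> P) \<subseteq> R"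
  shows "sp.inv_kernel V (push A)"
proof -
  have "A (x, y) \<in> R" if "x \<in> P" "y \<in> P" for x y using AR that by blast
  moreover have "hact X v x \<in> P" if "v \<in> V" "x \<in> P" for v x
    using act_closed inv_kernelD(2)[OF A] that by blast
  ultimately show ?thesis
    using inv_kernelD[OF A] by (auto simp: sp.inv_kernel_def push_def)
qed

lemma push_kmult:
  assumes A: "inv_kernel V A" and B: "inv_kernel V B"
    and AR: "A ` (P \<times> P) \<subseteq> R" and BR: "B ` (P \<times> P) \<subseteq> R"
  shows "kmult A B ` (P \<times> P) \<subseteq> R" "sp.kmult (push A) (push B) = push (kmult A B)"
proof -
  note V = inv_kernelD(1,2)[OF A]
  have A': "A (x, y) \<in> R" and B': "B (x, y) \<in> R" if "x \<in> P" "y \<in> P" for x y using AR BR that by blast+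
  have int: "integ X P (\<lambda>y. A (x, y) \<otimes>\<^bsub>k\<^esub> B (y, z)) \<in> R"
    "sp.integ X P (\<lambda>y. \<phi> (A (x, y) \<otimes>\<^bsub>k\<^esub> B (y, z))) = \<phi> (integ X P (\<lambda>y. A (x, y) \<otimes>\<^bsub>k\<^esub> B (y, z)))"
    if xz: "x \<in> P" "z \<in> P" for x z
    using xz A' B'
    by (intro integ_push[OF X_fin_on[OF two_point_stab[OF V xz]] kmult_integrand[OF A B xz]]; simp)+
  show "kmult A B ` (P \<times> P) \<subseteq> R" using int(1) by (auto simp: kmult_apply)
  show "sp.kmult (push A) (push B) = push (kmult A B)"
  proof (rule extensionalityI[where A = "P \<times> P"])
    fix p assume "p \<in> P \<times> P"
    then obtain x z where xz: "x \<in> P" "z \<in> P" "p = (x, z)" by blast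
    have "sp.kmult (push A) (push B) (x, z) = sp.integ X P (\<lambda>y. \<phi> (A (x, y) \<otimes>\<^bsub>k\<^esub> B (y, z)))"
      unfolding sp.kmult_apply[OF xz(1,2)] using xz A' B' by (intro sp.integ_cong) (simp add: push_def)
    thus "sp.kmult (push A) (push B) p = push (kmult A B) p"
      using int(2)[OF xz(1,2)] xz by (simp add: push_def kmult_apply)
  qed (simp_all add: push_def sp.kmult_def)
qed

lemma push_kpow:
  assumes A: "inv_kernel V A" and AR: "A ` (P \<times> P) \<subseteq> R"
  shows "kpow A n ` (P \<times> P) \<subseteq> R \<and> sp.kpow (push A) n = push (kpow A n)"
proof (induction n)
  case 0
  have "kone ` (P \<times> P) \<subseteq> R" "sp.kone = push kone"
    by (auto simp: kone_def sp.kone_def push_def fun_eq_iff)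
  thus ?case by simp
next
  case (Suc n)
  have "kpow A n \<in> kernels" using K.nat_pow_closed[of A n] A by (auto simp: kernels_def)
  moreover have "A \<in> kernels" using A by (auto simp: kernels_def)
  ultimately obtain W where "inv_kernel W (kpow A n)" "inv_kernel W A" by (rule common_kernel_group)
  from push_kmult[OF this] Suc AR show ?case by simp
qed

lemma push_ktrace:
  assumes A: "inv_kernel V A" and AR: "A ` (P \<times> P) \<subseteq> R"
  shows "ktrace A \<in> R" "sp.ktrace (push A) = \<phi> (ktrace A)"
proof -
  have A': "A (x, x) \<in> R" if "x \<in> P" for x using AR that by blast
  note i = integ_push[OF X_fin_on[OF inv_kernelD(1,2)[OF A]] inv_fun_trace[OF A] A']
  show "ktrace A \<in> R" unfolding ktrace_def by (rule i(1))
  have "sp.ktrace (push A) = sp.integ X P (\<lambda>x. \<phi> (A (x, x)))"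
    unfolding sp.ktrace_def by (rule sp.integ_cong) (simp add: push_def)
  thus "sp.ktrace (push A) = \<phi> (ktrace A)" using i(2) by (simp add: ktrace_def)
qed

lemma specialized_trace_zero:
  fixes p n :: nat
  assumes A: "A \<in> kernels" and AR: "A ` (P \<times> P) \<subseteq> R" and nil: "kpow A n = kzero"
    and p: "prime p" and char: "[p] \<cdot>\<^bsub>F\<^esub> \<one>\<^bsub>F\<^esub> = \<zero>\<^bsub>F\<^esub>" and red: "reduced_ring F"
  shows "\<phi> (ktrace A) = \<zero>\<^bsub>F\<^esub>"
proof -
  from A obtain V where V: "inv_kernel V A" by (auto simp: kernels_def)
  have "push A \<in> sp.kernels" using push_inv_kernel[OF V AR] by (auto simp: sp.kernels_def)
  moreover have "sp.kpow (push A) n = sp.kzero"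
    using push_kpow[OF V AR, of n] nil by (auto simp: push_def kzero_def sp.kzero_def fun_eq_iff)
  ultimately have "sp.ktrace (push A) = \<zero>\<^bsub>F\<^esub>" by (rule sp.ktrace_nilpotent_char_p[OF p char red])
  thus ?thesis by (simp add: push_ktrace[OF V AR])
qed

end


section \<open>Property (P)\<close>

lemma (in field) field_reduced: "reduced_ring R"
  unfolding reduced_ring_def nilpotent_elem_def
proof (intro allI impI, elim conjE exE)
  fix a and n :: nat assume a: "a \<in> carrier R" and "a [^] n = \<zero>"
  thus "a = \<zero>"
    by (induction n) (auto simp: integral_iff)
qed

text \<open>The least positive \<open>n\<close> with \<open>n 1 = 0\<close> is prime because there are no zero divisors.\<close>

lemma (in field) prime_char:
  assumes "positive_char R"
  obtains p :: nat where "prime p" "[p] \<cdot> \<one> = \<zero>"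
proof -
  define p where "p = (LEAST n :: nat. n > 0 \<and> [n] \<cdot> \<one> = \<zero>)"
  have ex: "\<exists>n :: nat. n > 0 \<and> [n] \<cdot> \<one> = \<zero>" using assms by (simp add: positive_char_def)
  have p: "p > 0" "[p] \<cdot> \<one> = \<zero>" using LeastI_ex[OF ex] by (auto simp: p_def)
  have least: "p \<le> n" if "n > 0" "[n] \<cdot> \<one> = \<zero>" for n :: nat
    unfolding p_def using that by (intro Least_le) simp
  have "p \<noteq> 1" using p(2) by auto
  moreover have "m = 1 \<or> m = p" if "m dvd p" for m
  proof -
    from that obtain j where j: "p = m * j" by blast
    have "([m] \<cdot> \<one>) \<otimes> ([j] \<cdot> \<one>) = [m] \<cdot> ([j] \<cdot> \<one>)"
      using add_pow_ldistr[of \<one> "[j] \<cdot> \<one>" m] by simp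
    also have "\<dots> = [p] \<cdot> \<one>" unfolding j using add.nat_pow_pow[of \<one> m j] by (simp add: mult.commute)
    finally have "[m] \<cdot> \<one> = \<zero> \<or> [j] \<cdot> \<one> = \<zero>" using p(2) integral[of "[m] \<cdot> \<one>" "[j] \<cdot> \<one>"] by simp
    hence "p \<le> m \<or> p \<le> j" using least[of m] least[of j] p(1) j by (auto intro: Nat.gr0I)
    moreover have "m \<le> p" "j \<le> p" using p(1) j by (auto intro!: Nat.gr0I)
    ultimately show ?thesis using p(1) j by auto
  qed
  ultimately have "prime p" using p(1) by (auto simp: prime_nat_iff)
  thus ?thesis using p(2) by (rule that)
qed

theorem theorem7p11:
  fixes G :: "('g, 'm) monoid_scheme" and T :: "'g topology"
    and k :: "('k, 'n) ring_scheme" and \<mu> :: "('g, 'k) hat_fun"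
    and X :: "('g, 'x) hat_set" and A :: "'x \<times> 'x \<Rightarrow> 'k"
  assumes "pro_oligomorphic G T"
    and "cring k"
    and "hat_measure G T k \<mu>"
    and "finitary_hat_set G T X"
    and "reduced_ring k"
    and "measure_property_P G T k \<mu>"
    and "A \<in> carrier (hat_mat G T k \<mu> X)"
    and "nilpotent_elem (hat_mat G T k \<mu> X) A"
  shows "hat_trace G T k \<mu> X A = \<zero>\<^bsub>k\<^esub>"
proof -
  have "group G" using assms(1) by (simp add: pro_oligomorphic_def topological_group_def)
  then interpret M: hat_matrices G T k \<mu> X
    using assms(1-4)
    by (simp add: hat_matrices_def hat_integration_def pro_oligomorphic_group_def
        pro_oligomorphic_group_axioms_def hat_integration_axioms_def hat_matrices_axioms_def)
  let ?P = "hpoints X"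
  have A: "A \<in> M.kernels" by (rule M.hat_mat_kernels[OF assms(7)])
  then obtain V where V: "M.inv_kernel V A" by (auto simp: M.kernels_def)
  obtain n :: nat where n: "M.kpow A n = M.kzero"
    using assms(8) M.hat_mat_pow[OF A] by (auto simp: nilpotent_elem_def hat_mat_def M.kzero_def)
  obtain S where S: "subring S k" "generate_ring k {\<mu> Y | Y. finitary_hat_set G T Y} \<subseteq> S"
    "property_P (k\<lparr>carrier := S\<rparr>)"
    using assms(6) by (auto simp: measure_property_P_def)
  define E where "E = A ` (?P \<times> ?P)"
  define R where "R = generate_ring k (S \<union> E)"
  have Ek: "E \<subseteq> carrier k" using M.kernels_in_carrier[OF A] by (auto simp: E_def)
  hence SE: "S \<union> E \<subseteq> carrier k" using subringE(1)[OF S(1)] by blast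
  have R: "subring R k" unfolding R_def by (rule M.k.generate_ring_is_subring[OF SE])
  have SR: "S \<union> E \<subseteq> R" unfolding R_def by (auto intro: generate_ring.incl)
  have \<mu>R: "\<mu> Y \<in> R" if "finitary_hat_set G T Y" for Y
  proof -
    have "\<mu> Y \<in> generate_ring k {\<mu> Y | Y. finitary_hat_set G T Y}"
      by (rule generate_ring.incl) (use that in blast)
    thus ?thesis using S(2) SR by blast
  qed
  \<comment> \<open>The entries are the values of an invariant function on the lists of length two.\<close>
  have "finite E"
  proof -
    note oV = M.inv_kernelD(1,2)[OF V]
    let ?F = "\<lambda>l. A (l ! 0, l ! 1)"
    have "M.inv_fun (hat_lists X) V (lists_of X 2) ?F"
      using M.inv_kernelD[OF V] M.L_act
      by (auto simp: M.inv_fun_def lists_of_def length_Suc_conv numeral_2_eq_2)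
    from M.inv_fun_finite_range[OF M.fin_lists_of[OF oV] this]
    have "finite (?F ` lists_of X 2)" .
    moreover have "E \<subseteq> ?F ` lists_of X 2"
    proof
      fix c assume "c \<in> E"
      then obtain x y where "x \<in> ?P" "y \<in> ?P" "c = ?F [x, y]" by (auto simp: E_def)
      thus "c \<in> ?F ` lists_of X 2" by (intro image_eqI[of _ _ "[x, y]"]) (auto simp: lists_of_def)
    qed
    ultimately show ?thesis by (rule finite_subset[rotated])
  qed
  moreover have cR: "cring (k\<lparr>carrier := R\<rparr>)"
    using M.k.subcring_iff[OF subringE(1)[OF R]] M.k.subcringI'[OF R] by simp
  moreover have "id \<in> ring_hom (k\<lparr>carrier := S\<rparr>) (k\<lparr>carrier := R\<rparr>)"
    using SR by (auto simp: ring_hom_def)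
  moreover have "R = generate_ring (k\<lparr>carrier := R\<rparr>) (S \<union> E)"
    using M.k.subring_gen_equality[OF R SR] by (simp add: R_def)
  ultimately have fg: "fg_algebra_via (k\<lparr>carrier := S\<rparr>) (k\<lparr>carrier := R\<rparr>) id"
    unfolding fg_algebra_via_def using SR by (auto intro!: exI[of _ E])
  have red: "reduced_ring (k\<lparr>carrier := R\<rparr>)"
    using assms(5) subringE(1)[OF R] by (auto simp: reduced_ring_def nilpotent_elem_def nat_pow_def)
  have AR: "A ` (?P \<times> ?P) \<subseteq> R" using SR by (simp add: E_def)
  have kill: "\<phi> (M.ktrace A) = \<zero>\<^bsub>F\<^esub>"
    if F: "field F" "positive_char F" and \<phi>: "\<phi> \<in> ring_hom (k\<lparr>carrier := R\<rparr>) F" for F :: "'k list ring" and \<phi>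
  proof -
    interpret F: field F by (rule F(1))
    interpret sp: hat_specialization G T k \<mu> X F R \<phi>
      using M.hat_matrices_axioms F.cring_axioms R \<mu>R \<phi>
      by (simp add: hat_specialization_def hat_specialization_axioms_def)
    obtain p :: nat where p: "prime p" "[p] \<cdot>\<^bsub>F\<^esub> \<one>\<^bsub>F\<^esub> = \<zero>\<^bsub>F\<^esub>" using F.prime_char[OF F(2)] .
    show ?thesis by (rule sp.specialized_trace_zero[OF A AR n p F.field_reduced])
  qed
  \<comment> \<open>The trace is a sum of products of entries and measures; formally, specialize along the identity
    of \<open>R\<close>.\<close>
  have "M.ktrace A \<in> R"
  proof -
    interpret id: hat_specialization G T k \<mu> X "k\<lparr>carrier := R\<rparr>" R id
      using cR R \<mu>R M.hat_matrices_axioms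
      by (simp add: hat_specialization_def hat_specialization_axioms_def ring_hom_def)
    show ?thesis by (rule id.push_ktrace(1)[OF V AR])
  qed
  hence "M.ktrace A \<in> {r \<in> carrier (k\<lparr>carrier := R\<rparr>). \<forall>(F :: 'k list ring) \<phi>.
      field F \<and> positive_char F \<and> \<phi> \<in> ring_hom (k\<lparr>carrier := R\<rparr>) F
        \<longrightarrow> r \<in> a_kernel (k\<lparr>carrier := R\<rparr>) F \<phi>}"
    using kill by (auto simp: a_kernel_def')
  hence "M.ktrace A = \<zero>\<^bsub>k\<^esub>" unfolding property_P_any_algebra[OF S(3) fg red] by simp
  thus ?thesis by (simp add: M.hat_trace_eq[OF A])
qed

end
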